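(* Let $n\ge 2$. For every $J\subseteq[n-2]$, the set $D_{n-1,J}^{-1}C_n$ is a fine set for the representation $S^{Z_{n-1,J}}\uparrow^{\mathfrak{S}_n}$ (induced from $\mathfrak{S}_{n-1}$ to $\mathfrak{S}_n$).
   Context: $\mathfrak{S}_{n-1}$ is identified with the subgroup of $\mathfrak{S}_n$ of permutations fixing $n$. For $\pi\in\mathfrak{S}_m$, $\mathrm{Des}(\pi)=\{i:\pi(i)>\pi(i+1)\}$; $D_{m,J}=\{\pi\in\mathfrak{S}_m:\mathrm{Des}(\pi)=J\}$ and $D_{m,J}^{-1}=\{\pi^{-1}:\pi\in D_{m,J}\}$, here viewed inside $\mathfrak{S}_n$ for $m=n-1$. Let $c$ be the $n$-cycle $(1,2,\dots,n)$ and $C_n=\{c^k:0\le k<n\}$. Permutations are multiplied as functions, $(\pi\sigma)(i)=\pi(\sigma(i))$, and $AB=\{\pi\sigma:\pi\in A,\sigma\in B\}$. For $D\subseteq[n-1]$, $F_{n,D}=\sum x_{i_1}\cdots x_{i_n}$ over $i_1\le\dots\le i_n$ with $i_j<i_{j+1}$ for $j\in D$; for a (multi)set $\mathcal{B}\subseteq\mathfrak{S}_n$, $\mathcal{Q}(\mathcal{B})=\sum_{b\in\mathcal{B}}F_{n,\mathrm{Des}(b)}$ (with multiplicity). $\mathcal{B}$ is fine for a representation $\rho$ if $\mathcal{Q}(\mathcal{B})=\mathrm{ch}(\chi^\rho)$, the Frobenius characteristic. $Z_{m,J}$ is the ribbon with $m$ cells labeled $1,\dots,m$ increasing in the northeast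 direction (English notation), cell $i+1$ immediately above cell $i$ if $i\in J$ and immediately to its right otherwise; $S^{Z}$ is the skew Specht module of $Z$, whose Frobenius image is the skew Schur function $s_Z$. *)

theory Defs
  imports Complex_Main
    "HOL-Library.Multiset"
    "HOL-Library.Function_Algebras"
    "HOL-Combinatorics.Permutations"
    "HOL-Combinatorics.Cycles"
    "HOL-Combinatorics.Orbits"
begin

section \<open>Permutations\<close>

text \<open>
  A permutation of \<open>[n]\<close> is a function \<open>nat \<Rightarrow> nat\<close> that permutes \<open>{1..n}\<close> (and is the identity
  outside). Hence the permutations of \<open>{1..n - 1}\<close> literally are the permutations of \<open>{1..n}\<close>
  that fix \<open>n\<close>, and the product \<open>\<pi> \<sigma>\<close> is \<open>\<pi> \<circ> \<sigma>\<close>.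
\<close>

definition Sym :: "nat \<Rightarrow> (nat \<Rightarrow> nat) set" where
  "Sym n = {p. p permutes {1..n}}"

definition Des :: "nat \<Rightarrow> (nat \<Rightarrow> nat) \<Rightarrow> nat set" where
  "Des n p = {i. 1 \<le> i \<and> i < n \<and> p i > p (i + 1)}"

definition descent_class :: "nat \<Rightarrow> nat set \<Rightarrow> (nat \<Rightarrow> nat) set" where
  "descent_class m J = {p \<in> Sym m. Des m p = J}"

definition inverse_descent_class :: "nat \<Rightarrow> nat set \<Rightarrow> (nat \<Rightarrow> nat) set" where
  "inverse_descent_class m J = inv ` descent_class m J"

definition long_cycle :: "nat \<Rightarrow> nat \<Rightarrow> nat" where
  "long_cycle n = cycle_of_list [1..<Suc n]"

definition cyclic_subgroup :: "nat \<Rightarrow> (nat \<Rightarrow> nat) set" where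
  "cyclic_subgroup n = {long_cycle n ^^ k | k. k < n}"

definition set_product :: "(nat \<Rightarrow> nat) set \<Rightarrow> (nat \<Rightarrow> nat) set \<Rightarrow> (nat \<Rightarrow> nat) set" where
  "set_product A B = {p \<circ> q | p q. p \<in> A \<and> q \<in> B}"

definition cycle_type :: "nat \<Rightarrow> (nat \<Rightarrow> nat) \<Rightarrow> nat multiset" where
  "cycle_type n p = image_mset card (mset_set (orbit p ` {1..n}))"

section \<open>Formal power series in infinitely many variables\<close>

text \<open>
  The variables are indexed by \<^typ>\<open>nat\<close>, so they are \<open>x\<^sub>0, x\<^sub>1, \<dots>\<close>; only the order type of the
  index set matters. A monomial \<open>x\<^sub>a x\<^sub>b \<dots>\<close> is the multiset \<open>{#a, b, \<dots>#}\<close>, and a formal power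
  series maps each monomial to its coefficient. The library's \<open>*\<close> on functions is pointwise
  and is not the product of series; that is \<open>ps_mult\<close>.
\<close>

type_synonym series = "nat multiset \<Rightarrow> complex"

definition ps_one :: series where
  "ps_one M = (if M = {#} then 1 else 0)"

definition ps_mult :: "series \<Rightarrow> series \<Rightarrow> series" where
  "ps_mult f g M = (\<Sum>A | A \<subseteq># M. f A * g (M - A))"

definition power_sum :: "nat \<Rightarrow> series" where
  "power_sum k M = (if \<exists>i. M = replicate_mset k i then 1 else 0)"

definition power_sum_mset :: "nat multiset \<Rightarrow> series" where
  "power_sum_mset lam = foldr ps_mult (map power_sum (sorted_list_of_multiset lam)) ps_one"

text \<open>
  The coefficient of a monomial in the fundamental quasisymmetric function is the number of
  admissible index sequences with that monomial. The sequence \<open>i\<^sub>1 \<le> \<dots> \<le> i\<^sub>n\<close> is the list \<open>w\<close>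
  with \<open>i\<^sub>j = w ! (j - 1)\<close>.
\<close>

definition fundamental_qsym :: "nat \<Rightarrow> nat set \<Rightarrow> series" where
  "fundamental_qsym n D M =
     of_nat (card {w :: nat list. length w = n \<and> sorted w \<and>
                     (\<forall>j\<in>D. w ! (j - 1) < w ! j) \<and> mset w = M})"

definition qsym_of :: "nat \<Rightarrow> (nat \<Rightarrow> nat) multiset \<Rightarrow> series" where
  "qsym_of n B M = (\<Sum>b\<in>#B. fundamental_qsym n (Des n b) M)"

section \<open>Representations, characters and the Frobenius characteristic\<close>

record 'v rep =
  rep_smult :: "complex \<Rightarrow> 'v \<Rightarrow> 'v"
  rep_space :: "'v set"
  rep_act :: "(nat \<Rightarrow> nat) \<Rightarrow> 'v \<Rightarrow> 'v"

definition is_representation :: "(nat \<Rightarrow> nat) set \<Rightarrow> 'v::ab_group_add rep \<Rightarrow> bool" where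
  "is_representation G V \<longleftrightarrow>
     vector_space (rep_smult V) \<and>
     module.subspace (rep_smult V) (rep_space V) \<and>
     (\<exists>B. finite B \<and> module.span (rep_smult V) B = rep_space V) \<and>
     (\<forall>g\<in>G. \<forall>v\<in>rep_space V. rep_act V g v \<in> rep_space V) \<and>
     (\<forall>g\<in>G. \<forall>v\<in>rep_space V. \<forall>w\<in>rep_space V. rep_act V g (v + w) = rep_act V g v + rep_act V g w) \<and>
     (\<forall>g\<in>G. \<forall>c. \<forall>v\<in>rep_space V. rep_act V g (rep_smult V c v) = rep_smult V c (rep_act V g v)) \<and>
     (\<forall>v\<in>rep_space V. rep_act V id v = v) \<and>
     (\<forall>g\<in>G. \<forall>h\<in>G. \<forall>v\<in>rep_space V. rep_act V (g \<circ> h) v = rep_act V g (rep_act V h v))"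

text \<open>The trace of \<open>f\<close> on the subspace \<open>S\<close>, computed in an arbitrary basis of \<open>S\<close>.\<close>

definition trace_on :: "(complex \<Rightarrow> 'v \<Rightarrow> 'v) \<Rightarrow> 'v::ab_group_add set \<Rightarrow> ('v \<Rightarrow> 'v) \<Rightarrow> complex" where
  "trace_on scl S f =
     (let B = (SOME B. \<not> module.dependent scl B \<and> module.span scl B = S)
      in \<Sum>b\<in>B. module.representation scl B (f b) b)"

definition character :: "'v::ab_group_add rep \<Rightarrow> (nat \<Rightarrow> nat) \<Rightarrow> complex" where
  "character V g = trace_on (rep_smult V) (rep_space V) (rep_act V g)"

definition frobenius_ch :: "nat \<Rightarrow> ((nat \<Rightarrow> nat) \<Rightarrow> complex) \<Rightarrow> series" where
  "frobenius_ch n chi M =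
     (1 / fact n) * (\<Sum>p\<in>Sym n. chi p * power_sum_mset (cycle_type n p) M)"

definition fine_for :: "nat \<Rightarrow> (nat \<Rightarrow> nat) multiset \<Rightarrow> 'v::ab_group_add rep \<Rightarrow> bool" where
  "fine_for n B V \<longleftrightarrow> qsym_of n B = frobenius_ch n (character V)"

text \<open>
  The representation of \<open>G\<close> induced from a representation \<open>V\<close> of a subgroup \<open>H\<close>, in the function
  model: all \<open>f : G \<rightarrow> V\<close> with \<open>f (h g) = h \<cdot> f g\<close> for \<open>h \<in> H\<close> (extended by \<open>0\<close> outside \<open>G\<close>), where
  \<open>G\<close> acts by right translation. For finite \<open>G\<close> this is the tensor product of \<open>V\<close> with the
  group algebra of \<open>G\<close> over that of \<open>H\<close>: the elementary tensor of \<open>g\<close> and \<open>v\<close> corresponds to the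
  function supported on \<open>H g\<^sup>-\<^sup>1\<close> with value \<open>h \<cdot> v\<close> at \<open>h g\<^sup>-\<^sup>1\<close>.
\<close>

definition induced ::
  "(nat \<Rightarrow> nat) set \<Rightarrow> (nat \<Rightarrow> nat) set \<Rightarrow> 'v::ab_group_add rep \<Rightarrow> ((nat \<Rightarrow> nat) \<Rightarrow> 'v) rep" where
  "induced H G V =
     \<lparr> rep_smult = (\<lambda>c f g. rep_smult V c (f g)),
       rep_space = {f. (\<forall>g\<in>G. f g \<in> rep_space V) \<and> (\<forall>g. g \<notin> G \<longrightarrow> f g = 0) \<and>
                   (\<forall>h\<in>H. \<forall>g\<in>G. f (h \<circ> g) = rep_act V h (f g))},
       rep_act = (\<lambda>x f g. f (g \<circ> x)) \<rparr>"

section \<open>Skew Specht modules\<close>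

text \<open>
  A cell is a pair (row, column), with rows numbered downwards (English notation). A diagram is
  only relevant up to translation, so integer coordinates are used. A tableau of a shape with
  \<open>m\<close> cells is a bijective filling with \<open>1, \<dots>, m\<close>; outside the shape it takes the dummy value
  \<open>0\<close>, which every permutation of \<open>{1..m}\<close> fixes, so that \<open>\<pi> T\<close> is just \<open>\<pi> \<circ> T\<close>.
\<close>

type_synonym cell = "int \<times> int"
type_synonym tableau = "cell \<Rightarrow> nat"
type_synonym tabloid = "tableau set"

definition tableaux :: "nat \<Rightarrow> cell set \<Rightarrow> tableau set" where
  "tableaux m Z = {T. bij_betw T Z {1..m} \<and> (\<forall>z. z \<notin> Z \<longrightarrow> T z = 0)}"

definition row_of :: "cell set \<Rightarrow> int \<Rightarrow> cell set" where
  "row_of Z r = {z \<in> Z. fst z = r}"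

definition column_of :: "cell set \<Rightarrow> int \<Rightarrow> cell set" where
  "column_of Z c = {z \<in> Z. snd z = c}"

definition tabloid_of :: "nat \<Rightarrow> cell set \<Rightarrow> tableau \<Rightarrow> tabloid" where
  "tabloid_of m Z T = {T' \<in> tableaux m Z. \<forall>r. T' ` row_of Z r = T ` row_of Z r}"

definition column_stabilizer :: "nat \<Rightarrow> cell set \<Rightarrow> tableau \<Rightarrow> (nat \<Rightarrow> nat) set" where
  "column_stabilizer m Z T = {s \<in> Sym m. \<forall>c. s ` T ` column_of Z c = T ` column_of Z c}"

text \<open>
  Elements of the permutation module on tabloids are functions from tabloids to coefficients.
\<close>

definition polytabloid :: "nat \<Rightarrow> cell set \<Rightarrow> tableau \<Rightarrow> tabloid \<Rightarrow> complex" where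
  "polytabloid m Z T U =
     (\<Sum>s\<in>column_stabilizer m Z T. of_int (sign s) * of_bool (U = tabloid_of m Z (s \<circ> T)))"

definition fun_smult :: "complex \<Rightarrow> ('a \<Rightarrow> complex) \<Rightarrow> 'a \<Rightarrow> complex" where
  "fun_smult c f x = c * f x"

text \<open>
  A permutation \<open>\<pi>\<close> sends the basis vector of the tabloid \<open>U\<close> to that of \<open>\<pi> U\<close>, so the coefficient
  of \<open>\<pi> \<cdot> v\<close> at \<open>U\<close> is the coefficient of \<open>v\<close> at \<open>\<pi>\<^sup>-\<^sup>1 U\<close>.
\<close>

definition skew_specht :: "nat \<Rightarrow> cell set \<Rightarrow> (tabloid \<Rightarrow> complex) rep" where
  "skew_specht m Z =
     \<lparr> rep_smult = fun_smult,
       rep_space = module.span fun_smult (polytabloid m Z ` tableaux m Z),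
       rep_act = (\<lambda>p v U. v ((\<lambda>T. inv p \<circ> T) ` U)) \<rparr>"

text \<open>
  \<open>ribbon_cell J i\<close> is the position of the cell labelled \<open>i + 1\<close>; cell \<open>1\<close> is placed at the origin,
  and decreasing the row moves up.
\<close>

fun ribbon_cell :: "nat set \<Rightarrow> nat \<Rightarrow> cell" where
  "ribbon_cell J 0 = (0, 0)"
| "ribbon_cell J (Suc i) =
     (case ribbon_cell J i of (r, c) \<Rightarrow> if Suc i \<in> J then (r - 1, c) else (r, c + 1))"

definition ribbon :: "nat \<Rightarrow> nat set \<Rightarrow> cell set" where
  "ribbon m J = ribbon_cell J ` {..<m}"

section \<open>The constructions above yield representations\<close>

lemma vector_space_fun_smult: "vector_space fun_smult"
  by unfold_locales (auto simp: fun_smult_def fun_eq_iff algebra_simps)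

lemma is_representation_induced:
  assumes V: "is_representation (Sym m) V" and "m \<le> n"
  shows "is_representation (Sym n) (induced (Sym m) (Sym n) V)"
proof -
  let ?G = "Sym n" and ?H = "Sym m" and ?W = "induced (Sym m) (Sym n) V"
  let ?s = "\<lambda>c f g. rep_smult V c (f g)"
  have HG: "?H \<subseteq> ?G"
    using \<open>m \<le> n\<close> by (auto simp: Sym_def intro: permutes_subset)
  have comp: "g \<circ> h \<in> ?G" if "g \<in> ?G" "h \<in> ?G" for g h
    using that by (auto simp: Sym_def intro: permutes_compose)
  have comp': "g \<in> ?G" if "g \<circ> h \<in> ?G" "h \<in> ?G" for g h
  proof -
    have "(g \<circ> h) \<circ> inv h \<in> ?G"
      using that by (auto simp: Sym_def intro!: permutes_compose permutes_inv)
    moreover have "(g \<circ> h) \<circ> inv h = g"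
      using that(2) permutes_inv_o(1)[of h "{1..n}"] by (simp add: Sym_def comp_assoc)
    ultimately show ?thesis by simp
  qed
  interpret V: vector_space "rep_smult V" using V by (simp add: is_representation_def)
  have sub: "V.subspace (rep_space V)" using V by (simp add: is_representation_def)
  have ws: "rep_smult ?W = ?s" by (simp add: induced_def)
  interpret W: vector_space ?s
    by unfold_locales (auto simp: fun_eq_iff V.scale_right_distrib V.scale_left_distrib)
  have wsp: "rep_space ?W = {f. (\<forall>g\<in>?G. f g \<in> rep_space V) \<and> (\<forall>g. g \<notin> ?G \<longrightarrow> f g = 0) \<and>
                   (\<forall>h\<in>?H. \<forall>g\<in>?G. f (h \<circ> g) = rep_act V h (f g))}" by (simp add: induced_def)
  have wact: "rep_act ?W = (\<lambda>x f g. f (g \<circ> x))" by (simp add: induced_def)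
  have act_add: "rep_act V h (v + w) = rep_act V h v + rep_act V h w"
    if "h \<in> ?H" "v \<in> rep_space V" "w \<in> rep_space V" for h v w
    using V that by (simp add: is_representation_def)
  have act_scale: "rep_act V h (rep_smult V c v) = rep_smult V c (rep_act V h v)"
    if "h \<in> ?H" "v \<in> rep_space V" for h v c
    using V that by (simp add: is_representation_def)
  have act_0: "rep_act V h 0 = 0" if "h \<in> ?H" for h
    using act_scale[OF that V.subspace_0[OF sub], of 0] by simp
  have subW: "W.subspace (rep_space ?W)"
    unfolding W.subspace_def wsp
    using V.subspace_0[OF sub] V.subspace_add[OF sub] V.subspace_scale[OF sub]
    by (auto simp: act_add act_scale act_0)
  obtain B where B: "finite B" "V.span B = rep_space V"
    using V by (auto simp: is_representation_def)
  define d where "d = (\<lambda>(g::nat\<Rightarrow>nat) v x. if x = g then v else (0::'a))"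
  define D where "D = (\<lambda>(g,b). d g b) ` (?G \<times> B)"
  have finG: "finite ?G" by (simp add: Sym_def finite_permutations)
  have finD: "finite D" using B finG by (simp add: D_def)
  have dspan: "d g v \<in> W.span D" if "g \<in> ?G" "v \<in> V.span B" for g v
    using that(2)
  proof (induction rule: V.span_induct_alt)
    case base
    have "d g 0 = 0" by (auto simp: d_def)
    then show ?case by (metis W.span_zero)
  next
    case (step c b y)
    have "d g (rep_smult V c b + y) = ?s c (d g b) + d g y"
      by (auto simp: d_def fun_eq_iff)
    moreover have "d g b \<in> D" using step that by (auto simp: D_def)
    ultimately show ?case
      using step by (metis W.span_add W.span_scale W.span_base)
  qed
  have "rep_space ?W \<subseteq> W.span D"
  proof
    fix f assume f: "f \<in> rep_space ?W"
    have "f = (\<Sum>g\<in>?G. d g (f g))"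
    proof
      fix x
      have ev: "(\<Sum>g\<in>A. d g (f g)) x = (\<Sum>g\<in>A. d g (f g) x)" if "finite A" for A
        using that by (induction A) auto
      show "f x = (\<Sum>g\<in>?G. d g (f g)) x"
        unfolding ev[OF finG] using f finG by (auto simp: d_def wsp)
    qed
    also have "\<dots> \<in> W.span D"
      using f B by (intro W.span_sum dspan) (auto simp: wsp)
    finally show "f \<in> W.span D" .
  qed
  then have WD: "rep_space ?W \<subseteq> W.span D" .
  obtain E where E: "E \<subseteq> rep_space ?W" "W.independent E" "rep_space ?W \<subseteq> W.span E"
    by (rule W.basis_exists[of "rep_space ?W"])
  have "finite E"
    using W.independent_span_bound[OF finD E(2) subset_trans[OF E(1) WD]] by (rule conjunct1)
  moreover have "W.span E = rep_space ?W"
    by (rule W.span_subspace[OF E(1,3) subW])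
  ultimately have fin: "\<exists>B. finite B \<and> W.span B = rep_space ?W" by blast
  have act_closed: "rep_act ?W g f \<in> rep_space ?W" if "g \<in> ?G" "f \<in> rep_space ?W" for g f
  proof -
    have "f (h \<circ> x \<circ> g) = rep_act V h (f (x \<circ> g))" if "h \<in> ?H" "x \<in> ?G" for h x
      using \<open>f \<in> rep_space ?W\<close> comp[OF that(2) \<open>g \<in> ?G\<close>] that(1) by (simp add: wsp comp_assoc)
    moreover have "f (x \<circ> g) = 0" if "x \<notin> ?G" for x
      using \<open>f \<in> rep_space ?W\<close> comp'[OF _ \<open>g \<in> ?G\<close>] that by (auto simp: wsp)
    moreover have "f (x \<circ> g) \<in> rep_space V" if "x \<in> ?G" for x
      using \<open>f \<in> rep_space ?W\<close> comp[OF that \<open>g \<in> ?G\<close>] by (simp add: wsp)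
    ultimately show ?thesis by (simp add: wact wsp)
  qed
  show ?thesis
    unfolding is_representation_def ws
    by (intro conjI W.vector_space_axioms subW fin ballI allI act_closed)
       (simp_all add: wact fun_eq_iff comp_assoc)
qed

lemma Sym_inv_cancel:
  assumes "p \<in> Sym m"
  shows "inv p \<circ> (p \<circ> X) = X" "p \<circ> (inv p \<circ> X) = X" "inv (inv p) = p"
  using assms permutes_inv_o[of p "{1..m}"]
  by (simp_all add: Sym_def o_assoc permutes_inv_inv)

lemma is_representation_skew_specht:
  assumes "finite Z"
  shows "is_representation (Sym m) (skew_specht m Z)"
proof -
  interpret vector_space "fun_smult :: complex \<Rightarrow> (tabloid \<Rightarrow> complex) \<Rightarrow> _"
    by (rule vector_space_fun_smult)
  let ?W = "skew_specht m Z"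
  have s: "rep_smult ?W = fun_smult" and sp: "rep_space ?W = span (polytabloid m Z ` tableaux m Z)"
    and a: "rep_act ?W = (\<lambda>p v U. v ((\<lambda>T. inv p \<circ> T) ` U))"
    by (simp_all add: skew_specht_def)
  have "finite {T :: tableau. \<forall>z. (z \<in> Z \<longrightarrow> T z \<in> {1..m}) \<and> (z \<notin> Z \<longrightarrow> T z = 0)}"
    by (rule finite_set_of_finite_funs) (use assms in auto)
  then have "finite (tableaux m Z)"
    by (rule finite_subset[rotated]) (auto simp: tableaux_def dest: bij_betwE)
  then have fin: "finite (polytabloid m Z ` tableaux m Z)" by simp
  have tab: "p \<circ> T \<in> tableaux m Z" if "p \<in> Sym m" "T \<in> tableaux m Z" for p T
    using that permutes_imp_bij[of p "{1..m}"] permutes_not_in[of p "{1..m}" 0]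
    by (auto simp: tableaux_def Sym_def intro: bij_betw_trans)
  have inv_Sym: "inv p \<in> Sym m" if "p \<in> Sym m" for p
    using that by (simp add: Sym_def permutes_inv)
  note invo = Sym_inv_cancel
  have img1: "(\<lambda>T. p \<circ> T) ` tabloid_of m Z X \<subseteq> tabloid_of m Z (p \<circ> X)" if "p \<in> Sym m" for p X
  proof
    fix T assume "T \<in> (\<lambda>T. p \<circ> T) ` tabloid_of m Z X"
    then obtain Y where Y: "T = p \<circ> Y" "Y \<in> tableaux m Z" "\<And>r. Y ` row_of Z r = X ` row_of Z r"
      by (auto simp: tabloid_of_def)
    have "T ` row_of Z r = (p \<circ> X) ` row_of Z r" for r
      unfolding Y(1) image_comp[symmetric] Y(3) ..
    then show "T \<in> tabloid_of m Z (p \<circ> X)"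
      using tab[OF that Y(2)] Y(1) by (simp add: tabloid_of_def)
  qed
  have img: "(\<lambda>T. p \<circ> T) ` tabloid_of m Z X = tabloid_of m Z (p \<circ> X)" if p: "p \<in> Sym m" for p X
  proof
    show "tabloid_of m Z (p \<circ> X) \<subseteq> (\<lambda>T. p \<circ> T) ` tabloid_of m Z X"
    proof
      fix T assume "T \<in> tabloid_of m Z (p \<circ> X)"
      then have "inv p \<circ> T \<in> tabloid_of m Z (inv p \<circ> (p \<circ> X))"
        using img1[OF inv_Sym[OF p], of "p \<circ> X"] by auto
      then show "T \<in> (\<lambda>T. p \<circ> T) ` tabloid_of m Z X"
        using invo[OF p] by (metis image_eqI)
    qed
  qed (rule img1[OF p])
  have imgU: "(\<lambda>T. inv p \<circ> T) ` U = tabloid_of m Z X \<longleftrightarrow> U = tabloid_of m Z (p \<circ> X)"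
    if p: "p \<in> Sym m" for p U X
  proof
    assume "(\<lambda>T. inv p \<circ> T) ` U = tabloid_of m Z X"
    then have "(\<lambda>T. p \<circ> T) ` (\<lambda>T. inv p \<circ> T) ` U = tabloid_of m Z (p \<circ> X)"
      using img[OF p] by simp
    then show "U = tabloid_of m Z (p \<circ> X)"
      by (simp add: image_image invo[OF p])
  next
    assume "U = tabloid_of m Z (p \<circ> X)"
    then show "(\<lambda>T. inv p \<circ> T) ` U = tabloid_of m Z X"
      by (simp add: img[OF inv_Sym[OF p]] invo[OF p])
  qed
  have conj_in: "p \<circ> s \<circ> inv p \<in> column_stabilizer m Z (p \<circ> T)"
    if "p \<in> Sym m" "s \<in> column_stabilizer m Z T" for p s T
  proof -
    have "p \<circ> s \<circ> inv p \<in> Sym m"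
      using that by (auto simp: column_stabilizer_def Sym_def intro!: permutes_compose permutes_inv)
    moreover have "(p \<circ> s \<circ> inv p) ` (p \<circ> T) ` A = p ` s ` T ` A" for A
    proof -
      have "inv p (p x) = x" for x using invo(1)[OF that(1), of id] by (simp add: fun_eq_iff)
      then show ?thesis by (simp add: image_image)
    qed
    moreover have "s ` T ` column_of Z c = T ` column_of Z c" for c
      using that(2) by (simp add: column_stabilizer_def)
    ultimately have "(p \<circ> s \<circ> inv p) ` (p \<circ> T) ` column_of Z c = (p \<circ> T) ` column_of Z c" for c
      by (metis image_comp)
    with \<open>p \<circ> s \<circ> inv p \<in> Sym m\<close> show ?thesis
      by (simp add: column_stabilizer_def)
  qed
  have pt: "rep_act ?W p (polytabloid m Z T) = polytabloid m Z (p \<circ> T)"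
    if p: "p \<in> Sym m" and T: "T \<in> tableaux m Z" for p T
  proof
    fix U
    have "(\<Sum>s\<in>column_stabilizer m Z T. of_int (sign s) * of_bool (U = tabloid_of m Z (p \<circ> (s \<circ> T)))) =
      (\<Sum>s\<in>column_stabilizer m Z (p \<circ> T). (of_int (sign s) :: complex) * of_bool (U = tabloid_of m Z (s \<circ> (p \<circ> T))))"
    proof (rule sum.reindex_bij_witness[of _ "\<lambda>s. inv p \<circ> s \<circ> p" "\<lambda>s. p \<circ> s \<circ> inv p"])
      fix s assume s: "s \<in> column_stabilizer m Z T"
      show "inv p \<circ> (p \<circ> s \<circ> inv p) \<circ> p = s"
        using permutes_inv_o[of p "{1..m}"] p by (simp add: comp_assoc invo[OF p] Sym_def)
      show "p \<circ> s \<circ> inv p \<in> column_stabilizer m Z (p \<circ> T)" by (rule conj_in[OF p s])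
      have perm: "permutation p" "permutation s"
        using p s by (auto simp: Sym_def column_stabilizer_def permutation_permutes)
      have "sign (p \<circ> s \<circ> inv p) = sign s"
        using perm by (simp add: sign_compose permutation_compose permutation_inverse sign_inverse)
      moreover have "p \<circ> s \<circ> inv p \<circ> (p \<circ> T) = p \<circ> (s \<circ> T)"
        by (simp add: comp_assoc invo[OF p])
      ultimately show "of_int (sign (p \<circ> s \<circ> inv p)) * of_bool (U = tabloid_of m Z (p \<circ> s \<circ> inv p \<circ> (p \<circ> T))) =
         (of_int (sign s) :: complex) * of_bool (U = tabloid_of m Z (p \<circ> (s \<circ> T)))" by simp
    next
      fix s assume s: "s \<in> column_stabilizer m Z (p \<circ> T)"
      show "p \<circ> (inv p \<circ> s \<circ> p) \<circ> inv p = s"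
        using permutes_inv_o[of p "{1..m}"] p by (simp add: comp_assoc invo[OF p] Sym_def)
      show "inv p \<circ> s \<circ> p \<in> column_stabilizer m Z T"
        using conj_in[OF inv_Sym[OF p] s] by (simp add: invo[OF p])
    qed
    then show "rep_act ?W p (polytabloid m Z T) U = polytabloid m Z (p \<circ> T) U"
      by (simp add: a polytabloid_def imgU[OF p])
  qed
  have closed: "rep_act ?W p v \<in> rep_space ?W" if p: "p \<in> Sym m" and v: "v \<in> rep_space ?W" for p v
    using v unfolding sp
  proof (induction rule: span_induct_alt)
    case base
    have "rep_act ?W p 0 = 0" by (simp add: a fun_eq_iff)
    then show ?case by (metis span_zero)
  next
    case (step c x y)
    have "rep_act ?W p (fun_smult c x + y) = fun_smult c (rep_act ?W p x) + rep_act ?W p y"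
      by (simp add: a fun_eq_iff fun_smult_def)
    moreover have "rep_act ?W p x \<in> polytabloid m Z ` tableaux m Z"
      using step pt[OF p] tab[OF p] by auto
    ultimately show ?case using step by (metis span_add span_scale span_base)
  qed
  have inv_comp: "inv (g \<circ> h) = inv h \<circ> inv g" if "g \<in> Sym m" "h \<in> Sym m" for g h
    using that by (auto simp: Sym_def permutes_bij intro: o_inv_distrib)
  show ?thesis
    unfolding is_representation_def s
  proof (intro conjI ballI allI)
    show "subspace (rep_space ?W)" by (simp add: sp subspace_span)
    show "\<exists>B. finite B \<and> span B = rep_space ?W" using fin sp by blast
    show "rep_act ?W p v \<in> rep_space ?W" if "p \<in> Sym m" "v \<in> rep_space ?W" for p v
      by (rule closed[OF that])
    show "rep_act ?W (g \<circ> h) v = rep_act ?W g (rep_act ?W h v)" if "g \<in> Sym m" "h \<in> Sym m" for g h v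
      using that by (simp add: a inv_comp image_image comp_assoc)
  qed (rule vector_space_fun_smult, simp_all add: a fun_eq_iff fun_smult_def)
qed

lemma finite_ribbon: "finite (ribbon m J)"
  by (simp add: ribbon_def)

end

theory Submission
  imports Defs
begin

text \<open>
  Both sides are compared at a monomial \<open>x\<^sup>M\<close>. Let \<open>N(M)\<close> be the number of words with content \<open>M\<close> and
  descent set \<open>J\<close>; both coefficients are \<open>\<Sum>\<^sub>t N(M - t)\<close>.

  On the representation side, the coefficient of \<open>x\<^sup>M\<close> in a Frobenius characteristic is the dimension of
  the invariants under the stabilizer of a word \<open>f\<close> of content \<open>M\<close>, and induction from \<open>Sym (n - 1)\<close>
  multiplies by \<open>\<Sum>\<^sub>t x\<^sub>t\<close>. Sending the polytabloid of \<open>T\<close> to the word \<open>f \<circ> T\<close>, antisymmetrized along the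
  columns and symmetrized along the rows, identifies these invariants for the ribbon Specht
  module with a space of combinations of words; the words with descent set \<open>J\<close> index a basis of
  it, by the Garnir relations and a triangularity argument. Hence \<open>N(M)\<close> is the coefficient for the
  ribbon and, the stabilizer being blind to the order of the alphabet, so is the number of words
  whose descent set is \<open>J\<close> for any other order of the letters.

  On the quasisymmetric side, the coefficient counts the words \<open>f\<close> whose standardization is the
  inverse of a rotation of \<open>\<pi>\<^sup>-\<^sup>1 n\<close> with \<open>Des \<pi> = J\<close>. Rotating \<open>n\<close> to the end turns this into the condition
  that \<open>f 1, \<dots>, f (n - 1)\<close> has descent set \<open>J\<close> for the cyclic order of the letters in which \<open>t = f n\<close> comes
  last.
\<close>

section \<open>Words and Young subgroups\<close>

text \<open>The cyclic order on the quasisymmetric side varies with the last letter, and no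
  bijection between words with descent set \<open>J\<close> for different orders of the alphabet is
  constructed. The Specht module takes its place: the trace of a stabilizer sum gives the number of
  such words for whichever order the letters carry. Neither irreducibles nor an explicit basis of
  the Specht module are involved. The stabilizer sum factors through the space of words, and a trace
  may be taken on either side of such a factorization.

  One statistic, \<open>cut_sum\<close>, drives both halves of the basis argument. It weights each
  letter by the index of its block; permutations within blocks leave it alone, and shuffling a
  decreasing stretch across a cut can only raise it. With the column cuts it makes straightening
  terminate, with the cuts \<open>J\<close> it makes the matrix triangular. The passage from one
  stabilizer to the whole characteristic is orbit counting.\<close>

definition words :: "nat \<Rightarrow> nat multiset \<Rightarrow> (nat \<Rightarrow> nat) set" where
  "words n M = {f. (\<forall>x. x \<notin> {1..n} \<longrightarrow> f x = 0) \<and> image_mset f (mset_set {1..n}) = M}"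

lemma finite_Sym [simp]: "finite (Sym n)"
  by (simp add: Sym_def finite_permutations)

lemma Sym_comp: "p \<in> Sym n \<Longrightarrow> q \<in> Sym n \<Longrightarrow> p \<circ> q \<in> Sym n"
  by (simp add: Sym_def permutes_compose)

lemma Sym_inv: "p \<in> Sym n \<Longrightarrow> inv p \<in> Sym n"
  by (simp add: Sym_def permutes_inv)

lemma Sym_id [simp]: "id \<in> Sym n"
  by (simp add: Sym_def permutes_id)

lemma Sym_inv_o:
  assumes "p \<in> Sym n" shows "inv p \<circ> p = id" "p \<circ> inv p = id"
  using assms permutes_inv_o[of p "{1..n}"] by (auto simp: Sym_def)

lemma Sym_inv_apply:
  assumes "p \<in> Sym n" shows "inv p (p x) = x" "p (inv p x) = x"
  using Sym_inv_o[OF assms] by (auto simp: fun_eq_iff)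

lemma Sym_eq_iff: "p \<in> Sym n \<Longrightarrow> p x = p y \<longleftrightarrow> x = y"
  by (metis Sym_inv_apply(1))

lemma Sym_in_iff: "p \<in> Sym n \<Longrightarrow> p x \<in> {1..n} \<longleftrightarrow> x \<in> {1..n}"
  by (metis Sym_def mem_Collect_eq permutes_in_image)

lemma Sym_image: "p \<in> Sym n \<Longrightarrow> p ` {1..n} = {1..n}"
  by (simp add: Sym_def permutes_image)

lemma Sym_permutation: "p \<in> Sym n \<Longrightarrow> permutation p"
  by (auto simp: Sym_def permutation_permutes)

lemma Sym_sign_comp: "p \<in> Sym n \<Longrightarrow> q \<in> Sym n \<Longrightarrow> sign (p \<circ> q) = sign p * sign q"
  by (simp add: sign_compose Sym_permutation)

lemma Sym_sign_inv: "p \<in> Sym n \<Longrightarrow> sign (inv p) = sign p"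
  by (simp add: sign_inverse Sym_permutation)

lemma Sym_transpose: "i \<in> {1..n} \<Longrightarrow> j \<in> {1..n} \<Longrightarrow> transpose i j \<in> Sym n"
  by (simp add: Sym_def permutes_swap_id)

lemma inv_comp_Sym: "p \<in> Sym n \<Longrightarrow> q \<in> Sym n \<Longrightarrow> inv (p \<circ> q) = inv q \<circ> inv p"
  by (auto simp: Sym_def permutes_bij intro: o_inv_distrib)

lemma Sym_outside: "p \<in> Sym n \<Longrightarrow> x \<notin> {1..n} \<Longrightarrow> p x = x"
  by (simp add: Sym_def permutes_not_in)

lemma sum_Sym_reindex: "p \<in> Sym n \<Longrightarrow> (\<Sum>x\<in>{1..n}. f (p x)) = (\<Sum>x\<in>{1..n}. f x)"
  using sum.permute[of p "{1..n}" f] by (simp add: Sym_def)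

lemma image_mset_Sym:
  assumes "p \<in> Sym n"
  shows "image_mset (f \<circ> p) (mset_set {1..n}) = image_mset f (mset_set {1..n})"
proof -
  have "inj_on p {1..n}" using Sym_eq_iff[OF assms] by (auto simp: inj_on_def)
  then have "image_mset p (mset_set {1..n}) = mset_set {1..n}"
    by (simp only: image_mset_mset_set Sym_image[OF assms])
  then show ?thesis by (simp only: multiset.map_comp[symmetric])
qed

lemma words_comp: "f \<in> words n M \<Longrightarrow> p \<in> Sym n \<Longrightarrow> f \<circ> p \<in> words n M"
proof -
  assume f: "f \<in> words n M" and p: "p \<in> Sym n"
  have "(f \<circ> p) x = 0" if "x \<notin> {1..n}" for x
    using f Sym_outside[OF p that] that by (simp add: words_def)
  then show ?thesis using f image_mset_Sym[OF p, of f] by (simp add: words_def del: comp_apply)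
qed

lemma set_words: "f \<in> words n M \<Longrightarrow> x \<in> {1..n} \<Longrightarrow> f x \<in># M"
  by (auto simp: words_def)

lemma finite_words [simp]: "finite (words n M)"
proof -
  have "finite {f. \<forall>x. (x \<in> {1..n} \<longrightarrow> f x \<in> set_mset M) \<and> (x \<notin> {1..n} \<longrightarrow> f x = (0::nat))}"
    by (rule finite_set_of_finite_funs) auto
  then show ?thesis
    by (rule finite_subset[rotated]) (auto simp: words_def)
qed

lemma words_transitive:
  assumes "f \<in> words n M" "g \<in> words n M"
  obtains p where "p \<in> Sym n" "f \<circ> p = g"
proof -
  have "image_mset g (mset_set {1..n}) = image_mset f (mset_set {1..n})"
    using assms by (simp add: words_def)
  from image_mset_eq_implies_permutes[OF _ this] obtain p where
    p: "p permutes {1..n}" "\<forall>x\<in>{1..n}. g x = f (p x)" by auto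
  have "f \<circ> p = g"
  proof
    fix x show "(f \<circ> p) x = g x"
    proof (cases "x \<in> {1..n}")
      case False
      then show ?thesis using assms permutes_not_in[OF p(1) False] by (auto simp: words_def)
    qed (use p in auto)
  qed
  with p(1) that show ?thesis by (auto simp: Sym_def)
qed

text \<open>
  Cutting \<open>{1..m}\<close> after each \<open>k \<in> L\<close> yields blocks numbered by \<open>cut_index L\<close>; their Young subgroup
  is \<open>young m L\<close>.
\<close>

definition cut_index :: "nat set \<Rightarrow> nat \<Rightarrow> nat" where
  "cut_index L p = card {k \<in> L. k < p}"

lemma cut_index_less: "k \<in> L \<Longrightarrow> p \<le> k \<Longrightarrow> k < q \<Longrightarrow> cut_index L p < cut_index L q"
proof -
  assume k: "k \<in> L" "p \<le> k" "k < q"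
  have "finite {k \<in> L. k < q}" by (rule finite_subset[of _ "{..<q}"]) auto
  moreover have "{k \<in> L. k < p} \<subseteq> {k \<in> L. k < q}" using k by auto
  moreover have "k \<in> {k \<in> L. k < q}" "k \<notin> {k \<in> L. k < p}" using k by auto
  ultimately show ?thesis
    unfolding cut_index_def by (intro psubset_card_mono) blast+
qed

lemma cut_index_insert: "k \<notin> L \<Longrightarrow> cut_index (insert k L) p = cut_index L p + of_bool (k < p)"
proof -
  assume k: "k \<notin> L"
  have "{l \<in> insert k L. l < p} = (if k < p then insert k {l \<in> L. l < p} else {l \<in> L. l < p})" by auto
  then show ?thesis using k by (simp add: cut_index_def)
qed

lemma cut_index_Un: "L \<inter> K = {} \<Longrightarrow> cut_index (L \<union> K) p = cut_index L p + cut_index K p"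
proof -
  assume "L \<inter> K = {}"
  then have "card ({k \<in> L. k < p} \<union> {k \<in> K. k < p}) = cut_index L p + cut_index K p"
    unfolding cut_index_def by (intro card_Un_disjoint) auto
  moreover have "{k \<in> L. k < p} \<union> {k \<in> K. k < p} = {k \<in> L \<union> K. k < p}" by auto
  ultimately show ?thesis by (simp add: cut_index_def)
qed

lemma cut_index_all: "p \<in> {1..m} \<Longrightarrow> cut_index {1..<m} p = p - 1"
proof -
  assume "p \<in> {1..m}"
  then have "{k \<in> {1..<m}. k < p} = {1..<p}" by auto
  then show ?thesis by (simp add: cut_index_def)
qed

definition young :: "nat \<Rightarrow> nat set \<Rightarrow> (nat \<Rightarrow> nat) set" where
  "young m L = {\<sigma> \<in> Sym m. \<forall>p. cut_index L (\<sigma> p) = cut_index L p}"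

lemma young_Sym: "\<sigma> \<in> young m L \<Longrightarrow> \<sigma> \<in> Sym m"
  by (simp add: young_def)

lemma finite_young [simp]: "finite (young m L)"
  by (rule finite_subset[of _ "Sym m"]) (auto simp: young_def)

lemma young_id [simp]: "id \<in> young m L"
  by (simp add: young_def)

lemma young_comp: "\<sigma> \<in> young m L \<Longrightarrow> \<tau> \<in> young m L \<Longrightarrow> \<sigma> \<circ> \<tau> \<in> young m L"
  by (simp add: young_def Sym_comp)

lemma young_inv: "\<sigma> \<in> young m L \<Longrightarrow> inv \<sigma> \<in> young m L"
proof -
  assume s: "\<sigma> \<in> young m L"
  have "cut_index L (\<sigma> (inv \<sigma> p)) = cut_index L (inv \<sigma> p)" for p
    using s by (simp add: young_def)
  then have "cut_index L (inv \<sigma> p) = cut_index L p" for p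
    by (simp add: Sym_inv_apply(2)[OF young_Sym[OF s]])
  then show ?thesis using Sym_inv[OF young_Sym[OF s]] by (simp add: young_def)
qed

lemma young_insertI:
  assumes "\<sigma> \<in> young m L" "\<And>p. k < \<sigma> p \<longleftrightarrow> k < p"
  shows "\<sigma> \<in> young m (insert k L)"
  using assms by (cases "k \<in> L") (auto simp: young_def insert_absorb cut_index_insert)

lemma young_mono:
  assumes "\<sigma> \<in> young m L" "k \<in> L" shows "k < \<sigma> p \<longleftrightarrow> k < p"
proof -
  have "cut_index L (\<sigma> p) = cut_index L p" using assms by (simp add: young_def)
  then show ?thesis
    using cut_index_less[OF assms(2), of p "\<sigma> p"] cut_index_less[OF assms(2), of "\<sigma> p" p]
    by (metis less_irrefl linorder_not_less)
qed

lemma young_subset: "K \<subseteq> L \<Longrightarrow> young m L \<subseteq> young m K"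
proof
  fix \<sigma> assume "K \<subseteq> L" and s: "\<sigma> \<in> young m L"
  have "{k \<in> K. k < \<sigma> p} = {k \<in> K. k < p}" for p
    using young_mono[OF s] \<open>K \<subseteq> L\<close> by auto
  then show "\<sigma> \<in> young m K" using s by (simp add: young_def cut_index_def)
qed

lemma transpose_in_young:
  assumes "i \<in> {1..<m}" "i \<notin> L"
  shows "transpose i (Suc i) \<in> young m L"
proof -
  have "{k \<in> L. k < Suc i} = {k \<in> L. k < i}" using assms(2) less_Suc_eq by blast
  then have "cut_index L (Suc i) = cut_index L i" by (simp add: cut_index_def)
  then have "cut_index L (transpose i (Suc i) p) = cut_index L p" for p
    by (simp add: transpose_def)
  moreover have "transpose i (Suc i) \<in> Sym m" using assms(1) by (intro Sym_transpose) auto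
  ultimately show ?thesis by (simp add: young_def)
qed

lemma sign_transpose_Suc: "sign (transpose i (Suc i)) = -1"
  by (simp add: sign_swap_id)

text \<open>For finite \<open>L\<close> this adds up the tail sums after the cuts
  (\<open>cut_sum_eq_sum\<close>): it is large when large letters stand late.\<close>

definition cut_sum :: "nat \<Rightarrow> nat set \<Rightarrow> (nat \<Rightarrow> nat) \<Rightarrow> nat" where
  "cut_sum m L g = (\<Sum>p\<in>{1..m}. cut_index L p * g p)"

lemma cut_sum_young: "\<sigma> \<in> young m L \<Longrightarrow> cut_sum m L (g \<circ> \<sigma>) = cut_sum m L g"
proof -
  assume s: "\<sigma> \<in> young m L"
  have "cut_sum m L (g \<circ> \<sigma>) = (\<Sum>p\<in>{1..m}. cut_index L (\<sigma> p) * g (\<sigma> p))"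
    using s by (simp add: cut_sum_def young_def)
  also have "\<dots> = cut_sum m L g"
    using sum_Sym_reindex[OF young_Sym[OF s], of "\<lambda>p. cut_index L p * g p"] by (simp add: cut_sum_def)
  finally show ?thesis .
qed

lemma cut_sum_insert:
  assumes "k \<notin> L"
  shows "cut_sum m (insert k L) g = cut_sum m L g + sum g {k<..m}"
proof -
  have "(\<Sum>p\<in>{1..m}. of_bool (k < p) * g p) = sum g {k<..m}"
    if "k \<ge> 0" using that
    by (cases "k = 0"; intro sum.mono_neutral_cong_right) auto
  then show ?thesis
    using assms by (simp add: cut_sum_def cut_index_insert algebra_simps sum.distrib)
qed

lemma cut_sum_eq_sum:
  assumes "finite L"
  shows "cut_sum m L g = (\<Sum>k\<in>L. sum g {k<..m})"
  using assms
proof (induction L)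
  case empty show ?case by (simp add: cut_sum_def cut_index_def)
next
  case (insert k L) then show ?case by (simp add: cut_sum_insert)
qed

section \<open>Tail sums of words with sorted blocks\<close>

lemma weakly_decreasing_chain:
  fixes w :: "nat \<Rightarrow> 'a::order"
  assumes "a \<le> b" "\<And>l. a \<le> l \<Longrightarrow> l < b \<Longrightarrow> w (Suc l) \<le> w l"
  shows "w b \<le> w a"
  using assms
proof (induction b)
  case (Suc b)
  show ?case
  proof (cases "a = Suc b")
    case False
    then have "w b \<le> w a" using Suc by auto
    moreover have "w (Suc b) \<le> w b" using Suc.prems False by auto
    ultimately show ?thesis by (rule order_trans[rotated])
  qed simp
qed simp

text \<open>The letters moved across \<open>k\<close> to the right are at least those moved to the left.\<close>

lemma tail_sum_young_int:
  fixes w :: "nat \<Rightarrow> int"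
  assumes s: "\<sigma> \<in> young m L" and k: "k \<in> {1..<m}" "k \<notin> L"
    and dec: "\<And>i. i \<in> {1..<m} \<Longrightarrow> i \<notin> L \<Longrightarrow> w (Suc i) \<le> w i"
  shows "sum w {k<..m} \<le> sum (w \<circ> \<sigma>) {k<..m}"
    and "w (Suc k) < w k \<Longrightarrow> sum w {k<..m} = sum (w \<circ> \<sigma>) {k<..m} \<Longrightarrow> k < \<sigma> p \<longleftrightarrow> k < p"
proof -
  let ?X = "{k<..m}"
  define A where "A = \<sigma> ` ?X"
  note sS = young_Sym[OF s]
  have inj: "inj_on \<sigma> B" for B using Sym_eq_iff[OF sS] by (auto simp: inj_on_def)
  have Asub: "A \<subseteq> {1..m}" using Sym_in_iff[OF sS] k by (fastforce simp: A_def)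
  have finA: "finite A" by (simp add: A_def)
  have cA: "card A = card ?X" by (simp add: A_def card_image inj)
  have idx: "cut_index L (\<sigma> p) = cut_index L p" for p using s by (simp add: young_def)
  \<comment> \<open>\<open>\<sigma>\<close> carries some \<open>p > k\<close> to
    \<open>q \<le> k\<close>, so both lie in one block. No cut lies between \<open>q\<close> and
    \<open>k\<close>, and \<open>w\<close> decreases weakly on that stretch.\<close>
  have big: "w k \<le> w q" if "q \<in> A - ?X" for q
  proof -
    from that obtain p where p: "q = \<sigma> p" "k < p" "p \<le> m" by (auto simp: A_def)
    have q: "1 \<le> q" "q \<le> k" using that Asub by auto
    have notin: "l \<notin> L" if "q \<le> l" "l < k" for l
      using cut_index_less[of l L q p] idx[of p] p that by auto
    have "w (Suc l) \<le> w l" if "q \<le> l" "l < k" for l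
      by (rule dec) (use that q k notin in auto)
    with q(2) show ?thesis by (rule weakly_decreasing_chain)
  qed
  have small: "w q \<le> w (Suc k)" if "q \<in> ?X - A" for q
  proof -
    have "inv \<sigma> q \<notin> ?X" using that Sym_inv_apply(2)[OF sS, of q] unfolding A_def by (metis DiffD2 image_eqI)
    moreover have "inv \<sigma> q \<in> {1..m}" using that k Sym_in_iff[OF Sym_inv[OF sS]] by auto
    ultimately have p: "inv \<sigma> q \<le> k" by auto
    have q: "k < q" "q \<le> m" using that by auto
    have notin: "l \<notin> L" if "Suc k \<le> l" "l < q" for l
      using cut_index_less[of l L "inv \<sigma> q" q] idx[of "inv \<sigma> q"] p that Sym_inv_apply(2)[OF sS, of q] by auto
    have "w (Suc l) \<le> w l" if "Suc k \<le> l" "l < q" for l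
      by (rule dec) (use that q k notin in auto)
    moreover have "Suc k \<le> q" using q by simp
    ultimately show ?thesis by (rule weakly_decreasing_chain[rotated])
  qed
  \<comment> \<open>As many positions cross \<open>k\<close> in one direction as in the other, so
    \<open>b1\<close> and \<open>b2\<close> bound equally many letters.\<close>
  have c: "card (A - ?X) = card (?X - A)"
    using cA finA card_Diff_subset_Int[of A ?X] card_Diff_subset_Int[of ?X A]
    by (simp add: Int_commute)
  have sA: "sum (w \<circ> \<sigma>) ?X = sum w A" by (simp add: A_def sum.reindex inj)
  have s1: "sum w A = sum w (A \<inter> ?X) + sum w (A - ?X)"
    using finA by (subst sum.union_disjoint[symmetric]) (auto intro: arg_cong[of _ _ "sum w"])
  have s2: "sum w ?X = sum w (A \<inter> ?X) + sum w (?X - A)"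
    using finA by (subst sum.union_disjoint[symmetric]) (auto intro: arg_cong[of _ _ "sum w"])
  have b1: "int (card (A - ?X)) * w k \<le> sum w (A - ?X)"
    using sum_bounded_below[of "A - ?X" "w k" w] big by simp
  have b2: "sum w (?X - A) \<le> int (card (A - ?X)) * w (Suc k)"
    using sum_bounded_above[of "?X - A" w "w (Suc k)"] small by (simp add: c)
  have "w (Suc k) \<le> w k" using dec k by auto
  then have "int (card (A - ?X)) * w (Suc k) \<le> int (card (A - ?X)) * w k" by (simp add: mult_left_mono)
  then show "sum w ?X \<le> sum (w \<circ> \<sigma>) ?X" using sA s1 s2 b1 b2 by linarith
  assume wk: "w (Suc k) < w k" and eq: "sum w ?X = sum (w \<circ> \<sigma>) ?X"
  \<comment> \<open>Equality collapses the chain of bounds, and the strict drop at \<open>k\<close>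
    then leaves no crossing position.\<close>
  have "int (card (A - ?X)) * w k \<le> int (card (A - ?X)) * w (Suc k)"
    using eq sA s1 s2 b1 b2 by linarith
  then have "card (A - ?X) = 0"
    using mult_strict_left_mono[OF wk, of "int (card (A - ?X))"] by (cases "card (A - ?X) = 0") linarith+
  then have "A \<subseteq> ?X" using finA by simp
  moreover have "?X \<subseteq> A" using \<open>card (A - ?X) = 0\<close> c by simp
  ultimately have AX: "\<sigma> ` ?X = ?X" by (simp add: A_def)
  show "k < \<sigma> p \<longleftrightarrow> k < p"
  proof (cases "p \<in> {1..m}")
    case True
    have "p \<in> ?X \<longleftrightarrow> \<sigma> p \<in> ?X" using AX Sym_eq_iff[OF sS] by (metis image_iff)
    then show ?thesis using True Sym_in_iff[OF sS, of p] by auto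
  next
    case False then show ?thesis using Sym_outside[OF sS] by simp
  qed
qed

text \<open>The form used for columns, which decrease strictly. The integer version is weak and
  signed because \<open>row_sorted_unique\<close> applies it to a negated word.\<close>

lemma tail_sum_young:
  fixes w :: "nat \<Rightarrow> nat"
  assumes s: "\<sigma> \<in> young m L" and k: "k \<in> {1..<m}" "k \<notin> L"
    and dec: "\<And>i. i \<in> {1..<m} \<Longrightarrow> i \<notin> L \<Longrightarrow> w (Suc i) < w i"
  shows "sum w {k<..m} \<le> sum (w \<circ> \<sigma>) {k<..m}"
    and "sum w {k<..m} = sum (w \<circ> \<sigma>) {k<..m} \<Longrightarrow> k < \<sigma> p \<longleftrightarrow> k < p"
proof -
  have d: "int (w (Suc i)) \<le> int (w i)" if "i \<in> {1..<m}" "i \<notin> L" for i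
    using dec[OF that] by simp
  have c: "(\<lambda>x. int (w x)) \<circ> \<sigma> = (\<lambda>x. int ((w \<circ> \<sigma>) x))" by auto
  note ti = tail_sum_young_int[OF s k, of "\<lambda>x. int (w x)", unfolded c of_nat_sum[symmetric], OF d]
  show "sum w {k<..m} \<le> sum (w \<circ> \<sigma>) {k<..m}"
    using ti(1) by linarith
  assume "sum w {k<..m} = sum (w \<circ> \<sigma>) {k<..m}"
  then show "k < \<sigma> p \<longleftrightarrow> k < p" using ti(2) dec[OF k] by simp
qed

text \<open>Shuffling weakly increasing rows cannot raise a tail sum. Applied to \<open>r\<close>
  and to its inverse, this makes all tail sums of the two words equal, and differences of
  consecutive tail sums are the letters.\<close>

lemma row_sorted_unique:
  assumes r: "r \<in> young m J" and w: "Des m w \<subseteq> J"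
    and wr: "Des m (w \<circ> r) \<subseteq> J"
  shows "w \<circ> r = w"
proof -
  have tail: "sum (v \<circ> q) {k<..m} \<le> sum v {k<..m}"
    if q: "q \<in> young m J" and v: "Des m v \<subseteq> J" for q v and k
  proof -
    have d: "- int (v (Suc i)) \<le> - int (v i)" if "i \<in> {1..<m}" "i \<notin> J" for i
      using that v by (auto simp: Des_def)
    consider "k = 0" | "k \<in> {1..<m}" "k \<notin> J" | "k \<in> J" | "m \<le> k" by fastforce
    then show ?thesis
    proof cases
      case 1
      have "{0<..m} = {1..m}" by auto
      then show ?thesis using sum_Sym_reindex[OF young_Sym[OF q], of v] 1 by simp
    next
      case 2
      have "(\<lambda>x. - int (v x)) \<circ> q = (\<lambda>x. - int ((v \<circ> q) x))" by auto
      then show ?thesis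
        using tail_sum_young_int(1)[OF q 2, of "\<lambda>x. - int (v x)", OF d]
        by (simp add: sum_negf of_nat_sum[symmetric] del: of_nat_sum)
    next
      case 3
      have "q ` {k<..m} = {k<..m}"
      proof (rule card_subset_eq)
        show "card (q ` {k<..m}) = card {k<..m}"
          using Sym_eq_iff[OF young_Sym[OF q]] by (intro card_image) (auto simp: inj_on_def)
        have "q p \<in> {k<..m}" if "p \<in> {k<..m}" for p
          using young_mono[OF q 3, of p] Sym_in_iff[OF young_Sym[OF q], of p] that by auto
        then show "q ` {k<..m} \<subseteq> {k<..m}" by auto
      qed simp
      moreover have "sum (v \<circ> q) {k<..m} = sum v (q ` {k<..m})"
        using Sym_eq_iff[OF young_Sym[OF q]] by (subst sum.reindex) (auto simp: inj_on_def)
      ultimately show ?thesis by simp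
    qed simp
  qed
  have c: "(w \<circ> r) \<circ> inv r = w" by (simp add: comp_assoc Sym_inv_o[OF young_Sym[OF r]])
  have eq: "sum (w \<circ> r) {k<..m} = sum w {k<..m}" for k
    using tail[OF r w, of k] tail[OF young_inv[OF r] wr, of k] unfolding c by linarith
  show ?thesis
  proof
    fix p show "(w \<circ> r) p = w p"
    proof (cases "p \<in> {1..m}")
      case True
      then have "{p - 1<..m} = insert p {p<..m}" by auto
      then have "sum v {p - 1<..m} = v p + sum v {p<..m}" for v :: "nat \<Rightarrow> nat" by simp
      then show ?thesis using eq[of "p - 1"] eq[of p] by simp
    next
      case False then show ?thesis using Sym_outside[OF young_Sym[OF r]] by simp
    qed
  qed
qed

section \<open>The words of a ribbon\<close>

text \<open>
  With the cells of the ribbon labelled \<open>1, \<dots>, m\<close>, the columns are the blocks cut outside \<open>J\<close> and the rows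
  are the blocks cut at \<open>J\<close>. So this is the word \<open>g\<close> times the column antisymmetrizer and the
  row symmetrizer, which act on positions.
\<close>

definition row_col_sum :: "nat \<Rightarrow> nat set \<Rightarrow> (nat \<Rightarrow> nat) \<Rightarrow> (nat \<Rightarrow> nat) \<Rightarrow> complex" where
  "row_col_sum m J g g' =
     (\<Sum>s\<in>young m ({1..<m} - J). \<Sum>r\<in>young m J. of_int (sign s) * of_bool (g \<circ> s \<circ> r = g'))"

lemma row_col_sum_comp:
  assumes u: "u \<in> young m ({1..<m} - J)"
  shows "row_col_sum m J (g \<circ> u) = fun_smult (of_int (sign u)) (row_col_sum m J g)"
proof
  fix g'
  let ?C = "young m ({1..<m} - J)" and ?R = "young m J"
  let ?F = "\<lambda>s. \<Sum>r\<in>?R. of_int (sign s) * (of_bool (g \<circ> s \<circ> r = g') :: complex)"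
  note uS = young_Sym[OF u]
  have "(\<Sum>s\<in>?C. \<Sum>r\<in>?R. of_int (sign s) * of_bool (g \<circ> u \<circ> s \<circ> r = g'))
      = (\<Sum>s\<in>?C. of_int (sign u) * ?F s)"
  proof (rule sum.reindex_bij_witness[of _ "\<lambda>s. inv u \<circ> s" "\<lambda>s. u \<circ> s"])
    fix s assume s: "s \<in> ?C"
    have "sign u * sign u = 1" by (simp add: sign_def)
    then have e: "sign s = sign u * sign (u \<circ> s)"
      by (simp add: Sym_sign_comp[OF uS young_Sym[OF s]] mult.assoc[symmetric])
    show "of_int (sign u) * ?F (u \<circ> s) =
        (\<Sum>r\<in>?R. of_int (sign s) * (of_bool (g \<circ> u \<circ> s \<circ> r = g') :: complex))"
      by (simp only: e o_assoc sum_distrib_left of_int_mult mult.assoc)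
  qed (use u in \<open>auto simp: Sym_inv_cancel[OF uS] simp del: One_nat_def intro: young_comp young_inv\<close>)
  then show "row_col_sum m J (g \<circ> u) g' = fun_smult (of_int (sign u)) (row_col_sum m J g) g'"
    by (simp add: row_col_sum_def fun_smult_def sum_distrib_left)
qed

lemma fun_sum_apply: "(\<Sum>x\<in>A. f x) y = (\<Sum>x\<in>A. f x y)"
  by (induction A rule: infinite_finite_induct) auto

text \<open>Cells \<open>i\<close> and \<open>i + 1\<close> share a column, so their transposition
  is in the column group: it fixes the word and reverses the sign.\<close>

lemma row_col_sum_eq_0:
  assumes "i \<in> J" "i \<in> {1..<m}" "g i = g (Suc i)"
  shows "row_col_sum m J g = 0"
proof -
  have "g \<circ> transpose i (Suc i) = g" using assms(3) by (auto simp: fun_eq_iff transpose_def)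
  moreover have "transpose i (Suc i) \<in> young m ({1..<m} - J)"
    using assms by (intro transpose_in_young) auto
  ultimately have "row_col_sum m J g = fun_smult (-1) (row_col_sum m J g)"
    using row_col_sum_comp[of "transpose i (Suc i)" m J g] by (simp add: sign_transpose_Suc)
  then have "row_col_sum m J g g' = - row_col_sum m J g g'" for g'
    by (metis fun_smult_def mult_minus1)
  then show ?thesis by (simp add: fun_eq_iff)
qed

text \<open>
  The Garnir relation of a ribbon: merging the two columns that meet in the row step \<open>i\<close>, the
  antisymmetrizer of the merged column kills the row symmetrizer, as both groups contain
  the transposition of \<open>i\<close> and \<open>i + 1\<close>.
\<close>

lemma garnir:
  assumes i: "i \<in> {1..<m}" "i \<notin> J"
  defines "G \<equiv> young m ({1..<m} - J - {i})"
  shows "(\<Sum>\<sigma>\<in>G. fun_smult (of_int (sign \<sigma>)) (row_col_sum m J (g \<circ> \<sigma>))) = 0"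
proof
  fix g'
  let ?C = "young m ({1..<m} - J)" and ?R = "young m J"
  have CG: "?C \<subseteq> G" unfolding G_def by (rule young_subset) auto
  have finG: "finite G" by (simp add: G_def)
  define t where "t = transpose i (Suc i)"
  have tG: "t \<in> G" unfolding t_def G_def using i by (intro transpose_in_young) auto
  have GtG: "\<sigma> \<circ> t \<in> G" if "\<sigma> \<in> G" for \<sigma> using that tG unfolding G_def by (rule young_comp)
  have tR: "t \<in> ?R" unfolding t_def using i by (intro transpose_in_young) auto
  have tS: "t \<in> Sym m" using tR by (rule young_Sym)
  have tt: "t \<circ> t = id" by (simp add: t_def)
  have st: "sign t = -1" by (simp add: t_def sign_transpose_Suc)
  have GS: "\<sigma> \<in> Sym m" if "\<sigma> \<in> G" for \<sigma> using that young_Sym by (simp add: G_def)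
  let ?D = "\<lambda>\<sigma>. \<Sum>r\<in>?R. (of_bool (g \<circ> \<sigma> \<circ> r = g') :: complex)"
  \<comment> \<open>As a member of the row group, \<open>t\<close> disappears into the sum over
    \<open>r\<close>; as an odd member of \<open>G\<close> it makes the terms of the outer sum
    cancel.\<close>
  have D: "?D (\<sigma> \<circ> t) = ?D \<sigma>" for \<sigma>
    by (rule sum.reindex_bij_witness[of _ "\<lambda>r. t \<circ> r" "\<lambda>r. t \<circ> r"])
       (auto simp: o_assoc tt tR young_comp)
  have "(\<Sum>\<sigma>\<in>G. of_int (sign \<sigma>) * ?D \<sigma>) = (\<Sum>\<sigma>\<in>G. - (of_int (sign \<sigma>) * ?D \<sigma>))"
  proof (rule sum.reindex_bij_witness[of _ "\<lambda>\<sigma>. \<sigma> \<circ> t" "\<lambda>\<sigma>. \<sigma> \<circ> t"])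
    fix \<sigma> assume s: "\<sigma> \<in> G"
    show "- (of_int (sign (\<sigma> \<circ> t)) * ?D (\<sigma> \<circ> t)) = of_int (sign \<sigma>) * ?D \<sigma>"
      unfolding D by (simp add: Sym_sign_comp[OF GS[OF s] tS] st)
  qed (auto simp: comp_assoc tt GtG)
  then have zero: "(\<Sum>\<sigma>\<in>G. of_int (sign \<sigma>) * ?D \<sigma>) = 0"
    by (simp add: sum_negf)
  \<comment> \<open>The column group lies in \<open>G\<close>, so \<open>\<sigma> \<circ> s\<close>
    runs through \<open>G\<close> as well and the signs combine: the summand of each
    \<open>s\<close> reduces to \<open>zero\<close>.\<close>
  have inner: "(\<Sum>\<sigma>\<in>G. of_int (sign \<sigma>) * (of_int (sign s) * ?D (\<sigma> \<circ> s))) = 0" if s: "s \<in> ?C" for s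
  proof -
    have "(\<Sum>\<sigma>\<in>G. of_int (sign \<sigma>) * (of_int (sign s) * ?D (\<sigma> \<circ> s))) = (\<Sum>\<sigma>\<in>G. of_int (sign \<sigma>) * ?D \<sigma>)"
    proof (rule sum.reindex_bij_witness[of _ "\<lambda>\<sigma>. \<sigma> \<circ> inv s" "\<lambda>\<sigma>. \<sigma> \<circ> s"])
      fix \<sigma> assume \<sigma>: "\<sigma> \<in> G"
      show "of_int (sign (\<sigma> \<circ> s)) * ?D (\<sigma> \<circ> s) = of_int (sign \<sigma>) * (of_int (sign s) * ?D (\<sigma> \<circ> s))"
        by (simp add: Sym_sign_comp[OF GS[OF \<sigma>] young_Sym[OF s]])
    qed (use s CG in \<open>auto simp: comp_assoc Sym_inv_o[OF young_Sym[OF s]] G_def intro!: young_comp young_inv\<close>)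
    then show ?thesis using zero by simp
  qed
  have "(\<Sum>\<sigma>\<in>G. of_int (sign \<sigma>) * row_col_sum m J (g \<circ> \<sigma>) g')
      = (\<Sum>s\<in>?C. \<Sum>\<sigma>\<in>G. of_int (sign \<sigma>) * (of_int (sign s) * ?D (\<sigma> \<circ> s)))"
    unfolding row_col_sum_def
    by (simp only: sum_distrib_left o_assoc) (rule sum.swap)
  also have "\<dots> = 0" using inner by simp
  finally show "(\<Sum>\<sigma>\<in>G. fun_smult (of_int (sign \<sigma>)) (row_col_sum m J (g \<circ> \<sigma>))) g' = 0 g'"
    by (simp add: fun_sum_apply fun_smult_def)
qed

section \<open>Straightening words to descent set \<open>J\<close>\<close>

lemma cut_sum_bound:
  assumes "finite L" "g \<in> words m M"
  shows "cut_sum m L g \<le> card L * (\<Sum>x\<in>#M. x)"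
proof -
  have "(\<Sum>x\<in>#M. x) = sum g {1..m}" using assms(2) by (auto simp: words_def sum_unfold_sum_mset)
  moreover have "cut_index L p \<le> card L" for p
    unfolding cut_index_def by (rule card_mono) (use assms in auto)
  ultimately show ?thesis
    unfolding cut_sum_def sum_distrib_left
    by (simp add: sum_distrib_left sum_mono mult_right_mono)
qed

lemma descent_sum_transpose:
  assumes "i \<in> {1..<m}" "(g :: nat \<Rightarrow> nat) i < g (Suc i)"
  shows "(\<Sum>p\<in>{1..m}. p * (g \<circ> transpose i (Suc i)) p) < (\<Sum>p\<in>{1..m}. p * g p)"
proof -
  have split: "{1..m} = insert i (insert (Suc i) ({1..m} - {i, Suc i}))" using assms by auto
  have eq: "(\<Sum>p\<in>{1..m} - {i, Suc i}. p * (g \<circ> transpose i (Suc i)) p) = (\<Sum>p\<in>{1..m} - {i, Suc i}. p * g p)"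
    by (rule sum.cong) (auto simp: transpose_def)
  show ?thesis
    by (subst (1 2) split) (use assms eq in \<open>simp add: transpose_def\<close>)
qed

lemma Des_iff: "i \<in> {1..<m} \<Longrightarrow> i \<in> Des m w \<longleftrightarrow> w (Suc i) < w i"
  by (auto simp: Des_def)

interpretation word_space: vector_space "fun_smult :: complex \<Rightarrow> ((nat \<Rightarrow> nat) \<Rightarrow> complex) \<Rightarrow> _"
  by (rule vector_space_fun_smult)

text \<open>The measure is lexicographic. A Garnir relation raises the \<open>cut_sum\<close> of the
  column cuts, so its distance to the bound of \<open>cut_sum_bound\<close> comes first; a swap
  within a column preserves it and lowers the second entry by
  \<open>descent_sum_transpose\<close>.\<close>

lemma row_col_sum_span:
  assumes J: "J \<subseteq> {1..<m}" and g: "g \<in> words m M"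
  shows "row_col_sum m J g \<in> word_space.span (row_col_sum m J ` {w \<in> words m M. Des m w = J})"
    (is "_ \<in> word_space.span ?E")
  using g
proof (induction g rule: wf_induct_rule[OF wf_measures[of
      "[\<lambda>g. card {1..<m} * (\<Sum>x\<in>#M. x) - cut_sum m ({1..<m} - J) g, \<lambda>g. \<Sum>p\<in>{1..m}. p * g p]"]])
  case (1 g)
  let ?L = "{1..<m} - J"
  note g = \<open>g \<in> words m M\<close>
  have bnd: "cut_sum m ?L h \<le> card {1..<m} * (\<Sum>x\<in>#M. x)" if "h \<in> words m M" for h
  proof -
    have "card ?L \<le> card {1..<m}" by (rule card_mono) auto
    then show ?thesis using cut_sum_bound[OF _ that, of ?L] by (meson finite_Diff finite_atLeastLessThan mult_right_mono order_trans zero_le)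
  qed
  consider (eq) "Des m g = J" | (col) i where "i \<in> J" "i \<notin> Des m g"
    | (row) i where "J \<subseteq> Des m g" "i \<notin> J" "i \<in> Des m g" by blast
  then show ?case
  proof cases
    case eq
    then show ?thesis using g by (intro word_space.span_base) auto
  next
    case (col i)
    then have i: "i \<in> {1..<m}" using J by auto
    show ?thesis
    proof (cases "g i = g (Suc i)")
      case True
      show ?thesis unfolding row_col_sum_eq_0[OF col(1) i True] by (rule word_space.span_zero)
    next
      case False
      with col i have lt: "g i < g (Suc i)" by (simp add: Des_iff)
      define t where "t = transpose i (Suc i)"
      have t: "t \<in> young m ?L" unfolding t_def using col i by (intro transpose_in_young) auto
      have w: "g \<circ> t \<in> words m M" using words_comp[OF g young_Sym[OF t]] .
      have "row_col_sum m J (g \<circ> t) \<in> word_space.span ?E"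
      proof (rule 1)
        show "(g \<circ> t, g) \<in> measures [\<lambda>g. card {1..<m} * (\<Sum>x\<in>#M. x) - cut_sum m ?L g, \<lambda>g. \<Sum>p\<in>{1..m}. p * g p]"
          using descent_sum_transpose[OF i lt] cut_sum_young[OF t, of g] by (simp add: t_def)
      qed (rule w)
      then have "fun_smult (-1) (row_col_sum m J (g \<circ> t)) \<in> word_space.span ?E"
        by (rule word_space.span_scale)
      moreover have "fun_smult (-1) (row_col_sum m J (g \<circ> t)) = row_col_sum m J g"
        using row_col_sum_comp[OF t, of g] by (simp add: t_def sign_transpose_Suc fun_smult_def)
      ultimately show ?thesis by simp
    qed
  next
    case (row i)
    have i: "i \<in> {1..<m}" using row by (auto simp: Des_def)
    have L: "?L = insert i (?L - {i})" using row i by auto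
    let ?G = "young m (?L - {i})" and ?C = "young m ?L"
    let ?v = "\<lambda>\<sigma>. fun_smult (of_int (sign \<sigma>)) (row_col_sum m J (g \<circ> \<sigma>))"
    have CG: "?C \<subseteq> ?G" by (rule young_subset) auto
    \<comment> \<open>The columns and the row step \<open>i\<close> all descend here, so the column
      merged at \<open>i\<close> is strictly decreasing throughout, as \<open>tail_sum_young\<close>
      demands.\<close>
    have dec: "g (Suc k) < g k" if "k \<in> {1..<m}" "k \<notin> ?L - {i}" for k
      using that row by (auto simp: Des_def)
    have "?v \<sigma> \<in> word_space.span ?E" if \<sigma>: "\<sigma> \<in> ?G - ?C" for \<sigma>
    proof -
      have \<sigma>G: "\<sigma> \<in> ?G" using \<sigma> by simp
      have ni: "i \<notin> ?L - {i}" by simp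
      have cs: "cut_sum m ?L h = cut_sum m (?L - {i}) h + sum h {i<..m}" for h
        using cut_sum_insert[OF ni, of m h] L by simp
      \<comment> \<open>Equality would mean that no position crosses \<open>i\<close>, which puts
        \<open>\<sigma>\<close> into the column group.\<close>
      have "sum g {i<..m} \<noteq> sum (g \<circ> \<sigma>) {i<..m}"
      proof
        assume e: "sum g {i<..m} = sum (g \<circ> \<sigma>) {i<..m}"
        have "\<And>p. i < \<sigma> p \<longleftrightarrow> i < p"
          using tail_sum_young(2)[OF \<sigma>G i ni, of g, OF dec e] by blast
        then have "\<sigma> \<in> ?C" using young_insertI[OF \<sigma>G, of i] L by simp
        then show False using \<sigma> by simp
      qed
      then have "sum g {i<..m} < sum (g \<circ> \<sigma>) {i<..m}"
        using tail_sum_young(1)[OF \<sigma>G i ni, of g, OF dec] by linarith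
      then have lt: "cut_sum m ?L g < cut_sum m ?L (g \<circ> \<sigma>)"
        using cs[of g] cs[of "g \<circ> \<sigma>"] cut_sum_young[OF \<sigma>G, of g] by linarith
      have w: "g \<circ> \<sigma> \<in> words m M" using words_comp[OF g young_Sym[OF \<sigma>G]] .
      have "row_col_sum m J (g \<circ> \<sigma>) \<in> word_space.span ?E"
      proof (rule 1)
        show "(g \<circ> \<sigma>, g) \<in> measures [\<lambda>g. card {1..<m} * (\<Sum>x\<in>#M. x) - cut_sum m ?L g, \<lambda>g. \<Sum>p\<in>{1..m}. p * g p]"
          using diff_less_mono2[OF lt less_le_trans[OF lt bnd[OF w]]] by simp
      qed (rule w)
      then show ?thesis by (rule word_space.span_scale)
    qed
    then have rest: "(\<Sum>\<sigma>\<in>?G - ?C. ?v \<sigma>) \<in> word_space.span ?E" by (rule word_space.span_sum)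
    \<comment> \<open>On the column group the two signs cancel. The Garnir relation thus contains
      the wanted vector \<open>card ?C\<close> times and is solved for it.\<close>
    have "?v \<sigma> = row_col_sum m J g" if "\<sigma> \<in> ?C" for \<sigma>
      using row_col_sum_comp[OF that, of g] by (simp add: fun_smult_def fun_eq_iff sign_def)
    then have "(\<Sum>\<sigma>\<in>?C. ?v \<sigma>) = (\<Sum>\<sigma>\<in>?C. row_col_sum m J g)" by simp
    moreover have "(\<Sum>\<sigma>\<in>?G. ?v \<sigma>) = (\<Sum>\<sigma>\<in>?G - ?C. ?v \<sigma>) + (\<Sum>\<sigma>\<in>?C. ?v \<sigma>)"
      by (rule sum.subset_diff) (use CG in auto)
    moreover have "(\<Sum>\<sigma>\<in>?G. ?v \<sigma>) = 0" by (rule garnir[OF i row(2)])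
    ultimately have z: "(\<Sum>\<sigma>\<in>?G - ?C. ?v \<sigma>) + (\<Sum>\<sigma>\<in>?C. row_col_sum m J g) = 0" by simp
    have c0: "card ?C \<noteq> 0" by (metis card_0_eq empty_iff finite_young young_id)
    have "row_col_sum m J g = fun_smult (- 1 / of_nat (card ?C)) (\<Sum>\<sigma>\<in>?G - ?C. ?v \<sigma>)"
    proof
      fix x
      have "(\<Sum>\<sigma>\<in>?G - ?C. ?v \<sigma>) x + of_nat (card ?C) * row_col_sum m J g x = 0"
        using fun_cong[OF z, of x] by (simp add: fun_sum_apply)
      then have "of_nat (card ?C) * row_col_sum m J g x = - (\<Sum>\<sigma>\<in>?G - ?C. ?v \<sigma>) x"
        by (simp only: add_eq_0_iff)
      then have "row_col_sum m J g x = - (\<Sum>\<sigma>\<in>?G - ?C. ?v \<sigma>) x / of_nat (card ?C)"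
        using c0 by (metis nonzero_mult_div_cancel_left of_nat_eq_0_iff)
      then show "row_col_sum m J g x = fun_smult (- 1 / of_nat (card ?C)) (\<Sum>\<sigma>\<in>?G - ?C. ?v \<sigma>) x"
        by (simp only: fun_smult_def times_divide_eq_left mult_minus1)
    qed
    then show ?thesis by (simp only: word_space.span_scale[OF rest])
  qed
qed

text \<open>The columns of \<open>w\<close> decrease strictly, so no tail sum after a cut in
  \<open>J\<close> can drop. If all of them persist, \<open>s\<close> preserves rows as well as
  columns, and a row of a ribbon meets a column in at most one cell.\<close>

lemma column_shuffle:
  assumes w: "Des m w = J" and s: "s \<in> young m ({1..<m} - J)"
  shows "s = id \<or> cut_sum m J w < cut_sum m J (w \<circ> s)"
proof -
  let ?L = "{1..<m} - J"
  have J: "J \<subseteq> {1..<m}" using w by (auto simp: Des_def)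
  then have finJ: "finite J" by (rule finite_subset) simp
  have dec: "w (Suc k) < w k" if "k \<in> {1..<m}" "k \<notin> ?L" for k
    using that w by (auto simp: Des_def)
  have le: "sum w {k<..m} \<le> sum (w \<circ> s) {k<..m}" if "k \<in> J" for k
    by (rule tail_sum_young(1)[OF s]) (use that J dec in auto)
  show ?thesis
  proof (cases "\<forall>k\<in>J. sum w {k<..m} = sum (w \<circ> s) {k<..m}")
    case False
    then have "(\<Sum>k\<in>J. sum w {k<..m}) < (\<Sum>k\<in>J. sum (w \<circ> s) {k<..m})"
      using le finJ by (intro sum_strict_mono_ex1) (auto simp: order_less_le)
    then show ?thesis by (simp add: cut_sum_eq_sum[OF finJ])
  next
    case True
    have "k < s p \<longleftrightarrow> k < p" if "k \<in> J" for k p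
      by (rule tail_sum_young(2)[OF s, where w = w]) (use that J dec True in auto)
    then have "{k \<in> J. k < s p} = {k \<in> J. k < p}" for p by blast
    then have "cut_index J (s p) = cut_index J p" for p by (simp add: cut_index_def)
    moreover have "cut_index ?L (s p) = cut_index ?L p" for p using s by (simp add: young_def)
    \<comment> \<open>The row index and the column index of \<open>p\<close> add up to
      \<open>p - 1\<close>, so preserving both fixes \<open>p\<close>.\<close>
    moreover have "?L \<union> J = {1..<m}" "?L \<inter> J = {}" using J by auto
    then have "cut_index {1..<m} p = cut_index ?L p + cut_index J p" for p
      using cut_index_Un[of ?L J p] by simp
    ultimately have all: "cut_index {1..<m} (s p) = cut_index {1..<m} p" for p by simp
    have "s = id"
    proof
      fix p show "s p = id p"
      proof (cases "p \<in> {1..m}")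
        case True
        then have "s p \<in> {1..m}" using Sym_in_iff[OF young_Sym[OF s]] by blast
        then show ?thesis using all[of p] True cut_index_all[of p m] cut_index_all[of "s p" m] by auto
      next
        case False then show ?thesis using Sym_outside[OF young_Sym[OF s]] by simp
      qed
    qed
    then show ?thesis ..
  qed
qed

text \<open>
  Shuffling the columns raises \<open>cut_sum m J\<close>, which the row group preserves. So the matrix
  \<open>row_col_sum m J w w'\<close> is triangular.
\<close>

lemma row_col_sum_triangular:
  assumes w: "Des m w = J" and w': "Des m w' = J"
    and nz: "row_col_sum m J w w' \<noteq> 0"
  shows "w' = w \<or> cut_sum m J w < cut_sum m J w'"
proof -
  obtain s where s: "s \<in> young m ({1..<m} - J)"
    and "(\<Sum>r\<in>young m J. of_int (sign s) * (of_bool (w \<circ> s \<circ> r = w') :: complex)) \<noteq> 0"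
    using nz unfolding row_col_sum_def by (rule sum.not_neutral_contains_not_neutral)
  then obtain r where r: "r \<in> young m J"
    and "of_int (sign s) * (of_bool (w \<circ> s \<circ> r = w') :: complex) \<noteq> 0"
    by (metis (no_types, lifting) sum.not_neutral_contains_not_neutral)
  then have eq: "w \<circ> s \<circ> r = w'" by (auto split: if_splits)
  have "cut_sum m J w' = cut_sum m J (w \<circ> s)"
    using cut_sum_young[OF r, of "w \<circ> s"] eq by simp
  moreover have "w' = w" if "s = id"
    using row_sorted_unique[OF r, of w] w w' eq that by simp
  ultimately show ?thesis using column_shuffle[OF w s] by auto
qed

text \<open>A column permutation other than \<open>id\<close> raises \<open>cut_sum m J\<close>, and
  the row group cannot lower it again. Only \<open>s = id\<close> remains, which counts the row
  stabilizer of \<open>w\<close>.\<close>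

lemma row_col_sum_diag:
  assumes w: "Des m w = J"
  shows "row_col_sum m J w w \<noteq> 0"
proof -
  let ?C = "young m ({1..<m} - J)" and ?R = "young m J"
  let ?F = "\<lambda>s. \<Sum>r\<in>?R. of_int (sign s) * (of_bool (w \<circ> s \<circ> r = w) :: complex)"
  have "of_int (sign s) * (of_bool (w \<circ> s \<circ> r = w) :: complex) = 0"
    if "s \<in> ?C - {id}" "r \<in> ?R" for s r
    using column_shuffle[OF w, of s] cut_sum_young[OF that(2), of "w \<circ> s"] that by auto
  then have "(\<Sum>s\<in>?C - {id}. ?F s) = 0" by (intro sum.neutral ballI) (simp del: sum_mult_of_bool_eq)
  moreover have "row_col_sum m J w w = ?F id + (\<Sum>s\<in>?C - {id}. ?F s)"
    unfolding row_col_sum_def by (rule sum.remove) auto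
  moreover have "?F id = of_nat (card {r \<in> ?R. w \<circ> r = w})"
    by (simp add: Int_def)
  moreover have "card {r \<in> ?R. w \<circ> r = w} \<noteq> 0"
  proof -
    have "id \<in> {r \<in> ?R. w \<circ> r = w}" by simp
    moreover have "finite {r \<in> ?R. w \<circ> r = w}" by (rule finite_subset[of _ ?R]) auto
    ultimately show ?thesis by (metis card_0_eq empty_iff)
  qed
  ultimately show ?thesis by simp
qed

text \<open>A relation is evaluated at a word \<open>v\<close> of least \<open>cut_sum\<close> among
  those with nonzero coefficient: triangularity leaves only the diagonal entry of
  \<open>v\<close>.\<close>

lemma row_col_sum_independent:
  assumes c: "(\<Sum>w | w \<in> words m M \<and> Des m w = J. fun_smult (c w) (row_col_sum m J w)) = 0"
    and w: "w \<in> words m M" "Des m w = J"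
  shows "c w = 0"
proof (rule ccontr)
  let ?D = "{w \<in> words m M. Des m w = J}"
  assume "c w \<noteq> 0"
  then have "w \<in> {w \<in> ?D. c w \<noteq> 0}" using w by simp
  then obtain v where v: "v \<in> ?D" "c v \<noteq> 0"
    and min: "\<And>u. u \<in> ?D \<Longrightarrow> c u \<noteq> 0 \<Longrightarrow> cut_sum m J v \<le> cut_sum m J u"
    using ex_has_least_nat[of "\<lambda>v. v \<in> ?D \<and> c v \<noteq> 0" w "cut_sum m J"] by blast
  have "c u * row_col_sum m J u v = 0" if "u \<in> ?D - {v}" for u
  proof (rule ccontr)
    assume "c u * row_col_sum m J u v \<noteq> 0"
    then have "c u \<noteq> 0" "row_col_sum m J u v \<noteq> 0" by simp_all
    moreover have "u \<in> words m M" "Des m u = J" "Des m v = J" "u \<noteq> v" using that v by auto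
    ultimately show False
      using row_col_sum_triangular[of m u J v] min[of u] by (auto simp: not_less[symmetric])
  qed
  then have "(\<Sum>u\<in>?D - {v}. c u * row_col_sum m J u v) = 0" by (rule sum.neutral[OF ballI])
  moreover have "(\<Sum>u\<in>?D. c u * row_col_sum m J u v) =
      c v * row_col_sum m J v v + (\<Sum>u\<in>?D - {v}. c u * row_col_sum m J u v)"
    by (rule sum.remove) (use v in auto)
  moreover have "(\<Sum>u\<in>?D. c u * row_col_sum m J u v) = 0"
    using fun_cong[OF c, of v] by (simp add: fun_sum_apply fun_smult_def)
  ultimately show False using row_col_sum_diag[of m v J] v by simp
qed

section \<open>Traces and induced characters\<close>

text \<open>The basis behind \<open>trace_on\<close> is chosen without reference to
  \<open>f\<close>, so a single \<open>B\<close> serves all maps; additivity of the trace rests on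
  this.\<close>

lemma trace_on_basis:
  assumes V: "vector_space scl" and S: "module.subspace scl S"
    and fin: "finite B0" "module.span scl B0 = S"
  obtains B where "finite B" "\<not> module.dependent scl B" "module.span scl B = S"
    "\<And>f. trace_on scl S f = (\<Sum>b\<in>B. module.representation scl B (f b) b)"
proof -
  interpret vector_space scl by (rule V)
  obtain E where E: "E \<subseteq> S" "independent E" "S \<subseteq> span E"
    by (rule basis_exists[of S])
  have "span E = S" by (rule span_subspace[OF E(1,3) S])
  then have ex: "\<exists>B. independent B \<and> span B = S" using E(2) by blast
  define B where "B = (SOME B. independent B \<and> span B = S)"
  have B: "independent B" "span B = S" using someI_ex[OF ex] by (auto simp: B_def)
  have "B \<subseteq> span B0" using B(2) fin(2) span_superset by blast
  then have "finite B" using independent_span_bound[OF fin(1) B(1)] by blast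
  moreover have "trace_on scl S f = (\<Sum>b\<in>B. representation B (f b) b)" for f
    by (simp add: trace_on_def B_def Let_def)
  ultimately show ?thesis using that B by blast
qed

text \<open>
  The \<open>e i\<close> need not be independent: this is the identity \<open>tr (A B) = tr (B A)\<close>, where
  \<open>B\<close> has the coordinates \<open>\<phi> i\<close> and \<open>A\<close> sends the unit vectors to the \<open>e i\<close>.
\<close>

lemma trace_on_frame:
  assumes V: "vector_space scl" and S: "module.subspace scl S"
    and fin: "finite B0" "module.span scl B0 = S" and I: "finite I"
    and e: "\<And>i. i \<in> I \<Longrightarrow> e i \<in> S"
    and add: "\<And>i v w. i \<in> I \<Longrightarrow> v \<in> S \<Longrightarrow> w \<in> S \<Longrightarrow> \<phi> i (v + w) = \<phi> i v + \<phi> i w"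
    and smult: "\<And>i c v. i \<in> I \<Longrightarrow> v \<in> S \<Longrightarrow> \<phi> i (scl c v) = c * \<phi> i v"
    and f: "\<And>v. v \<in> S \<Longrightarrow> f v = (\<Sum>i\<in>I. scl (\<phi> i v) (e i))"
  shows "trace_on scl S f = (\<Sum>i\<in>I. \<phi> i (e i))"
proof -
  interpret vector_space scl by (rule V)
  obtain B where B: "finite B" "independent B" "span B = S"
    and tr: "trace_on scl S f = (\<Sum>b\<in>B. representation B (f b) b)"
    by (rule trace_on_basis[OF V S fin]) blast
  have BS: "B \<subseteq> S" using span_superset[of B] B by simp
  have \<phi>0: "\<phi> i 0 = 0" if "i \<in> I" for i
    using smult[OF that subspace_0[OF S], of 0] by simp
  have lin: "\<phi> i (\<Sum>b\<in>A. scl (c b) b) = (\<Sum>b\<in>A. c b * \<phi> i b)" if "i \<in> I" "finite A" "A \<subseteq> S" for i A c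
    using that(2,3)
  proof (induction A)
    case (insert a A)
    then have "scl (c a) a \<in> S" "(\<Sum>b\<in>A. scl (c b) b) \<in> S"
      by (auto intro!: subspace_scale[OF S] subspace_sum[OF S])
    then show ?case using insert by (simp add: add[OF that(1)] smult[OF that(1)])
  qed (simp add: \<phi>0[OF that(1)])
  have "(\<Sum>b\<in>B. representation B (f b) b) = (\<Sum>b\<in>B. \<Sum>i\<in>I. representation B (e i) b * \<phi> i b)"
  proof (rule sum.cong[OF refl])
    fix b assume b: "b \<in> B"
    have "representation B (f b) = (\<lambda>x. \<Sum>i\<in>I. representation B (scl (\<phi> i b) (e i)) x)"
      unfolding f[OF subsetD[OF BS b]]
      by (rule representation_sum[OF B(2)]) (use B(3) e in \<open>auto intro: span_scale\<close>)
    then show "representation B (f b) b = (\<Sum>i\<in>I. representation B (e i) b * \<phi> i b)"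
      using e B by (simp add: representation_scale mult.commute)
  qed
  also have "\<dots> = (\<Sum>i\<in>I. \<Sum>b\<in>B. representation B (e i) b * \<phi> i b)" by (rule sum.swap)
  also have "\<dots> = (\<Sum>i\<in>I. \<phi> i (e i))"
  proof (rule sum.cong[OF refl])
    fix i assume i: "i \<in> I"
    have "(\<Sum>b\<in>B. scl (representation B (e i) b) b) = e i"
      by (rule sum_representation_eq) (use B e i in auto)
    then show "(\<Sum>b\<in>B. representation B (e i) b * \<phi> i b) = \<phi> i (e i)"
      using lin[OF i B(1) BS, of "representation B (e i)"] by simp
  qed
  finally show ?thesis using tr by simp
qed

lemma trace_on_sum:
  assumes V: "vector_space scl" and S: "module.subspace scl S"
    and fin: "finite B0" "module.span scl B0 = S"
    and F: "\<And>h v. h \<in> H \<Longrightarrow> v \<in> S \<Longrightarrow> F h v \<in> S"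
  shows "trace_on scl S (\<lambda>v. \<Sum>h\<in>H. F h v) = (\<Sum>h\<in>H. trace_on scl S (F h))"
proof -
  interpret vector_space scl by (rule V)
  obtain B where B: "finite B" "independent B" "span B = S"
    and tr: "\<And>f. trace_on scl S f = (\<Sum>b\<in>B. representation B (f b) b)"
    by (rule trace_on_basis[OF V S fin]) blast
  have BS: "B \<subseteq> S" using span_superset[of B] B by simp
  have "representation B (\<Sum>h\<in>H. F h b) = (\<lambda>x. \<Sum>h\<in>H. representation B (F h b) x)" if "b \<in> B" for b
    by (rule representation_sum[OF B(2)]) (use B(3) F BS that in auto)
  then show ?thesis unfolding tr by (simp add: sum.swap[of _ H])
qed

section \<open>The character of an induced representation\<close>

lemma is_representationD:
  assumes "is_representation G V"
  shows "vector_space (rep_smult V)" "module.subspace (rep_smult V) (rep_space V)"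
    "g \<in> G \<Longrightarrow> v \<in> rep_space V \<Longrightarrow> rep_act V g v \<in> rep_space V"
    "g \<in> G \<Longrightarrow> v \<in> rep_space V \<Longrightarrow> w \<in> rep_space V \<Longrightarrow> rep_act V g (v + w) = rep_act V g v + rep_act V g w"
    "g \<in> G \<Longrightarrow> v \<in> rep_space V \<Longrightarrow> rep_act V g (rep_smult V c v) = rep_smult V c (rep_act V g v)"
    "v \<in> rep_space V \<Longrightarrow> rep_act V id v = v"
    "g \<in> G \<Longrightarrow> h \<in> G \<Longrightarrow> v \<in> rep_space V \<Longrightarrow> rep_act V (g \<circ> h) v = rep_act V g (rep_act V h v)"
  using assms by (auto simp: is_representation_def)

lemma Sym_pred_iff:
  assumes "n \<ge> 1" shows "h \<in> Sym (n - 1) \<longleftrightarrow> h \<in> Sym n \<and> h n = n"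
proof
  assume h: "h \<in> Sym (n - 1)"
  then have "h \<in> Sym n" using permutes_subset[of h "{1..n - 1}" "{1..n}"] by (auto simp: Sym_def)
  then show "h \<in> Sym n \<and> h n = n" using Sym_outside[OF h, of n] assms by auto
next
  assume h: "h \<in> Sym n \<and> h n = n"
  have "h x = x" if "x \<notin> {1..n - 1}" for x
    using that h Sym_outside[of h n x] by (cases "x = n") auto
  then show "h \<in> Sym (n - 1)" using h by (auto simp: Sym_def permutes_def)
qed

text \<open>
  The cosets of \<open>Sym (n - 1)\<close> in \<open>Sym n\<close> are represented by the transpositions \<open>(j n)\<close>, the coset
  of \<open>g\<close> being determined by the preimage \<open>j\<close> of \<open>n\<close>.
\<close>

lemma character_induced:
  notes One_nat_def [simp del]
  assumes V: "is_representation (Sym (n - 1)) V" and n: "n \<ge> 1" and x: "x \<in> Sym n"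
  shows "character (induced (Sym (n - 1)) (Sym n) V) x =
    (\<Sum>j | j \<in> {1..n} \<and> x j = j. character V (transpose j n \<circ> x \<circ> transpose j n))"
proof -
  let ?G = "Sym n" and ?H = "Sym (n - 1)" and ?W = "induced (Sym (n - 1)) (Sym n) V"
  let ?S = "rep_space V" and ?s = "rep_smult V" and ?\<rho> = "rep_act V"
  let ?t = "\<lambda>j. transpose j n"
  note Vr = is_representationD[OF V]
  have W: "is_representation ?G ?W" by (rule is_representation_induced[OF V]) simp
  note Wr = is_representationD[OF W]
  interpret V: vector_space ?s by (rule Vr(1))
  obtain B0 where B0: "finite B0" "V.span B0 = ?S" using V by (auto simp: is_representation_def)
  obtain W0 where W0: "finite W0" "module.span (rep_smult ?W) W0 = rep_space ?W"
    using W by (auto simp: is_representation_def)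
  obtain B where B: "finite B" "V.independent B" "V.span B = ?S"
    and tr: "\<And>f. trace_on ?s ?S f = (\<Sum>b\<in>B. V.representation B (f b) b)"
    by (rule trace_on_basis[OF Vr(1,2) B0]) blast
  have BS: "b \<in> ?S" if "b \<in> B" for b using that V.span_base[of b B] B by simp
  have ws: "rep_smult ?W = (\<lambda>c f g. ?s c (f g))" by (simp add: induced_def)
  have wsp: "rep_space ?W = {f. (\<forall>g\<in>?G. f g \<in> ?S) \<and> (\<forall>g. g \<notin> ?G \<longrightarrow> f g = 0) \<and>
                   (\<forall>h\<in>?H. \<forall>g\<in>?G. f (h \<circ> g) = ?\<rho> h (f g))}" by (simp add: induced_def)
  have wact: "rep_act ?W x = (\<lambda>f g. f (g \<circ> x))" by (simp add: induced_def)
  have tG: "?t j \<in> ?G" if "j \<in> {1..n}" for j using that n by (intro Sym_transpose) auto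
  have tt: "?t j \<circ> ?t j = id" for j by simp
  have act0: "?\<rho> h 0 = 0" if "h \<in> ?H" for h
    using Vr(5)[OF that V.subspace_0[OF Vr(2)], of 0] by simp
  have gtH: "g \<circ> ?t j \<in> ?H" if "g \<in> ?G" "j \<in> {1..n}" "g j = n" for g j
    unfolding Sym_pred_iff[OF n] using that Sym_comp[OF that(1) tG[OF that(2)]] by simp
  have HG: "h \<in> ?G" "h n = n" if "h \<in> ?H" for h using that unfolding Sym_pred_iff[OF n] by simp_all
  \<comment> \<open>\<open>e (j, b)\<close> is supported on the coset of \<open>?t j\<close> and has
    the value \<open>b\<close> at \<open>?t j\<close>. \<open>\<phi> (j, b) F\<close> is the
    \<open>b\<close>-coordinate, at that same point, of the translate of \<open>F\<close> by
    \<open>x\<close>.\<close>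
  define e where "e = (\<lambda>(j, b) g. if g \<in> ?G \<and> g j = n then ?\<rho> (g \<circ> ?t j) b else 0)"
  define \<phi> where "\<phi> = (\<lambda>(j, b) F. V.representation B (F (?t j \<circ> x)) b)"
  let ?I = "{1..n} \<times> B"
  have txG: "?t j \<circ> x \<in> ?G" if "j \<in> {1..n}" for j using tG[OF that] x by (rule Sym_comp)
  have eW: "e i \<in> rep_space ?W" if i: "i \<in> ?I" for i
  proof -
    obtain j b where ib: "i = (j, b)" "j \<in> {1..n}" "b \<in> B" using i by auto
    have 1: "e i g \<in> ?S" if "g \<in> ?G" for g
      using Vr(3)[OF gtH[OF that ib(2)] BS[OF ib(3)]] V.subspace_0[OF Vr(2)] that ib(1) by (simp add: e_def)
    have 2: "e i g = 0" if "g \<notin> ?G" for g using that ib(1) by (simp add: e_def)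
    have 3: "e i (h \<circ> g) = ?\<rho> h (e i g)" if h: "h \<in> ?H" and g: "g \<in> ?G" for h g
    proof -
      have hg: "h \<circ> g \<in> ?G" using HG(1)[OF h] g by (rule Sym_comp)
      have "(h \<circ> g) j = n \<longleftrightarrow> g j = n" using HG[OF h] Sym_eq_iff[of h n "g j" n] by simp
      then show ?thesis
        using hg g ib(1) Vr(7)[OF h gtH[OF g ib(2)] BS[OF ib(3)]] act0[OF h]
        by (simp add: e_def comp_assoc)
    qed
    show ?thesis using 1 2 3 by (simp add: wsp)
  qed
  have expand: "K g = (\<Sum>i\<in>?I. ?s (V.representation B (K (?t (fst i))) (snd i)) (e i g))"
    if K: "K \<in> rep_space ?W" for K g
  proof (cases "g \<in> ?G")
    case False
    then show ?thesis using K by (simp add: wsp e_def split_beta)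
  next
    case g: True
    define j where "j = inv g n"
    have j: "j \<in> {1..n}" "g j = n"
      using n Sym_in_iff[OF Sym_inv[OF g], of n] Sym_inv_apply(2)[OF g] by (auto simp: j_def)
    have uniq: "g k = n \<longleftrightarrow> k = j" for k using j(2) Sym_eq_iff[OF g, of k j] by auto
    define h where "h = g \<circ> ?t j"
    have hH: "h \<in> ?H" unfolding h_def by (rule gtH[OF g j])
    have KS: "K (?t j) \<in> ?S" using K tG[OF j(1)] by (simp add: wsp)
    have lin: "?\<rho> h (\<Sum>b\<in>A. ?s (c b) b) = (\<Sum>b\<in>A. ?s (c b) (?\<rho> h b))" if "finite A" "A \<subseteq> B" for A c
      using that
    proof (induction A)
      case (insert a A)
      then have aS: "a \<in> ?S" and AS: "\<And>b. b \<in> A \<Longrightarrow> b \<in> ?S" using BS by auto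
      have "?s (c a) a \<in> ?S" using aS by (rule V.subspace_scale[OF Vr(2)])
      moreover have "(\<Sum>b\<in>A. ?s (c b) b) \<in> ?S"
        by (intro V.subspace_sum[OF Vr(2)] V.subspace_scale[OF Vr(2)] AS)
      ultimately show ?case using insert aS by (simp add: Vr(4)[OF hH] Vr(5)[OF hH])
    qed (simp add: act0[OF hH])
    \<comment> \<open>Equivariance recovers \<open>K\<close> on the whole coset from its value at
      \<open>?t j\<close>.\<close>
    have "K g = K (h \<circ> ?t j)" by (simp add: h_def comp_assoc)
    also have "\<dots> = ?\<rho> h (K (?t j))" using K hH tG[OF j(1)] by (simp add: wsp)
    also have "K (?t j) = (\<Sum>b\<in>B. ?s (V.representation B (K (?t j)) b) b)"
      by (rule V.sum_representation_eq[symmetric]) (use B KS in auto)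
    also have "?\<rho> h \<dots> = (\<Sum>b\<in>B. ?s (V.representation B (K (?t j)) b) (?\<rho> h b))"
      by (rule lin) (use B in auto)
    also have "\<dots> = (\<Sum>k\<in>{1..n}. if k = j then \<Sum>b\<in>B. ?s (V.representation B (K (?t k)) b) (?\<rho> (g \<circ> ?t k) b) else 0)"
      using j(1) by (simp add: h_def)
    also have "\<dots> = (\<Sum>k\<in>{1..n}. \<Sum>b\<in>B. ?s (V.representation B (K (?t k)) b) (e (k, b) g))"
      by (intro sum.cong) (auto simp: e_def g uniq)
    also have "\<dots> = (\<Sum>i\<in>?I. ?s (V.representation B (K (?t (fst i))) (snd i)) (e i g))"
      by (simp add: sum.cartesian_product split_beta)
    finally show ?thesis .
  qed
  have "character ?W x = (\<Sum>i\<in>?I. \<phi> i (e i))"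
    unfolding character_def
  proof (rule trace_on_frame[OF Wr(1,2) W0])
    show "finite ?I" using B by simp
    show "e i \<in> rep_space ?W" if "i \<in> ?I" for i by (rule eW[OF that])
    fix i assume i: "i \<in> ?I"
    then have tx: "?t (fst i) \<circ> x \<in> ?G" using txG by auto
    show "\<phi> i (v + w) = \<phi> i v + \<phi> i w" if "v \<in> rep_space ?W" "w \<in> rep_space ?W" for v w
      using that tx B(2,3) by (simp add: \<phi>_def split_beta wsp V.representation_add)
    show "\<phi> i (rep_smult ?W c v) = c * \<phi> i v" if "v \<in> rep_space ?W" for c v
      using that tx B(2,3) by (simp add: \<phi>_def split_beta wsp ws V.representation_scale)
  next
    fix v assume v: "v \<in> rep_space ?W"
    show "rep_act ?W x v = (\<Sum>i\<in>?I. rep_smult ?W (\<phi> i v) (e i))"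
    proof
      fix g
      show "rep_act ?W x v g = (\<Sum>i\<in>?I. rep_smult ?W (\<phi> i v) (e i)) g"
        using expand[OF Wr(3)[OF x v], of g]
        by (simp add: wact ws \<phi>_def split_beta fun_sum_apply)
    qed
  qed
  also have "\<dots> = (\<Sum>j\<in>{1..n}. \<Sum>b\<in>B. \<phi> (j, b) (e (j, b)))"
    by (simp add: sum.cartesian_product split_beta)
  also have "\<dots> = (\<Sum>j\<in>{1..n}. if x j = j then character V (?t j \<circ> x \<circ> ?t j) else 0)"
  proof (rule sum.cong[OF refl])
    fix j assume j: "j \<in> {1..n}"
    \<comment> \<open>The point \<open>?t j \<circ> x\<close> lies in the coset supporting
      \<open>e (j, b)\<close> exactly when \<open>x\<close> fixes \<open>j\<close>.\<close>
    have "transpose j n (x j) = n \<longleftrightarrow> x j = j" by (auto simp: transpose_def)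
    then have "\<phi> (j, b) (e (j, b)) = (if x j = j then V.representation B (?\<rho> (?t j \<circ> x \<circ> ?t j) b) b else 0)" for b
      using txG[OF j] by (simp add: \<phi>_def e_def V.representation_zero)
    then show "(\<Sum>b\<in>B. \<phi> (j, b) (e (j, b))) = (if x j = j then character V (?t j \<circ> x \<circ> ?t j) else 0)"
      by (simp add: character_def tr)
  qed
  finally show ?thesis by (simp add: sum.If_cases Int_def)
qed

section \<open>Ribbon Specht modules\<close>

text \<open>Column minus row equals \<open>i\<close> on the cell labelled \<open>i + 1\<close>, so the label can be read off the cell.\<close>

definition ribbon_tableau :: "nat \<Rightarrow> nat set \<Rightarrow> (nat \<Rightarrow> nat) \<Rightarrow> tableau" where
  "ribbon_tableau m J \<tau> z = (if z \<in> ribbon m J then \<tau> (Suc (nat (snd z - fst z))) else 0)"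

definition ribbon_tabloid :: "nat \<Rightarrow> nat set \<Rightarrow> (nat \<Rightarrow> nat) \<Rightarrow> tabloid" where
  "ribbon_tabloid m J \<tau> = tabloid_of m (ribbon m J) (ribbon_tableau m J \<tau>)"

text \<open>A step across an element of \<open>J\<close> goes up, any other step goes right. So rows
  are the blocks cut at \<open>J\<close>, with negated indices, and columns the complementary
  blocks. An element \<open>0\<close> of \<open>J\<close> would be counted by
  \<open>cut_index\<close> without belonging to a step.\<close>

lemma ribbon_cell_eq:
  assumes "0 \<notin> J"
  shows "ribbon_cell J i = (- int (cut_index J (Suc i)), int i - int (cut_index J (Suc i)))"
proof (induction i)
  case 0
  have "{k \<in> J. k < Suc 0} = {}" using assms by auto
  then show ?case by (simp add: cut_index_def)
next
  case (Suc i)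
  have fin: "finite {k \<in> J. k < Suc i}" by (rule finite_subset[of _ "{..i}"]) auto
  have "{k \<in> J. k < Suc (Suc i)} = (if Suc i \<in> J then insert (Suc i) {k \<in> J. k < Suc i} else {k \<in> J. k < Suc i})"
    by (auto simp: less_Suc_eq)
  then have "cut_index J (Suc (Suc i)) = cut_index J (Suc i) + of_bool (Suc i \<in> J)"
    using fin by (simp add: cut_index_def)
  then show ?case using Suc by simp
qed

lemma cut_index_compl:
  assumes "J \<subseteq> {1..<m}" "p \<in> {1..m}"
  shows "int (cut_index ({1..<m} - J) p) = int p - 1 - int (cut_index J p)"
proof -
  have "({1..<m} - J) \<union> J = {1..<m}" "({1..<m} - J) \<inter> J = {}" using assms(1) by auto
  then have "cut_index {1..<m} p = cut_index ({1..<m} - J) p + cut_index J p"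
    using cut_index_Un[of "{1..<m} - J" J p] by simp
  then show ?thesis using cut_index_all[OF assms(2)] assms(2) by auto
qed

locale ribbon_shape =
  fixes m :: nat and J :: "nat set"
  assumes J: "J \<subseteq> {1..<m}"
begin

abbreviation "Z \<equiv> ribbon m J"
abbreviation "T \<equiv> ribbon_tableau m J"
abbreviation "tb \<equiv> ribbon_tabloid m J"
abbreviation "colcuts \<equiv> {1..<m} - J"
abbreviation "cell p \<equiv> ribbon_cell J (p - 1)"

lemma cell_eq:
  assumes "p \<in> {1..m}"
  shows "cell p = (- int (cut_index J p), int (cut_index colcuts p))"
proof -
  have "0 \<notin> J" using J by auto
  from ribbon_cell_eq[OF this, of "p - 1"] show ?thesis
    using cut_index_compl[OF J assms] assms by auto
qed

lemma cell_diff: "p \<in> {1..m} \<Longrightarrow> Suc (nat (snd (cell p) - fst (cell p))) = p"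
  using cell_eq[of p] cut_index_compl[OF J, of p] by auto

lemma Z_eq: "Z = (\<lambda>p. cell p) ` {1..m}"
proof -
  have "{..<m} = (\<lambda>p. p - 1) ` {1..m}" by (auto simp: image_iff intro!: bexI[of _ "Suc _"])
  then show ?thesis by (simp add: ribbon_def image_image)
qed

lemma T_cell: "p \<in> {1..m} \<Longrightarrow> T \<tau> (cell p) = \<tau> p"
  using cell_diff[of p] Z_eq by (simp add: ribbon_tableau_def)

lemma bij_cell: "bij_betw (\<lambda>p. cell p) {1..m} Z"
  unfolding bij_betw_def Z_eq by (metis (mono_tags, lifting) cell_diff inj_onI)

lemma T_tableau:
  assumes "\<tau> \<in> Sym m" shows "T \<tau> \<in> tableaux m Z"
proof -
  have "bij_betw \<tau> {1..m} {1..m}" using assms by (simp add: Sym_def permutes_imp_bij)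
  then have "bij_betw (\<lambda>p. T \<tau> (cell p)) {1..m} {1..m}"
    by (simp only: T_cell cong: bij_betw_cong)
  then have "bij_betw (T \<tau> \<circ> (\<lambda>p. cell p)) {1..m} {1..m}" by (simp add: comp_def)
  then have "bij_betw (T \<tau>) Z {1..m}" using bij_betw_comp_iff[OF bij_cell] by blast
  then show ?thesis by (simp add: tableaux_def ribbon_tableau_def)
qed

text \<open>Read along the labels, a tableau is a permutation. Permuting entries is then composition
  on the left, permuting cells composition on the right.\<close>

lemma tableaux_eq: "tableaux m Z = T ` Sym m"
proof
  show "T ` Sym m \<subseteq> tableaux m Z" using T_tableau by auto
  show "tableaux m Z \<subseteq> T ` Sym m"
  proof
    fix X assume X: "X \<in> tableaux m Z"
    define \<tau> where "\<tau> p = (if p \<in> {1..m} then X (cell p) else p)" for p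
    have "bij_betw X Z {1..m}" using X by (simp add: tableaux_def)
    then have "bij_betw (X \<circ> (\<lambda>p. cell p)) {1..m} {1..m}" using bij_cell bij_betw_trans by blast
    then have "bij_betw \<tau> {1..m} {1..m}" by (rule iffD1[OF bij_betw_cong, rotated]) (simp add: \<tau>_def)
    then have "\<tau> \<in> Sym m" unfolding Sym_def by (auto intro!: bij_imp_permutes simp: \<tau>_def)
    moreover have "X = T \<tau>"
    proof
      fix z show "X z = T \<tau> z"
      proof (cases "z \<in> Z")
        case True
        then obtain p where p: "p \<in> {1..m}" "z = cell p" using Z_eq by auto
        then show ?thesis using T_cell[OF p(1), of \<tau>] by (simp add: \<tau>_def)
      next
        case False then show ?thesis using X by (simp add: tableaux_def ribbon_tableau_def del: split_paired_All)
      qed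
    qed
    ultimately show "X \<in> T ` Sym m" by blast
  qed
qed

lemma comp_T: "h \<in> Sym m \<Longrightarrow> h \<circ> T \<tau> = T (h \<circ> \<tau>)"
  using Sym_outside[of h m 0] by (auto simp: ribbon_tableau_def)

lemma T_row: "T \<tau> ` row_of Z r = \<tau> ` {p \<in> {1..m}. - int (cut_index J p) = r}"
proof -
  have "row_of Z r = (\<lambda>p. cell p) ` {p \<in> {1..m}. fst (cell p) = r}"
    by (auto simp: row_of_def Z_eq)
  also have "{p \<in> {1..m}. fst (cell p) = r} = {p \<in> {1..m}. - int (cut_index J p) = r}"
    using cell_eq by (intro Collect_cong conj_cong refl) simp
  finally show ?thesis using T_cell by (simp add: image_image cong: image_cong_simp)
qed

lemma T_column: "T \<tau> ` column_of Z c = \<tau> ` {p \<in> {1..m}. int (cut_index colcuts p) = c}"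
proof -
  have "column_of Z c = (\<lambda>p. cell p) ` {p \<in> {1..m}. snd (cell p) = c}"
    by (auto simp: column_of_def Z_eq)
  also have "{p \<in> {1..m}. snd (cell p) = c} = {p \<in> {1..m}. int (cut_index colcuts p) = c}"
    using cell_eq by (intro Collect_cong conj_cong refl) simp
  finally show ?thesis using T_cell by (simp add: image_image cong: image_cong_simp)
qed

end

text \<open>Fillings with the same sets in all blocks differ by a permutation of positions within
  blocks. \<open>F\<close> turns block indices into coordinates: negated for rows, unchanged for
  columns.\<close>

lemma same_blocks_iff:
  fixes F :: "nat \<Rightarrow> int"
  assumes F: "inj F" and t: "\<tau> \<in> Sym m" "\<tau>' \<in> Sym m"
  shows "(\<forall>r. \<tau>' ` {p \<in> {1..m}. F (cut_index L p) = r} = \<tau> ` {p \<in> {1..m}. F (cut_index L p) = r})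
     \<longleftrightarrow> inv \<tau> \<circ> \<tau>' \<in> young m L"
proof -
  let ?P = "\<lambda>r. {p \<in> {1..m}. F (cut_index L p) = r}"
  let ?s = "inv \<tau> \<circ> \<tau>'"
  have s: "?s \<in> Sym m" using t by (simp add: Sym_comp Sym_inv)
  have "(\<forall>r. \<tau>' ` ?P r = \<tau> ` ?P r) \<longleftrightarrow> (\<forall>r. ?s ` ?P r = ?P r)"
  proof (intro iff_allI)
    fix r
    show "\<tau>' ` ?P r = \<tau> ` ?P r \<longleftrightarrow> ?s ` ?P r = ?P r"
    proof
      assume "\<tau>' ` ?P r = \<tau> ` ?P r"
      then have "inv \<tau> ` (\<tau>' ` ?P r) = inv \<tau> ` (\<tau> ` ?P r)" by simp
      then show "?s ` ?P r = ?P r" by (simp only: image_comp Sym_inv_o[OF t(1)] image_id id_apply)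
    next
      assume "?s ` ?P r = ?P r"
      then have "\<tau> ` (?s ` ?P r) = \<tau> ` ?P r" by simp
      then show "\<tau>' ` ?P r = \<tau> ` ?P r" by (simp only: image_comp Sym_inv_cancel[OF t(1)])
    qed
  qed
  also have "\<dots> \<longleftrightarrow> (\<forall>p. cut_index L (?s p) = cut_index L p)"
  proof (intro iffI allI)
    fix p assume a: "\<forall>r. ?s ` ?P r = ?P r"
    show "cut_index L (?s p) = cut_index L p"
    proof (cases "p \<in> {1..m}")
      case True
      then have "p \<in> ?P (F (cut_index L p))" by simp
      then have "?s p \<in> ?P (F (cut_index L p))" using a by blast
      then show ?thesis using injD[OF F] by simp
    next
      case False then show ?thesis using Sym_outside[OF s] by simp
    qed
  next
    fix r assume a: "\<forall>p. cut_index L (?s p) = cut_index L p"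
    show "?s ` ?P r = ?P r"
    proof (rule card_subset_eq)
      show "?s ` ?P r \<subseteq> ?P r"
      proof
        fix y assume "y \<in> ?s ` ?P r"
        then obtain p where "p \<in> ?P r" "y = ?s p" by blast
        then show "y \<in> ?P r" using a Sym_in_iff[OF s, of p] by auto
      qed
      show "card (?s ` ?P r) = card (?P r)"
        using Sym_eq_iff[OF s] by (intro card_image) (auto simp: inj_on_def)
    qed simp
  qed
  finally show ?thesis using s by (simp add: young_def)
qed

context ribbon_shape
begin

text \<open>Tabloids become left cosets of the row group of positions.\<close>

lemma tb_eq_iff:
  assumes t: "\<tau> \<in> Sym m" "\<tau>' \<in> Sym m"
  shows "tb \<tau>' = tb \<tau> \<longleftrightarrow> inv \<tau> \<circ> \<tau>' \<in> young m J"
proof -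
  have "tb \<tau>' = tb \<tau> \<longleftrightarrow> (\<forall>r. T \<tau>' ` row_of Z r = T \<tau> ` row_of Z r)"
  proof
    assume "tb \<tau>' = tb \<tau>"
    moreover have "T \<tau>' \<in> tb \<tau>'" using T_tableau[OF t(2)] by (simp add: ribbon_tabloid_def tabloid_of_def)
    ultimately have "T \<tau>' \<in> tb \<tau>" by simp
    then show "\<forall>r. T \<tau>' ` row_of Z r = T \<tau> ` row_of Z r"
      by (simp add: ribbon_tabloid_def tabloid_of_def)
  qed (simp add: ribbon_tabloid_def tabloid_of_def)
  then show ?thesis
    unfolding T_row using same_blocks_iff[of "\<lambda>x. - int x", OF _ t, of J] by (simp add: inj_def)
qed

lemma column_stabilizer_T:
  assumes t: "\<tau> \<in> Sym m"
  shows "column_stabilizer m Z (T \<tau>) = {s \<in> Sym m. inv \<tau> \<circ> (s \<circ> \<tau>) \<in> young m colcuts}"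
proof -
  have "(\<forall>c. s ` T \<tau> ` column_of Z c = T \<tau> ` column_of Z c) \<longleftrightarrow> inv \<tau> \<circ> (s \<circ> \<tau>) \<in> young m colcuts"
    if s: "s \<in> Sym m" for s
    unfolding T_column image_comp
    by (rule same_blocks_iff[of int, OF _ t Sym_comp[OF s t]]) (simp add: inj_def)
  then show ?thesis unfolding column_stabilizer_def by blast
qed

text \<open>The column stabilizer permutes entries; conjugation by \<open>\<tau>\<close> turns it
  into the column group of positions and preserves signs.\<close>

lemma polytabloid_T:
  assumes t: "\<tau> \<in> Sym m"
  shows "polytabloid m Z (T \<tau>) U = (\<Sum>s\<in>young m colcuts. of_int (sign s) * of_bool (U = tb (\<tau> \<circ> s)))"
  unfolding polytabloid_def column_stabilizer_T[OF t]
proof (rule sum.reindex_bij_witness[of _ "\<lambda>s. \<tau> \<circ> s \<circ> inv \<tau>" "\<lambda>s. inv \<tau> \<circ> (s \<circ> \<tau>)"])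
  fix s assume s: "s \<in> young m colcuts"
  have "\<tau> \<circ> s \<circ> inv \<tau> \<in> Sym m" using s t by (simp add: young_Sym Sym_comp Sym_inv)
  then show "\<tau> \<circ> s \<circ> inv \<tau> \<in> {s \<in> Sym m. inv \<tau> \<circ> (s \<circ> \<tau>) \<in> young m colcuts}"
    using s by (simp add: comp_assoc Sym_inv_o[OF t] Sym_inv_cancel[OF t] del: One_nat_def)
  show "inv \<tau> \<circ> (\<tau> \<circ> s \<circ> inv \<tau> \<circ> \<tau>) = s"
    by (simp add: comp_assoc Sym_inv_o[OF t] Sym_inv_cancel[OF t])
next
  fix s assume s: "s \<in> {s \<in> Sym m. inv \<tau> \<circ> (s \<circ> \<tau>) \<in> young m colcuts}"
  then have sS: "s \<in> Sym m" by simp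
  show "\<tau> \<circ> (inv \<tau> \<circ> (s \<circ> \<tau>)) \<circ> inv \<tau> = s"
    by (simp add: comp_assoc Sym_inv_o[OF t] Sym_inv_cancel[OF t])
  show "inv \<tau> \<circ> (s \<circ> \<tau>) \<in> young m colcuts" using s by simp
  have "sign \<tau> * sign \<tau> = 1" by (simp add: sign_def)
  then have "sign (inv \<tau> \<circ> (s \<circ> \<tau>)) = sign s"
    using t sS by (simp add: Sym_sign_comp[of _ m] Sym_comp Sym_inv Sym_sign_inv mult.left_commute)
  moreover have "\<tau> \<circ> (inv \<tau> \<circ> (s \<circ> \<tau>)) = s \<circ> \<tau>" by (simp add: Sym_inv_cancel[OF t])
  ultimately show "of_int (sign (inv \<tau> \<circ> (s \<circ> \<tau>))) * of_bool (U = tb (\<tau> \<circ> (inv \<tau> \<circ> (s \<circ> \<tau>)))) =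
    (of_int (sign s) :: complex) * of_bool (U = tabloid_of m Z (s \<circ> T \<tau>))"
    by (simp add: comp_T[OF sS] ribbon_tabloid_def)
qed

lemma image_tb:
  assumes h: "h \<in> Sym m" and t: "\<tau> \<in> Sym m"
  shows "(\<lambda>X. h \<circ> X) ` tb \<tau> = tb (h \<circ> \<tau>)"
proof -
  have tb: "tb \<tau> = T ` {\<sigma> \<in> Sym m. inv \<tau> \<circ> \<sigma> \<in> young m J}" if "\<tau> \<in> Sym m" for \<tau>
  proof -
    have "tb \<tau> = {X \<in> tableaux m Z. \<forall>r. X ` row_of Z r = T \<tau> ` row_of Z r}"
      by (simp add: ribbon_tabloid_def tabloid_of_def)
    also have "\<dots> = T ` {\<sigma> \<in> Sym m. \<forall>r. T \<sigma> ` row_of Z r = T \<tau> ` row_of Z r}"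
      unfolding tableaux_eq by auto
    also have "{\<sigma> \<in> Sym m. \<forall>r. T \<sigma> ` row_of Z r = T \<tau> ` row_of Z r} = {\<sigma> \<in> Sym m. inv \<tau> \<circ> \<sigma> \<in> young m J}"
      unfolding T_row
      by (intro Collect_cong conj_cong refl same_blocks_iff[of "\<lambda>x. - int x", OF _ that]) (auto simp: inj_def)
    finally show ?thesis .
  qed
  have "(\<lambda>\<sigma>. h \<circ> \<sigma>) ` {\<sigma> \<in> Sym m. inv \<tau> \<circ> \<sigma> \<in> young m J} = {\<sigma> \<in> Sym m. inv (h \<circ> \<tau>) \<circ> \<sigma> \<in> young m J}"
  proof (intro set_eqI iffI)
    fix \<sigma> assume "\<sigma> \<in> {\<sigma> \<in> Sym m. inv (h \<circ> \<tau>) \<circ> \<sigma> \<in> young m J}"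
    then have "inv h \<circ> \<sigma> \<in> {\<sigma> \<in> Sym m. inv \<tau> \<circ> \<sigma> \<in> young m J}"
      using h t by (simp add: inv_comp_Sym[OF h t] comp_assoc Sym_comp Sym_inv)
    moreover have "\<sigma> = h \<circ> (inv h \<circ> \<sigma>)" by (simp add: Sym_inv_cancel[OF h])
    ultimately show "\<sigma> \<in> (\<lambda>\<sigma>. h \<circ> \<sigma>) ` {\<sigma> \<in> Sym m. inv \<tau> \<circ> \<sigma> \<in> young m J}" by blast
  qed (use h t in \<open>auto simp: inv_comp_Sym[OF h t] comp_assoc Sym_comp Sym_inv_cancel[OF h]\<close>)
  then show ?thesis
    unfolding tb[OF t] tb[OF Sym_comp[OF h t]] image_image comp_T[OF h]
    by (simp add: image_image[symmetric, of T "\<lambda>\<sigma>. h \<circ> \<sigma>"])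
qed

end

section \<open>Coordinates in the span of the symmetrized words\<close>

lemma word_span_coordinates:
  assumes "x \<in> word_space.span (row_col_sum m J ` D)" "finite D"
  shows "\<exists>c. x = (\<Sum>w\<in>D. fun_smult (c w) (row_col_sum m J w))"
  using assms(1)
proof (induction rule: word_space.span_induct_alt)
  case base
  show ?case by (rule exI[of _ "\<lambda>_. 0"]) (simp add: fun_eq_iff fun_sum_apply fun_smult_def)
next
  case (step a y x)
  then obtain c w where c: "x = (\<Sum>w\<in>D. fun_smult (c w) (row_col_sum m J w))"
    and w: "w \<in> D" "y = row_col_sum m J w" by auto
  have "fun_smult a y + x = (\<Sum>v\<in>D. fun_smult (c v + (if v = w then a else 0)) (row_col_sum m J v))"
  proof
    fix z
    have "(\<Sum>v\<in>D. (if v = w then a else 0) * row_col_sum m J v z) = a * row_col_sum m J w z"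
      using w assms(2) by (simp add: if_distrib[of "\<lambda>q. q * _"] cong: if_cong)
    then show "(fun_smult a y + x) z = (\<Sum>v\<in>D. fun_smult (c v + (if v = w then a else 0)) (row_col_sum m J v)) z"
      by (simp add: c w fun_sum_apply fun_smult_def distrib_right sum.distrib)
  qed
  then show ?case by (rule exI[of _ "\<lambda>v. c v + (if v = w then a else 0)"])
qed

text \<open>Spanning provides coordinates, and independence makes them unique, hence linear. Indexed
  by words, they supply the functionals that \<open>trace_on_frame\<close> expects.\<close>

lemma word_coordinates:
  fixes M :: "nat multiset"
  assumes J: "J \<subseteq> {1..<m}"
  defines "D \<equiv> {w \<in> words m M. Des m w = J}"
  defines "X \<equiv> word_space.span (row_col_sum m J ` words m M)"
  obtains \<kappa> :: "((nat \<Rightarrow> nat) \<Rightarrow> complex) \<Rightarrow> (nat \<Rightarrow> nat) \<Rightarrow> complex"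
  where "\<And>x. x \<in> X \<Longrightarrow> x = (\<Sum>w\<in>D. fun_smult (\<kappa> x w) (row_col_sum m J w))"
    and "\<And>x y w. x \<in> X \<Longrightarrow> y \<in> X \<Longrightarrow> w \<in> D \<Longrightarrow> \<kappa> (x + y) w = \<kappa> x w + \<kappa> y w"
    and "\<And>a x w. x \<in> X \<Longrightarrow> w \<in> D \<Longrightarrow> \<kappa> (fun_smult a x) w = a * \<kappa> x w"
    and "\<And>w. w \<in> D \<Longrightarrow> \<kappa> (row_col_sum m J w) w = 1"
proof -
  let ?\<epsilon> = "row_col_sum m J"
  let ?comb = "\<lambda>c. \<Sum>w\<in>D. fun_smult (c w) (?\<epsilon> w)"
  have finD: "finite D" by (simp add: D_def)
  have "X \<subseteq> word_space.span (?\<epsilon> ` D)"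
    unfolding X_def by (rule word_space.span_minimal)
      (use row_col_sum_span[OF J] in \<open>auto simp: D_def word_space.subspace_span\<close>)
  then have ex: "\<exists>c. x = ?comb c" if "x \<in> X" for x
    using word_span_coordinates[OF _ finD] that by blast
  have uniq: "c w = c' w" if "?comb c = ?comb c'" "w \<in> D" for c c' w
  proof -
    have "?comb (\<lambda>w. c w - c' w) = ?comb c - ?comb c'"
      by (simp add: fun_eq_iff fun_sum_apply fun_smult_def left_diff_distrib sum_subtractf)
    then have "?comb (\<lambda>w. c w - c' w) = 0" using that(1) by simp
    then have "c w - c' w = 0"
      using row_col_sum_independent[where c = "\<lambda>w. c w - c' w"] that(2) by (simp add: D_def)
    then show ?thesis by simp
  qed
  define \<kappa> where "\<kappa> x = (SOME c. x = ?comb c)" for x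
  have \<kappa>: "x = ?comb (\<kappa> x)" if "x \<in> X" for x
    unfolding \<kappa>_def by (rule someI_ex[OF ex[OF that]])
  have add: "\<kappa> (x + y) w = \<kappa> x w + \<kappa> y w" if "x \<in> X" "y \<in> X" "w \<in> D" for x y w
  proof (rule uniq[OF _ that(3)])
    have "x + y \<in> X" using that unfolding X_def by (simp add: word_space.span_add)
    have "?comb (\<lambda>w. \<kappa> x w + \<kappa> y w) = ?comb (\<kappa> x) + ?comb (\<kappa> y)"
      by (simp add: fun_eq_iff fun_sum_apply fun_smult_def distrib_right sum.distrib)
    then show "?comb (\<kappa> (x + y)) = ?comb (\<lambda>w. \<kappa> x w + \<kappa> y w)"
      using \<kappa>[OF that(1)] \<kappa>[OF that(2)] \<kappa>[OF \<open>x + y \<in> X\<close>] by simp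
  qed
  have scale: "\<kappa> (fun_smult a x) w = a * \<kappa> x w" if "x \<in> X" "w \<in> D" for a x w
  proof (rule uniq[OF _ that(2)])
    have sX: "fun_smult a x \<in> X" using that unfolding X_def by (simp add: word_space.span_scale)
    have "?comb (\<lambda>w. a * \<kappa> x w) = fun_smult a (?comb (\<kappa> x))"
      by (simp add: fun_eq_iff fun_sum_apply fun_smult_def sum_distrib_left mult.assoc)
    then show "?comb (\<kappa> (fun_smult a x)) = ?comb (\<lambda>w. a * \<kappa> x w)"
      using \<kappa>[OF that(1)] \<kappa>[OF sX] by simp
  qed
  have one: "\<kappa> (?\<epsilon> w) w = 1" if w: "w \<in> D" for w
  proof -
    have "?\<epsilon> w \<in> X" using w unfolding X_def by (intro word_space.span_base) (auto simp: D_def)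
    moreover have "?\<epsilon> w = ?comb (\<lambda>v. if v = w then 1 else 0)"
    proof
      fix z
      show "?\<epsilon> w z = ?comb (\<lambda>v. if v = w then 1 else 0) z"
        using w finD by (simp add: fun_sum_apply fun_smult_def if_distrib[of "\<lambda>q. q * _"] cong: if_cong)
    qed
    ultimately have "?comb (\<kappa> (?\<epsilon> w)) = ?comb (\<lambda>v. if v = w then 1 else 0)"
      using \<kappa> by metis
    from uniq[OF this w] show ?thesis by simp
  qed
  show ?thesis by (rule that[of \<kappa>]) (use \<kappa> add scale one in blast)+
qed

section \<open>From the Specht module to words\<close>

context ribbon_shape
begin

abbreviation "spc \<equiv> rep_space (skew_specht m Z)"
abbreviation "act \<equiv> rep_act (skew_specht m Z)"

text \<open>The linear map that replaces each entry \<open>a\<close> of a filling by the letter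
  \<open>f a\<close>. A tabloid goes to the sum of the words of all its fillings, which builds in
  the row symmetrization.\<close>

definition weight_map :: "(nat \<Rightarrow> nat) \<Rightarrow> (tabloid \<Rightarrow> complex) \<Rightarrow> (nat \<Rightarrow> nat) \<Rightarrow> complex" where
  "weight_map f v g = (\<Sum>\<tau> | \<tau> \<in> Sym m \<and> f \<circ> \<tau> = g. v (tb \<tau>))"

lemma weight_map_add: "weight_map f (v + w) = weight_map f v + weight_map f w"
  by (simp add: weight_map_def fun_eq_iff sum.distrib)

lemma weight_map_scale: "weight_map f (fun_smult c v) = fun_smult c (weight_map f v)"
  by (simp add: weight_map_def fun_eq_iff fun_smult_def sum_distrib_left)

lemma weight_map_sum: "weight_map f (\<Sum>h\<in>H. F h) = (\<Sum>h\<in>H. weight_map f (F h))"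
  by (simp add: weight_map_def fun_eq_iff fun_sum_apply sum.swap[of _ H])

text \<open>The column sum comes from the polytabloid, the row sum from the fillings of each
  tabloid, which form a coset of the row group.\<close>

lemma weight_map_polytabloid:
  assumes t: "\<tau> \<in> Sym m"
  shows "weight_map f (polytabloid m Z (T \<tau>)) = row_col_sum m J (f \<circ> \<tau>)"
proof
  fix g
  let ?C = "young m colcuts" and ?R = "young m J"
  let ?S = "{\<sigma> \<in> Sym m. f \<circ> \<sigma> = g}"
  have "(\<Sum>\<sigma>\<in>?S. of_bool (tb \<sigma> = tb (\<tau> \<circ> s))) = (\<Sum>r\<in>?R. (of_bool (f \<circ> \<tau> \<circ> s \<circ> r = g) :: complex))"
    if s: "s \<in> ?C" for s
  proof -
    define u where "u = \<tau> \<circ> s"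
    have ts: "u \<in> Sym m" unfolding u_def using t young_Sym[OF s] by (rule Sym_comp)
    have "{\<sigma> \<in> ?S. tb \<sigma> = tb u} = {\<sigma> \<in> Sym m. f \<circ> \<sigma> = g \<and> inv u \<circ> \<sigma> \<in> ?R}"
      using tb_eq_iff[OF ts] by blast
    moreover have "bij_betw (\<lambda>r. u \<circ> r) {r \<in> ?R. f \<circ> u \<circ> r = g} {\<sigma> \<in> Sym m. f \<circ> \<sigma> = g \<and> inv u \<circ> \<sigma> \<in> ?R}"
    proof (rule bij_betw_byWitness[where f' = "\<lambda>\<sigma>. inv u \<circ> \<sigma>"])
      show "(\<lambda>r. u \<circ> r) ` {r \<in> ?R. f \<circ> u \<circ> r = g}
          \<subseteq> {\<sigma> \<in> Sym m. f \<circ> \<sigma> = g \<and> inv u \<circ> \<sigma> \<in> ?R}"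
        using Sym_comp[OF ts young_Sym] by (auto simp: Sym_inv_o(1)[OF ts] o_assoc)
      show "(\<lambda>\<sigma>. inv u \<circ> \<sigma>) ` {\<sigma> \<in> Sym m. f \<circ> \<sigma> = g \<and> inv u \<circ> \<sigma> \<in> ?R}
          \<subseteq> {r \<in> ?R. f \<circ> u \<circ> r = g}"
      proof -
        have "f \<circ> u \<circ> (inv u \<circ> \<sigma>) = f \<circ> \<sigma>" for \<sigma> :: "nat \<Rightarrow> nat"
          using Sym_inv_cancel(2)[OF ts, of \<sigma>] by (simp add: comp_assoc)
        then show ?thesis by auto
      qed
    qed (auto simp: Sym_inv_cancel[OF ts])
    then have "card {r \<in> ?R. f \<circ> u \<circ> r = g} = card {\<sigma> \<in> Sym m. f \<circ> \<sigma> = g \<and> inv u \<circ> \<sigma> \<in> ?R}"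
      by (rule bij_betw_same_card)
    ultimately have "card {\<sigma> \<in> ?S. tb \<sigma> = tb u} = card {r \<in> ?R. f \<circ> u \<circ> r = g}" by simp
    then show ?thesis by (simp add: Int_def u_def o_assoc)
  qed
  then have "(\<Sum>s\<in>?C. \<Sum>\<sigma>\<in>?S. of_int (sign s) * of_bool (tb \<sigma> = tb (\<tau> \<circ> s))) =
     (\<Sum>s\<in>?C. \<Sum>r\<in>?R. of_int (sign s) * (of_bool (f \<circ> \<tau> \<circ> s \<circ> r = g) :: complex))"
    by (simp only: sum_distrib_left[symmetric] cong: sum.cong)
  then show "weight_map f (polytabloid m Z (T \<tau>)) g = row_col_sum m J (f \<circ> \<tau>) g"
    unfolding weight_map_def row_col_sum_def polytabloid_T[OF t] by (subst sum.swap)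
qed

interpretation tab: vector_space "fun_smult :: complex \<Rightarrow> (tabloid \<Rightarrow> complex) \<Rightarrow> _"
  by (rule vector_space_fun_smult)

lemma specht_eqs:
  "rep_smult (skew_specht m Z) = fun_smult"
  "spc = tab.span ((\<lambda>\<tau>. polytabloid m Z (T \<tau>)) ` Sym m)"
  "act h v U = v ((\<lambda>X. inv h \<circ> X) ` U)"
  by (simp_all add: skew_specht_def tableaux_eq image_image)

lemma specht_rep: "is_representation (Sym m) (skew_specht m Z)"
  by (rule is_representation_skew_specht[OF finite_ribbon])

lemma polytabloid_spc: "\<tau> \<in> Sym m \<Longrightarrow> polytabloid m Z (T \<tau>) \<in> spc"
  unfolding specht_eqs by (intro tab.span_base) auto

text \<open>Module elements are functions on arbitrary sets of tableaux, whereas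
  \<open>stabilizer_sum_eq\<close> gives values at genuine tabloids only. Vanishing elsewhere lets
  these values decide equality.\<close>

lemma specht_support:
  assumes "v \<in> spc" "U \<notin> tb ` Sym m" shows "v U = 0"
  using assms(1) unfolding specht_eqs
proof (induction rule: tab.span_induct_alt)
  case (step c x y)
  then obtain \<tau> where t: "\<tau> \<in> Sym m" "x = polytabloid m Z (T \<tau>)" by auto
  have "U \<noteq> tb (\<tau> \<circ> s)" if "s \<in> young m colcuts" for s
    using assms(2) Sym_comp[OF t(1) young_Sym[OF that]] by blast
  then have "x U = 0" unfolding t(2) polytabloid_T[OF t(1)] by (intro sum.neutral) auto
  then show ?case using step by (simp add: fun_smult_def)
qed simp

lemma weight_map_span:
  assumes "v \<in> spc" and f: "f \<in> words m M"
  shows "weight_map f v \<in> word_space.span (row_col_sum m J ` words m M)"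
  using assms(1) unfolding specht_eqs
proof (induction rule: tab.span_induct_alt)
  case base
  have "weight_map f 0 = 0" by (simp add: weight_map_def fun_eq_iff)
  then show ?case by (metis word_space.span_zero)
next
  case (step c x y)
  then obtain \<tau> where t: "\<tau> \<in> Sym m" "x = polytabloid m Z (T \<tau>)" by auto
  have "row_col_sum m J (f \<circ> \<tau>) \<in> word_space.span (row_col_sum m J ` words m M)"
    using words_comp[OF f t(1)] by (intro word_space.span_base) auto
  then show ?case
    unfolding t(2) weight_map_add weight_map_scale weight_map_polytabloid[OF t(1)]
    using step(2) by (intro word_space.span_add word_space.span_scale)
qed

lemma weight_map_act:
  assumes h: "h \<in> Sym m" "f \<circ> h = f"
  shows "weight_map f (act h v) = weight_map f v"
proof
  fix g
  note hi = Sym_inv[OF h(1)]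
  have fi: "f \<circ> inv h = f" using h by (metis comp_assoc comp_id Sym_inv_o(2))
  show "weight_map f (act h v) g = weight_map f v g"
    unfolding weight_map_def
  proof (rule sum.reindex_bij_witness[of _ "\<lambda>\<tau>. h \<circ> \<tau>" "\<lambda>\<tau>. inv h \<circ> \<tau>"])
    fix \<tau> assume t: "\<tau> \<in> {\<tau> \<in> Sym m. f \<circ> \<tau> = g}"
    then show "v (tb (inv h \<circ> \<tau>)) = act h v (tb \<tau>)"
      using image_tb[OF hi] by (simp add: specht_eqs)
    show "inv h \<circ> \<tau> \<in> {\<tau> \<in> Sym m. f \<circ> \<tau> = g}"
      using t fi hi by (simp add: Sym_comp o_assoc)
    show "h \<circ> \<tau> \<in> {\<tau> \<in> Sym m. f \<circ> \<tau> = g}"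
      using t h by (simp add: Sym_comp o_assoc)
  qed (simp_all add: Sym_inv_cancel[OF h(1)])
qed

text \<open>Hence the trace of the stabilizer sum can be computed in the space of words.\<close>

lemma stabilizer_sum_eq:
  assumes t: "\<tau> \<in> Sym m"
  shows "(\<Sum>h | h \<in> Sym m \<and> f \<circ> h = f. act h v) (tb \<tau>) = weight_map f v (f \<circ> \<tau>)"
  unfolding weight_map_def fun_sum_apply
proof (rule sum.reindex_bij_witness[of _ "\<lambda>\<sigma>. \<tau> \<circ> inv \<sigma>" "\<lambda>h. inv h \<circ> \<tau>"])
  fix h assume h: "h \<in> {h \<in> Sym m. f \<circ> h = f}"
  then have hS: "h \<in> Sym m" "f \<circ> h = f" by auto
  have fi: "f \<circ> inv h = f" using hS by (metis comp_assoc comp_id Sym_inv_o(2))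
  show "v (tb (inv h \<circ> \<tau>)) = act h v (tb \<tau>)"
    using image_tb[OF Sym_inv[OF hS(1)] t] by (simp add: specht_eqs)
  show "inv h \<circ> \<tau> \<in> {\<sigma> \<in> Sym m. f \<circ> \<sigma> = f \<circ> \<tau>}"
    using hS fi t by (simp add: Sym_comp Sym_inv o_assoc)
  show "\<tau> \<circ> inv (inv h \<circ> \<tau>) = h"
    by (simp add: inv_comp_Sym[OF Sym_inv[OF hS(1)] t] Sym_inv_cancel(3)[OF hS(1)] Sym_inv_cancel(2)[OF t])
next
  fix \<sigma> assume "\<sigma> \<in> {\<sigma> \<in> Sym m. f \<circ> \<sigma> = f \<circ> \<tau>}"
  then have s: "\<sigma> \<in> Sym m" "f \<circ> \<sigma> = f \<circ> \<tau>" by auto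
  have "f \<circ> (\<tau> \<circ> inv \<sigma>) = f" using s by (metis comp_assoc comp_id Sym_inv_o(2))
  then show "\<tau> \<circ> inv \<sigma> \<in> {h \<in> Sym m. f \<circ> h = f}" using s t by (simp add: Sym_comp Sym_inv)
  show "inv (\<tau> \<circ> inv \<sigma>) \<circ> \<tau> = \<sigma>"
    by (simp add: inv_comp_Sym[OF t Sym_inv[OF s(1)]] Sym_inv_cancel(3)[OF s(1)] comp_assoc Sym_inv_o(1)[OF t])
qed

text \<open>By \<open>stabilizer_sum_eq\<close>, \<open>P v\<close> depends on \<open>v\<close> only
  through \<open>weight_map f v\<close>, and \<open>weight_map f (P v)\<close> is
  \<open>card ?H\<close> times that. Each basis word thus contributes \<open>card ?H\<close> to the
  trace.\<close>

lemma sum_character_stabilizer: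
  assumes f: "f \<in> words m M"
  shows "(\<Sum>h | h \<in> Sym m \<and> f \<circ> h = f. character (skew_specht m Z) h) =
    of_nat (card {h \<in> Sym m. f \<circ> h = f}) * of_nat (card {w \<in> words m M. Des m w = J})"
proof -
  let ?H = "{h \<in> Sym m. f \<circ> h = f}" and ?D = "{w \<in> words m M. Des m w = J}"
  let ?X = "word_space.span (row_col_sum m J ` words m M)"
  define P where "P v = (\<Sum>h\<in>?H. act h v)" for v
  note R = is_representationD[OF specht_rep, unfolded specht_eqs(1)]
  obtain B0 where B0: "finite B0" "tab.span B0 = spc"
    using specht_rep by (auto simp: is_representation_def specht_eqs(1))
  obtain \<kappa> where \<kappa>: "\<And>x. x \<in> ?X \<Longrightarrow> x = (\<Sum>w\<in>?D. fun_smult (\<kappa> x w) (row_col_sum m J w))"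
    and \<kappa>_add: "\<And>x y w. x \<in> ?X \<Longrightarrow> y \<in> ?X \<Longrightarrow> w \<in> ?D \<Longrightarrow> \<kappa> (x + y) w = \<kappa> x w + \<kappa> y w"
    and \<kappa>_scale: "\<And>a x w. x \<in> ?X \<Longrightarrow> w \<in> ?D \<Longrightarrow> \<kappa> (fun_smult a x) w = a * \<kappa> x w"
    and \<kappa>_one: "\<And>w. w \<in> ?D \<Longrightarrow> \<kappa> (row_col_sum m J w) w = 1"
    by (rule word_coordinates[OF J, of M]) blast
  \<comment> \<open>Every basis word is \<open>f\<close> composed with a permutation, so its
    symmetrization lifts to a polytabloid \<open>p w\<close>; the vectors \<open>P (p w)\<close>
    will form the frame.\<close>
  have "\<forall>w\<in>?D. \<exists>\<tau>. \<tau> \<in> Sym m \<and> f \<circ> \<tau> = w"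
    using words_transitive[OF f] by blast
  from bchoice[OF this] obtain \<tau>
    where \<tau>: "\<And>w. w \<in> ?D \<Longrightarrow> \<tau> w \<in> Sym m" "\<And>w. w \<in> ?D \<Longrightarrow> f \<circ> \<tau> w = w" by blast
  define p where "p w = polytabloid m Z (T (\<tau> w))" for w
  have p: "p w \<in> spc" "weight_map f (p w) = row_col_sum m J w" if "w \<in> ?D" for w
    using polytabloid_spc[OF \<tau>(1)[OF that]] weight_map_polytabloid[OF \<tau>(1)[OF that], of f] \<tau>(2)[OF that]
    by (simp_all add: p_def)
  have Pspc: "P v \<in> spc" if "v \<in> spc" for v
    unfolding P_def by (rule tab.subspace_sum[OF R(2)]) (use R(3) that in auto)
  have Ptb: "P v (tb \<sigma>) = weight_map f v (f \<circ> \<sigma>)" if "\<sigma> \<in> Sym m" for v \<sigma>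
    unfolding P_def by (rule stabilizer_sum_eq[OF that])
  have wP: "weight_map f (P v) = fun_smult (of_nat (card ?H)) (weight_map f v)" for v
    by (simp add: P_def weight_map_sum weight_map_act fun_smult_def fun_eq_iff)
  have X: "weight_map f v \<in> ?X" if "v \<in> spc" for v by (rule weight_map_span[OF that f])
  have "trace_on fun_smult spc P = (\<Sum>w\<in>?D. \<kappa> (weight_map f (P (p w))) w)"
  proof (rule trace_on_frame[OF vector_space_fun_smult R(2) B0, where \<phi> = "\<lambda>w v. \<kappa> (weight_map f v) w"])
    show "finite ?D" by simp
    show "P (p w) \<in> spc" if "w \<in> ?D" for w using p[OF that] Pspc by blast
    show "\<kappa> (weight_map f (u + v)) w = \<kappa> (weight_map f u) w + \<kappa> (weight_map f v) w"
      if "w \<in> ?D" "u \<in> spc" "v \<in> spc" for w u v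
      unfolding weight_map_add by (rule \<kappa>_add[OF X[OF that(2)] X[OF that(3)] that(1)])
    show "\<kappa> (weight_map f (fun_smult c v)) w = c * \<kappa> (weight_map f v) w"
      if "w \<in> ?D" "v \<in> spc" for w c v
      unfolding weight_map_scale by (rule \<kappa>_scale[OF X[OF that(2)] that(1)])
    fix v assume v: "v \<in> spc"
    show "P v = (\<Sum>w\<in>?D. fun_smult (\<kappa> (weight_map f v) w) (P (p w)))"
    proof
      fix U
      show "P v U = (\<Sum>w\<in>?D. fun_smult (\<kappa> (weight_map f v) w) (P (p w))) U"
      proof (cases "U \<in> tb ` Sym m")
        case False
        then show ?thesis
          using specht_support[OF Pspc[OF v]] specht_support[OF Pspc[OF p(1)]]
          by (simp add: fun_sum_apply fun_smult_def)
      next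
        case True
        then obtain \<sigma> where s: "\<sigma> \<in> Sym m" "U = tb \<sigma>" by blast
        have "P v U = weight_map f v (f \<circ> \<sigma>)" by (simp add: s Ptb)
        also have "\<dots> = (\<Sum>w\<in>?D. fun_smult (\<kappa> (weight_map f v) w) (row_col_sum m J w)) (f \<circ> \<sigma>)"
          using \<kappa>[OF X[OF v]] by simp
        also have "\<dots> = (\<Sum>w\<in>?D. fun_smult (\<kappa> (weight_map f v) w) (P (p w))) U"
          using p(2) by (simp add: fun_sum_apply fun_smult_def s Ptb)
        finally show ?thesis .
      qed
    qed
  qed
  also have "\<dots> = (\<Sum>w\<in>?D. of_nat (card ?H))"
  proof (rule sum.cong[OF refl])
    fix w assume w: "w \<in> ?D"
    have "row_col_sum m J w \<in> ?X" using X[OF p(1)[OF w]] p(2)[OF w] by simp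
    then show "\<kappa> (weight_map f (P (p w))) w = of_nat (card ?H)"
      using w by (simp add: wP p(2)[OF w] \<kappa>_scale \<kappa>_one)
  qed
  also have "trace_on fun_smult spc P = (\<Sum>h\<in>?H. character (skew_specht m Z) h)"
    unfolding character_def specht_eqs(1) P_def
    by (rule trace_on_sum[OF vector_space_fun_smult R(2) B0]) (use R(3) in auto)
  finally show ?thesis by (simp only: sum_constant mult.commute)
qed

text \<open>The words of content \<open>M\<close> form one orbit. The permutations carrying
  \<open>f\<close> to \<open>g\<close> form a coset of the stabilizer of \<open>g\<close>, and these
  cosets partition \<open>Sym m\<close>.\<close>

lemma sum_card_stabilizer:
  assumes f: "f \<in> words m M"
  shows "(\<Sum>g\<in>words m M. card {h \<in> Sym m. g \<circ> h = g}) = fact m"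
proof -
  have "card {\<sigma> \<in> Sym m. f \<circ> \<sigma> = g} = card {h \<in> Sym m. g \<circ> h = g}" if g: "g \<in> words m M" for g
  proof -
    obtain \<tau> where t: "\<tau> \<in> Sym m" "f \<circ> \<tau> = g" by (rule words_transitive[OF f g])
    have "bij_betw (\<lambda>h. \<tau> \<circ> h) {h \<in> Sym m. g \<circ> h = g} {\<sigma> \<in> Sym m. f \<circ> \<sigma> = g}"
    proof (rule bij_betw_byWitness[where f' = "\<lambda>\<sigma>. inv \<tau> \<circ> \<sigma>"])
      show "(\<lambda>h. \<tau> \<circ> h) ` {h \<in> Sym m. g \<circ> h = g} \<subseteq> {\<sigma> \<in> Sym m. f \<circ> \<sigma> = g}"
        using t by (auto simp: Sym_comp o_assoc)
      have "g \<circ> (inv \<tau> \<circ> \<sigma>) = f \<circ> \<sigma>" for \<sigma>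
        unfolding t(2)[symmetric] by (simp add: comp_assoc Sym_inv_cancel[OF t(1)])
      then show "(\<lambda>\<sigma>. inv \<tau> \<circ> \<sigma>) ` {\<sigma> \<in> Sym m. f \<circ> \<sigma> = g} \<subseteq> {h \<in> Sym m. g \<circ> h = g}"
        using t(1) by (auto simp: Sym_comp Sym_inv)
    qed (auto simp: Sym_inv_cancel[OF t(1)])
    then show ?thesis by (simp add: bij_betw_same_card)
  qed
  then have "(\<Sum>g\<in>words m M. card {h \<in> Sym m. g \<circ> h = g}) = (\<Sum>g\<in>words m M. card {\<sigma> \<in> Sym m. f \<circ> \<sigma> = g})"
    by simp
  also have "\<dots> = card (\<Union>g\<in>words m M. {\<sigma> \<in> Sym m. f \<circ> \<sigma> = g})"
    by (rule card_UN_disjoint[symmetric]) auto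
  also have "(\<Union>g\<in>words m M. {\<sigma> \<in> Sym m. f \<circ> \<sigma> = g}) = Sym m"
    using words_comp[OF f] by auto
  also have "card (Sym m) = fact m"
    unfolding Sym_def by (rule card_permutations) simp_all
  finally show ?thesis .
qed

text \<open>Exchanging the sums groups the terms by words, each of which contributes its stabilizer
  size times the same count; the sizes add up to \<open>fact m\<close>. Up to this factor the left
  side is a coefficient of the Frobenius characteristic.\<close>

lemma sum_character_fixed_words:
  "(\<Sum>y\<in>Sym m. character (skew_specht m Z) y * of_nat (card {g \<in> words m M. g \<circ> y = g})) =
     fact m * of_nat (card {w \<in> words m M. Des m w = J})"
proof (cases "words m M = {}")
  case False
  then obtain f where f: "f \<in> words m M" by blast
  let ?\<chi> = "character (skew_specht m Z)"
  have "(\<Sum>y\<in>Sym m. ?\<chi> y * of_nat (card {g \<in> words m M. g \<circ> y = g})) =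
      (\<Sum>y\<in>Sym m. \<Sum>g\<in>words m M. if g \<circ> y = g then ?\<chi> y else 0)"
    by (simp add: sum.If_cases Int_def mult.commute)
  also have "\<dots> = (\<Sum>g\<in>words m M. \<Sum>y\<in>Sym m. if g \<circ> y = g then ?\<chi> y else 0)"
    by (rule sum.swap)
  also have "\<dots> = (\<Sum>g\<in>words m M. \<Sum>y | y \<in> Sym m \<and> g \<circ> y = g. ?\<chi> y)"
    by (simp add: sum.inter_filter)
  also have "\<dots> = (\<Sum>g\<in>words m M. of_nat (card {h \<in> Sym m. g \<circ> h = g}) * of_nat (card {w \<in> words m M. Des m w = J}))"
    by (intro sum.cong refl sum_character_stabilizer)
  also have "\<dots> = of_nat (\<Sum>g\<in>words m M. card {h \<in> Sym m. g \<circ> h = g}) * of_nat (card {w \<in> words m M. Des m w = J})"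
    by (simp add: sum_distrib_right)
  finally show ?thesis unfolding sum_card_stabilizer[OF f] by simp
qed simp

text \<open>
  By \<open>sum_character_stabilizer\<close> both numbers are determined by the stabilizer of a word, and this
  does not change when the letters are renamed.
\<close>

lemma card_words_Des_relabel:
  assumes k: "inj_on k (set_mset M)"
  shows "card {g \<in> words m M. Des m (k \<circ> g) = J} = card {g \<in> words m M. Des m g = J}"
proof (cases "words m M = {}")
  case False
  then obtain f where f: "f \<in> words m M" by blast
  \<comment> \<open>Not simply \<open>k \<circ> g\<close>: words vanish outside
    \<open>{1..m}\<close>, and \<open>k 0\<close> may be nonzero.\<close>
  define r where "r g x = (if x \<in> {1..m} then k (g x) else 0)" for g x
  have rw: "r g \<in> words m (image_mset k M)" if g: "g \<in> words m M" for g
  proof -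
    have "image_mset (r g) (mset_set {1..m}) = image_mset (k \<circ> g) (mset_set {1..m})"
      by (intro image_mset_cong) (simp add: r_def)
    also have "\<dots> = image_mset k M"
      using g by (simp only: words_def mem_Collect_eq multiset.map_comp[symmetric])
    finally show ?thesis by (auto simp: words_def r_def)
  qed
  have "r f \<circ> h = r f \<longleftrightarrow> f \<circ> h = f" if h: "h \<in> Sym m" for h
  proof
    assume e: "r f \<circ> h = r f"
    show "f \<circ> h = f"
    proof
      fix x show "(f \<circ> h) x = f x"
      proof (cases "x \<in> {1..m}")
        case True
        then have "k (f (h x)) = k (f x)"
          using fun_cong[OF e, of x] Sym_in_iff[OF h, of x] by (simp add: r_def)
        then show ?thesis
          using inj_onD[OF k] True Sym_in_iff[OF h, of x] set_words[OF f] by simp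
      next
        case False then show ?thesis using Sym_outside[OF h] by simp
      qed
    qed
  next
    assume e: "f \<circ> h = f"
    show "r f \<circ> h = r f"
      using Sym_in_iff[OF h] fun_cong[OF e] by (simp add: r_def fun_eq_iff)
  qed
  then have st: "{h \<in> Sym m. r f \<circ> h = r f} = {h \<in> Sym m. f \<circ> h = f}" by blast
  have fin: "finite {h \<in> Sym m. f \<circ> h = f}" by (rule finite_subset[of _ "Sym m"]) auto
  have "id \<in> {h \<in> Sym m. f \<circ> h = f}" by simp
  then have "card {h \<in> Sym m. f \<circ> h = f} \<noteq> 0" using fin by (metis card_0_eq empty_iff)
  moreover have "of_nat (card {h \<in> Sym m. f \<circ> h = f}) * of_nat (card {w \<in> words m M. Des m w = J})
      = (of_nat (card {h \<in> Sym m. f \<circ> h = f}) * of_nat (card {w \<in> words m (image_mset k M). Des m w = J}) :: complex)"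
    by (rule trans[OF sum_character_stabilizer[OF f, symmetric] sum_character_stabilizer[OF rw[OF f], unfolded st]])
  ultimately have c: "card {w \<in> words m M. Des m w = J} = card {w \<in> words m (image_mset k M). Des m w = J}"
    by (simp only: mult_cancel_left of_nat_eq_iff of_nat_eq_0_iff simp_thms)
  have Des_r: "Des m (r g) = Des m (k \<circ> g)" for g by (auto simp: Des_def r_def)
  have "bij_betw r {g \<in> words m M. Des m (k \<circ> g) = J} {w \<in> words m (image_mset k M). Des m w = J}"
    unfolding bij_betw_def
  proof
    show "inj_on r {g \<in> words m M. Des m (k \<circ> g) = J}"
    proof (rule inj_onI)
      fix g g' assume a: "g \<in> {g \<in> words m M. Des m (k \<circ> g) = J}" "g' \<in> {g \<in> words m M. Des m (k \<circ> g) = J}" "r g = r g'"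
      show "g = g'"
      proof
        fix x show "g x = g' x"
        proof (cases "x \<in> {1..m}")
          case True
          then have "k (g x) = k (g' x)" using fun_cong[OF a(3), of x] by (simp add: r_def)
          then show ?thesis using a True set_words[of g m M x] set_words[of g' m M x] inj_onD[OF k] by auto
        next
          case False then show ?thesis using a by (simp add: words_def)
        qed
      qed
    qed
    show "r ` {g \<in> words m M. Des m (k \<circ> g) = J} = {w \<in> words m (image_mset k M). Des m w = J}"
    proof
      show "r ` {g \<in> words m M. Des m (k \<circ> g) = J} \<subseteq> {w \<in> words m (image_mset k M). Des m w = J}"
        using rw Des_r by auto
      show "{w \<in> words m (image_mset k M). Des m w = J} \<subseteq> r ` {g \<in> words m M. Des m (k \<circ> g) = J}"
      proof
        fix w assume w: "w \<in> {w \<in> words m (image_mset k M). Des m w = J}"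
        obtain \<sigma> where s: "\<sigma> \<in> Sym m" "r f \<circ> \<sigma> = w"
          using words_transitive[OF rw[OF f], of w] w by blast
        have "w = r (f \<circ> \<sigma>)"
          unfolding s(2)[symmetric] using Sym_in_iff[OF s(1)] by (intro ext) (simp add: r_def)
        moreover have "f \<circ> \<sigma> \<in> words m M" by (rule words_comp[OF f s(1)])
        ultimately show "w \<in> r ` {g \<in> words m M. Des m (k \<circ> g) = J}"
          using w Des_r[of "f \<circ> \<sigma>"] by auto
      qed
    qed
  qed
  then show ?thesis using c by (simp add: bij_betw_same_card)
qed simp

end

section \<open>The Frobenius characteristic\<close>

lemma finite_submultisets: "finite {A. A \<subseteq># (M :: 'a multiset)}"
proof (induction M)
  case (add x M)
  have "{A. A \<subseteq># add_mset x M} \<subseteq> {A. A \<subseteq># M} \<union> add_mset x ` {A. A \<subseteq># M}"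
  proof
    fix A assume A: "A \<in> {A. A \<subseteq># add_mset x M}"
    show "A \<in> {A. A \<subseteq># M} \<union> add_mset x ` {A. A \<subseteq># M}"
    proof (cases "x \<in># A")
      case True
      then obtain B where "A = add_mset x B" by (metis insert_DiffM)
      then show ?thesis using A by auto
    next
      case False
      then have "A \<subseteq># M" using A
        by (metis (mono_tags) diff_single_trivial mem_Collect_eq subset_eq_diff_conv add_mset_add_single)
      then show ?thesis by simp
    qed
  qed
  then show ?case using add by (meson finite_UnI finite_imageI finite_subset)
qed simp

text \<open>The sets will be the cycles of a permutation. A list keeps them aligned with the factors
  of \<open>power_sum_mset\<close>, so that the product expands by recursion.\<close>

definition colorings :: "nat set list \<Rightarrow> nat multiset \<Rightarrow> (nat \<Rightarrow> nat) set" where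
  "colorings Os M = {f. (\<forall>x. x \<notin> \<Union>(set Os) \<longrightarrow> f x = 0) \<and>
     (\<forall>S\<in>set Os. \<forall>x\<in>S. \<forall>y\<in>S. f x = f y) \<and> image_mset f (mset_set (\<Union>(set Os))) = M}"

lemma finite_colorings:
  assumes "finite (\<Union>(set Os))"
  shows "finite (colorings Os M)"
proof -
  have "finite {f. \<forall>x. (x \<in> \<Union>(set Os) \<longrightarrow> f x \<in> set_mset M) \<and> (x \<notin> \<Union>(set Os) \<longrightarrow> f x = (0::nat))}"
    by (rule finite_set_of_finite_funs) (use assms in auto)
  then show ?thesis
  proof (rule finite_subset[rotated])
    have "f x \<in># M" if "f \<in> colorings Os M" "x \<in> \<Union>(set Os)" for f x
    proof -
      have "f x \<in># image_mset f (mset_set (\<Union>(set Os)))" using assms that(2) by simp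
      then show ?thesis using that(1) by (simp only: colorings_def mem_Collect_eq)
    qed
    moreover have "f x = 0" if "f \<in> colorings Os M" "x \<notin> \<Union>(set Os)" for f x
      using that unfolding colorings_def by blast
    ultimately show "colorings Os M \<subseteq> {f. \<forall>x. (x \<in> \<Union>(set Os) \<longrightarrow> f x \<in> set_mset M) \<and> (x \<notin> \<Union>(set Os) \<longrightarrow> f x = 0)}"
      by blast
  qed
qed

lemma colorings_const: "f \<in> colorings Os M \<Longrightarrow> S \<in> set Os \<Longrightarrow> x \<in> S \<Longrightarrow> y \<in> S \<Longrightarrow> f x = f y"
  unfolding colorings_def by blast

lemma image_mset_eq_replicate:
  assumes "image_mset f (mset_set S) = replicate_mset k i" "finite S" "x \<in> S"
  shows "f x = i"
proof -
  have "f x \<in># replicate_mset k i" unfolding assms(1)[symmetric] using assms(2,3) by simp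
  then show ?thesis by (simp split: if_splits)
qed

text \<open>A colouring consists of a constant value on \<open>S\<close> and a colouring of the
  rest. Its content on \<open>S\<close> is the submultiset \<open>A\<close> that
  \<open>ps_mult\<close> gives to the first factor.\<close>

lemma foldr_power_sum:
  assumes "\<forall>S\<in>set Os. finite S \<and> S \<noteq> {}" "pairwise disjnt (set Os)" "distinct Os"
  shows "foldr ps_mult (map power_sum (map card Os)) ps_one M = of_nat (card (colorings Os M))"
  using assms
proof (induction Os arbitrary: M)
  case Nil
  have "colorings [] M = (if M = {#} then {\<lambda>_. 0} else {})" by (auto simp: colorings_def)
  then show ?case by (simp add: ps_one_def)
next
  case (Cons S Os)
  let ?U = "\<Union>(set Os)"
  have S: "finite S" "S \<noteq> {}" using Cons.prems by auto
  have U: "finite ?U" using Cons.prems by auto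
  have SU: "S \<inter> ?U = {}" using Cons.prems by (auto simp: pairwise_insert disjnt_def)
  have mS: "mset_set (S \<union> ?U) = mset_set S + mset_set ?U"
    by (rule mset_set_Union[OF S(1) U SU])
  define part where "part A = {f \<in> colorings (S # Os) M. image_mset f (mset_set S) = A}" for A
  have IH: "foldr ps_mult (map power_sum (map card Os)) ps_one N = of_nat (card (colorings Os N))" for N
    using Cons by (simp add: pairwise_insert)
  have part: "card (part A) = (if \<exists>i. A = replicate_mset (card S) i then card (colorings Os (M - A)) else 0)"
    if A: "A \<subseteq># M" for A
  proof (cases "\<exists>i. A = replicate_mset (card S) i")
    case False
    have "part A = {}"
    proof (rule ccontr)
      assume "part A \<noteq> {}"
      then obtain f where f: "f \<in> part A" by blast
      obtain x where x: "x \<in> S" using S by blast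
      have "f \<in> colorings (S # Os) M" using f by (simp add: part_def)
      then have "f y = f x" if "y \<in> S" for y by (rule colorings_const[of _ _ _ S]) (use x that in auto)
      then have "image_mset f (mset_set S) = image_mset (\<lambda>_. f x) (mset_set S)"
        by (intro image_mset_cong) (use S in auto)
      then have "A = replicate_mset (card S) (f x)" using f by (simp add: part_def image_mset_const_eq)
      then show False using False by blast
    qed
    then show ?thesis using False by simp
  next
    case True
    then obtain i where i: "A = replicate_mset (card S) i" by blast
    \<comment> \<open>Forgetting the value on \<open>S\<close> means writing the default
      \<open>0\<close> there; the letter \<open>i\<close> of \<open>A\<close> restores it.\<close>
    have "bij_betw (\<lambda>f x. if x \<in> S then 0 else f x) (part A) (colorings Os (M - A))"
    proof (rule bij_betw_byWitness[where f' = "\<lambda>g x. if x \<in> S then i else g x"])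
      show "\<forall>f\<in>part A. (\<lambda>x. if x \<in> S then i else (if x \<in> S then 0 else f x)) = f"
      proof (intro ballI ext)
        fix f x assume "f \<in> part A"
        then have "image_mset f (mset_set S) = replicate_mset (card S) i" by (simp add: part_def i)
        then show "(if x \<in> S then i else (if x \<in> S then 0 else f x)) = f x"
          using image_mset_eq_replicate[OF _ S(1), of f "card S" i x] by auto
      qed
      show "\<forall>g\<in>colorings Os (M - A). (\<lambda>x. if x \<in> S then 0 else (if x \<in> S then i else g x)) = g"
      proof (intro ballI ext)
        fix g x assume "g \<in> colorings Os (M - A)"
        then have "g x = 0" if "x \<in> S" using SU that unfolding colorings_def by blast
        then show "(if x \<in> S then 0 else (if x \<in> S then i else g x)) = g x" by simp
      qed
      show "(\<lambda>f x. if x \<in> S then 0 else f x) ` part A \<subseteq> colorings Os (M - A)"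
      proof
        fix g assume "g \<in> (\<lambda>f x. if x \<in> S then 0 else f x) ` part A"
        then obtain f where f: "f \<in> part A" and g: "g = (\<lambda>x. if x \<in> S then 0 else f x)" by blast
        have gf: "g x = f x" if "x \<in> ?U" for x using SU that by (auto simp: g)
        have "image_mset g (mset_set ?U) = image_mset f (mset_set ?U)"
          by (intro image_mset_cong) (use U gf in auto)
        moreover have "image_mset f (mset_set S) + image_mset f (mset_set ?U) = M" "image_mset f (mset_set S) = A"
          using f by (auto simp: part_def colorings_def mS)
        ultimately have "image_mset g (mset_set ?U) = M - A" by (metis add_diff_cancel_left')
        moreover have "g x = g y" if "R \<in> set Os" "x \<in> R" "y \<in> R" for R x y
        proof -
          have "f \<in> colorings (S # Os) M" using f by (simp add: part_def)
          then have "f x = f y" by (rule colorings_const[of _ _ _ R]) (use that in auto)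
          moreover have "x \<in> ?U" "y \<in> ?U" using that by auto
          ultimately show ?thesis by (simp only: gf)
        qed
        moreover have "g x = 0" if "x \<notin> ?U" for x
          using f that by (auto simp: g part_def colorings_def)
        ultimately show "g \<in> colorings Os (M - A)" unfolding colorings_def by blast
      qed
      show "(\<lambda>g x. if x \<in> S then i else g x) ` colorings Os (M - A) \<subseteq> part A"
      proof
        fix f assume "f \<in> (\<lambda>g x. if x \<in> S then i else g x) ` colorings Os (M - A)"
        then obtain g where g: "g \<in> colorings Os (M - A)" and f: "f = (\<lambda>x. if x \<in> S then i else g x)" by blast
        have fg: "f x = g x" if "x \<in> ?U" for x using SU that by (auto simp: f)
        have "image_mset f (mset_set ?U) = image_mset g (mset_set ?U)"
          by (intro image_mset_cong) (use U fg in auto)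
        moreover have fS: "image_mset f (mset_set S) = A"
        proof -
          have "image_mset f (mset_set S) = image_mset (\<lambda>_. i) (mset_set S)"
            by (intro image_mset_cong) (use S in \<open>auto simp: f\<close>)
          then show ?thesis by (simp add: i image_mset_const_eq)
        qed
        ultimately have "image_mset f (mset_set (S \<union> ?U)) = M"
          using g A by (simp add: mS colorings_def)
        moreover have "f x = f y" if "x \<in> S" "y \<in> S" for x y using that by (simp add: f)
        moreover have "f x = f y" if "R \<in> set Os" "x \<in> R" "y \<in> R" for R x y
        proof -
          have "g x = g y" using colorings_const[OF g that] .
          moreover have "x \<in> ?U" "y \<in> ?U" using that by auto
          ultimately show ?thesis by (simp only: fg)
        qed
        moreover have "f x = 0" if "x \<notin> S \<union> ?U" for x
          using g that by (auto simp: f colorings_def)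
        moreover have "\<Union>(set (S # Os)) = S \<union> ?U" "set (S # Os) = insert S (set Os)" by simp_all
        ultimately show "f \<in> part A" using fS unfolding part_def colorings_def by (simp only: mem_Collect_eq) blast
      qed
    qed
    then have "card (part A) = card (colorings Os (M - A))" by (rule bij_betw_same_card)
    then show ?thesis using True by simp
  qed
  have fin: "finite (colorings (S # Os) M)" by (rule finite_colorings) (use S U in auto)
  have "card (\<Union>A\<in>{A. A \<subseteq># M}. part A) = (\<Sum>A | A \<subseteq># M. card (part A))"
    by (rule card_UN_disjoint) (use fin finite_submultisets in \<open>auto simp: part_def\<close>)
  moreover have "(\<Union>A\<in>{A. A \<subseteq># M}. part A) = colorings (S # Os) M"
  proof -
    have "image_mset f (mset_set S) \<subseteq># M" if "f \<in> colorings (S # Os) M" for f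
    proof -
      have "image_mset f (mset_set S) + image_mset f (mset_set ?U) = M"
        using that by (simp add: colorings_def mS)
      then show ?thesis by (metis mset_subset_eq_add_left)
    qed
    then show ?thesis unfolding part_def by blast
  qed
  ultimately have "of_nat (card (colorings (S # Os) M)) = (\<Sum>A | A \<subseteq># M. of_nat (card (part A)) :: complex)"
    by simp
  also have "\<dots> = (\<Sum>A | A \<subseteq># M. power_sum (card S) A * of_nat (card (colorings Os (M - A))))"
    by (intro sum.cong refl) (simp add: part power_sum_def)
  finally show ?case by (simp add: ps_mult_def[of "power_sum (card S)"] IH[symmetric])
qed

text \<open>Serves to list the orbits in the order of the sorted cycle type, which records only
  their sizes.\<close>

lemma mset_eq_image_mset_obtain:
  assumes "mset ys = image_mset f N"
  obtains xs where "mset xs = N" "map f xs = ys"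
proof -
  have "\<exists>xs. mset xs = N \<and> map f xs = ys"
    using assms
  proof (induction ys arbitrary: N)
    case (Cons y ys)
    then have "y \<in># image_mset f N" by (metis list.set_intros(1) set_mset_mset)
    then obtain x where x: "x \<in># N" "y = f x" by auto
    then obtain N' where N: "N = add_mset x N'" by (metis insert_DiffM)
    then have "mset ys = image_mset f N'" using Cons.prems x by simp
    from Cons.IH[OF this] obtain xs where "mset xs = N'" "map f xs = ys" by blast
    then show ?case using N x by (intro exI[of _ "x # xs"]) simp
  qed simp
  then show ?thesis using that by blast
qed

text \<open>A word is fixed by \<open>p\<close> exactly when it is constant on the cycles of
  \<open>p\<close>, and each power sum chooses the letter of one cycle.\<close>

lemma power_sum_mset_cycle_type:
  assumes p: "p \<in> Sym n"
  shows "power_sum_mset (cycle_type n p) M = of_nat (card {f \<in> words n M. f \<circ> p = f})"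
proof -
  have pp: "p permutes {1..n}" using p by (simp add: Sym_def)
  let ?N = "mset_set (orbit p ` {1..n})"
  have "mset (sorted_list_of_multiset (cycle_type n p)) = image_mset card ?N"
    by (simp add: cycle_type_def)
  then obtain Os where Os: "mset Os = ?N" "map card Os = sorted_list_of_multiset (cycle_type n p)"
    by (rule mset_eq_image_mset_obtain)
  have "set Os = set_mset (mset Os)" by simp
  also have "\<dots> = set_mset ?N" by (rule arg_cong[OF Os(1)])
  also have "\<dots> = orbit p ` {1..n}" by (rule finite_set_mset_mset_set) simp
  finally have setOs: "set Os = orbit p ` {1..n}" .
  have "distinct Os" unfolding distinct_count_atmost_1 setOs Os(1) by (auto simp: count_mset_set')
  have self: "x \<in> orbit p x" for x by (rule permutation_self_in_orbit[OF Sym_permutation[OF p]])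
  have sub: "orbit p x \<subseteq> {1..n}" if "x \<in> {1..n}" for x by (rule permutes_orbit_subset[OF pp that])
  have eq: "orbit p y = orbit p x" if "y \<in> orbit p x" for x y
    by (rule orbit_cyclic_eq3[OF cyclic_on_orbit[OF pp] that]) simp
  have U: "\<Union>(set Os) = {1..n}" unfolding setOs using self sub by blast
  have 1: "\<forall>S\<in>set Os. finite S \<and> S \<noteq> {}"
    unfolding setOs using self finite_subset[OF sub] by fastforce
  have 2: "pairwise disjnt (set Os)"
  proof (rule pairwiseI)
    fix A B assume "A \<in> set Os" "B \<in> set Os" and ne: "A \<noteq> B"
    then obtain x y where A: "A = orbit p x" and B: "B = orbit p y" unfolding setOs by blast
    have False if "z \<in> A" "z \<in> B" for z
      using eq[of z x] eq[of z y] that ne unfolding A B by simp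
    then show "disjnt A B" by (auto simp: disjnt_def)
  qed
  have const: "(\<forall>S\<in>set Os. \<forall>x\<in>S. \<forall>y\<in>S. f x = f y) \<longleftrightarrow> f \<circ> p = f" if f: "f \<in> words n M" for f
  proof
    assume a: "\<forall>S\<in>set Os. \<forall>x\<in>S. \<forall>y\<in>S. f x = f y"
    show "f \<circ> p = f"
    proof
      fix x show "(f \<circ> p) x = f x"
      proof (cases "x \<in> {1..n}")
        case True
        then have "orbit p x \<in> set Os" unfolding setOs by blast
        then show ?thesis using a self[of x] orbit.base[of p x] by (metis comp_apply)
      next
        case False then show ?thesis using Sym_outside[OF p] by simp
      qed
    qed
  next
    assume a: "f \<circ> p = f"
    have "f y = f x" if "y \<in> orbit p x" for x y
      using that by induction (use fun_cong[OF a] in auto)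
    then show "\<forall>S\<in>set Os. \<forall>x\<in>S. \<forall>y\<in>S. f x = f y" unfolding setOs by auto
  qed
  have "f \<in> colorings Os M \<longleftrightarrow> f \<in> words n M \<and> (\<forall>S\<in>set Os. \<forall>x\<in>S. \<forall>y\<in>S. f x = f y)" for f
    unfolding colorings_def U words_def by (simp only: mem_Collect_eq conj_ac)
  then have "colorings Os M = {f \<in> words n M. f \<circ> p = f}"
    by (simp add: set_eq_iff const cong: conj_cong)
  moreover have "power_sum_mset (cycle_type n p) M = foldr ps_mult (map power_sum (map card Os)) ps_one M"
    by (simp add: power_sum_mset_def Os(2))
  ultimately show ?thesis using foldr_power_sum[OF 1 2 \<open>distinct Os\<close>] by simp
qed

section \<open>Coefficients of a Frobenius characteristic under induction\<close>

lemma frobenius_ch_eq: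
  "frobenius_ch n \<chi> M = (1 / fact n) * (\<Sum>p\<in>Sym n. \<chi> p * of_nat (card {f \<in> words n M. f \<circ> p = f}))"
  by (simp add: frobenius_ch_def power_sum_mset_cycle_type)

text \<open>Words are split by their last letter. \<open>Q\<close> is arbitrary because both sides
  of the theorem use this recursion: for fixed words and for the cyclic descent condition.\<close>

lemma card_words_split:
  assumes n: "n \<ge> 1"
  shows "card {f \<in> words n M. Q (f(n := 0)) (f n)} =
    (\<Sum>t\<in>set_mset M. card {g \<in> words (n - 1) (M - {#t#}). Q g t})"
proof -
  have ins: "{1..n} = insert n {1..n - 1}" and nn: "n \<notin> {1..n - 1}" using n by auto
  define part where "part t = {f \<in> words n M. Q (f(n := 0)) (f n) \<and> f n = t}" for t
  have "card (part t) = card {g \<in> words (n - 1) (M - {#t#}). Q g t}" if t: "t \<in># M" for t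
  proof (rule bij_betw_same_card[OF bij_betw_byWitness[where f = "\<lambda>f. f(n := 0)" and f' = "\<lambda>g. g(n := t)"]])
    show "\<forall>f\<in>part t. (f(n := 0))(n := t) = f" by (auto simp: part_def)
    show "\<forall>g\<in>{g \<in> words (n - 1) (M - {#t#}). Q g t}. (g(n := t))(n := 0) = g"
      using nn by (auto simp: words_def fun_upd_idem)
    have same: "image_mset (f(n := a)) (mset_set {1..n - 1}) = image_mset f (mset_set {1..n - 1})" for f :: "nat \<Rightarrow> nat" and a
      by (intro image_mset_cong) (use nn in auto)
    have split: "image_mset f (mset_set {1..n}) = add_mset (f n) (image_mset f (mset_set {1..n - 1}))" for f :: "nat \<Rightarrow> nat"
      unfolding ins using nn by simp
    show "(\<lambda>f. f(n := 0)) ` part t \<subseteq> {g \<in> words (n - 1) (M - {#t#}). Q g t}"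
    proof
      fix g assume "g \<in> (\<lambda>f. f(n := 0)) ` part t"
      then obtain f where f: "f \<in> part t" "g = f(n := 0)" by blast
      have "add_mset t (image_mset f (mset_set {1..n - 1})) = M"
        using f(1) split[of f] by (simp add: part_def words_def)
      then have "image_mset g (mset_set {1..n - 1}) = M - {#t#}"
        unfolding f(2) same by auto
      moreover have "g x = 0" if "x \<notin> {1..n - 1}" for x
        using f that n by (cases "x = n") (auto simp: part_def words_def)
      ultimately show "g \<in> {g \<in> words (n - 1) (M - {#t#}). Q g t}"
        using f by (auto simp: part_def words_def)
    qed
    show "(\<lambda>g. g(n := t)) ` {g \<in> words (n - 1) (M - {#t#}). Q g t} \<subseteq> part t"
    proof
      fix f assume "f \<in> (\<lambda>g. g(n := t)) ` {g \<in> words (n - 1) (M - {#t#}). Q g t}"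
      then obtain g where g: "g \<in> words (n - 1) (M - {#t#})" "Q g t" "f = g(n := t)" by blast
      have "image_mset f (mset_set {1..n}) = M"
        using g t unfolding split g(3) same by (simp add: words_def)
      moreover have "f x = 0" if "x \<notin> {1..n}" for x using g that n by (auto simp: words_def)
      moreover have "f(n := 0) = g" using g nn by (auto simp: words_def fun_upd_idem)
      ultimately show "f \<in> part t" using g by (simp add: part_def words_def)
    qed
  qed
  then have "(\<Sum>t\<in>set_mset M. card {g \<in> words (n - 1) (M - {#t#}). Q g t}) = (\<Sum>t\<in>set_mset M. card (part t))"
    by simp
  also have "\<dots> = card (\<Union>t\<in>set_mset M. part t)"
  proof (rule card_UN_disjoint[symmetric])
    have "finite (part t)" for t by (rule finite_subset[of _ "words n M"]) (auto simp: part_def)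
    then show "\<forall>t\<in>set_mset M. finite (part t)" by blast
  qed (auto simp: part_def)
  also have "(\<Union>t\<in>set_mset M. part t) = {f \<in> words n M. Q (f(n := 0)) (f n)}"
    using set_words[of _ n M n] n by (auto simp: part_def)
  finally show ?thesis by simp
qed

text \<open>Conjugation by \<open>transpose j n\<close> makes the \<open>n\<close> cosets contribute
  equally, and the factor \<open>n\<close> turns \<open>1 / fact n\<close> into
  \<open>1 / fact (n - 1)\<close>. A permutation fixing \<open>n\<close> leaves the last letter of a
  fixed word free, whence the sum over \<open>t\<close>.\<close>

lemma frobenius_ch_induced:
  assumes V: "is_representation (Sym (n - 1)) V" and n: "n \<ge> 1"
  shows "frobenius_ch n (character (induced (Sym (n - 1)) (Sym n) V)) M =
    (\<Sum>t\<in>set_mset M. frobenius_ch (n - 1) (character V) (M - {#t#}))"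
proof -
  let ?G = "Sym n" and ?H = "Sym (n - 1)" and ?\<chi> = "character V"
  let ?F = "\<lambda>x. of_nat (card {f \<in> words n M. f \<circ> x = f}) :: complex"
  let ?t = "\<lambda>j. transpose j n"
  have HG: "y \<in> ?G" "y n = n" if "y \<in> ?H" for y using that unfolding Sym_pred_iff[OF n] by simp_all
  have conj: "(\<Sum>x | x \<in> ?G \<and> x j = j. ?\<chi> (?t j \<circ> x \<circ> ?t j) * ?F x) = (\<Sum>y\<in>?H. ?\<chi> y * ?F y)"
    if j: "j \<in> {1..n}" for j
  proof (rule sum.reindex_bij_witness[of _ "\<lambda>y. ?t j \<circ> y \<circ> ?t j" "\<lambda>x. ?t j \<circ> x \<circ> ?t j"])
    have t: "?t j \<in> ?G" using j n by (intro Sym_transpose) auto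
    have tt: "?t j \<circ> ?t j = id" "?t j \<circ> (?t j \<circ> g) = g" for g :: "nat \<Rightarrow> nat"
      by (simp_all add: o_assoc)
    fix x assume x: "x \<in> {x \<in> ?G. x j = j}"
    show "?t j \<circ> (?t j \<circ> x \<circ> ?t j) \<circ> ?t j = x" by (simp only: comp_assoc tt comp_id)
    show "?t j \<circ> x \<circ> ?t j \<in> ?H"
      unfolding Sym_pred_iff[OF n] using x t by (simp add: Sym_comp)
    have "card {f \<in> words n M. f \<circ> (?t j \<circ> x \<circ> ?t j) = f} = card {f \<in> words n M. f \<circ> x = f}"
    proof (rule bij_betw_same_card[OF bij_betw_byWitness[where f = "\<lambda>f. f \<circ> ?t j" and f' = "\<lambda>f. f \<circ> ?t j"]])
      have e: "f \<circ> ?t j \<circ> x = f \<circ> ?t j \<longleftrightarrow> f \<circ> (?t j \<circ> x \<circ> ?t j) = f" for f :: "nat \<Rightarrow> nat"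
      proof
        assume "f \<circ> ?t j \<circ> x = f \<circ> ?t j"
        then have "f \<circ> ?t j \<circ> x \<circ> ?t j = f \<circ> ?t j \<circ> ?t j" by simp
        then show "f \<circ> (?t j \<circ> x \<circ> ?t j) = f" by (simp only: comp_assoc tt comp_id)
      next
        assume "f \<circ> (?t j \<circ> x \<circ> ?t j) = f"
        then have "f \<circ> (?t j \<circ> x \<circ> ?t j) \<circ> ?t j = f \<circ> ?t j" by simp
        then show "f \<circ> ?t j \<circ> x = f \<circ> ?t j" by (simp only: comp_assoc tt comp_id)
      qed
      then show "(\<lambda>f. f \<circ> ?t j) ` {f \<in> words n M. f \<circ> (?t j \<circ> x \<circ> ?t j) = f} \<subseteq> {f \<in> words n M. f \<circ> x = f}"
        using words_comp[OF _ t] by blast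
      have "f \<circ> ?t j \<circ> (?t j \<circ> x \<circ> ?t j) = f \<circ> x \<circ> ?t j" for f :: "nat \<Rightarrow> nat"
        by (simp only: comp_assoc tt)
      then show "(\<lambda>f. f \<circ> ?t j) ` {f \<in> words n M. f \<circ> x = f} \<subseteq> {f \<in> words n M. f \<circ> (?t j \<circ> x \<circ> ?t j) = f}"
        using words_comp[OF _ t] by auto
    qed (simp_all add: comp_assoc)
    then show "?\<chi> (?t j \<circ> x \<circ> ?t j) * ?F (?t j \<circ> x \<circ> ?t j) = ?\<chi> (?t j \<circ> x \<circ> ?t j) * ?F x" by simp
  next
    have t: "?t j \<in> ?G" using j n by (intro Sym_transpose) auto
    fix y assume y: "y \<in> ?H"
    show "?t j \<circ> (?t j \<circ> y \<circ> ?t j) \<circ> ?t j = y" by (simp add: fun_eq_iff)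
    show "?t j \<circ> y \<circ> ?t j \<in> {x \<in> ?G. x j = j}" using HG[OF y] t by (simp add: Sym_comp)
  qed
  have fixed: "card {f \<in> words n M. f \<circ> y = f} =
      (\<Sum>t\<in>set_mset M. card {g \<in> words (n - 1) (M - {#t#}). g \<circ> y = g})" if y: "y \<in> ?H" for y
  proof -
    have "f \<circ> y = f \<longleftrightarrow> f(n := 0) \<circ> y = f(n := 0)" for f :: "nat \<Rightarrow> nat"
    proof -
      have "y x = n \<longleftrightarrow> x = n" for x using HG[OF y] Sym_eq_iff[of y n x n] by simp
      then show ?thesis using HG(2)[OF y] by (auto simp: fun_eq_iff) metis
    qed
    then have "{f \<in> words n M. f \<circ> y = f} = {f \<in> words n M. f(n := 0) \<circ> y = f(n := 0)}" by blast
    then show ?thesis using card_words_split[OF n, of M "\<lambda>g t. g \<circ> y = g"] by simp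
  qed
  have "(\<Sum>x\<in>?G. character (induced ?H ?G V) x * ?F x) =
      (\<Sum>x\<in>?G. \<Sum>j\<in>{1..n}. if x j = j then ?\<chi> (?t j \<circ> x \<circ> ?t j) * ?F x else 0)"
  proof (rule sum.cong[OF refl])
    fix x assume x: "x \<in> ?G"
    show "character (induced ?H ?G V) x * ?F x = (\<Sum>j\<in>{1..n}. if x j = j then ?\<chi> (?t j \<circ> x \<circ> ?t j) * ?F x else 0)"
      unfolding character_induced[OF V n x] sum_distrib_right by (rule sum.inter_filter) simp
  qed
  also have "\<dots> = (\<Sum>j\<in>{1..n}. \<Sum>x\<in>?G. if x j = j then ?\<chi> (?t j \<circ> x \<circ> ?t j) * ?F x else 0)"
    by (rule sum.swap)
  also have "\<dots> = (\<Sum>j\<in>{1..n}. \<Sum>x | x \<in> ?G \<and> x j = j. ?\<chi> (?t j \<circ> x \<circ> ?t j) * ?F x)"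
    by (intro sum.cong[OF refl] sum.inter_filter[symmetric]) simp
  also have "\<dots> = (\<Sum>j\<in>{1..n}. \<Sum>y\<in>?H. ?\<chi> y * ?F y)" using conj by (rule sum.cong[OF refl])
  also have "\<dots> = of_nat n * (\<Sum>y\<in>?H. ?\<chi> y * ?F y)" by simp
  also have "(\<Sum>y\<in>?H. ?\<chi> y * ?F y) =
      (\<Sum>t\<in>set_mset M. \<Sum>y\<in>?H. ?\<chi> y * of_nat (card {g \<in> words (n - 1) (M - {#t#}). g \<circ> y = g}))"
    by (subst sum.swap) (simp add: fixed sum_distrib_left)
  finally have main: "(\<Sum>x\<in>?G. character (induced ?H ?G V) x * ?F x) = of_nat n *
      (\<Sum>t\<in>set_mset M. \<Sum>y\<in>?H. ?\<chi> y * of_nat (card {g \<in> words (n - 1) (M - {#t#}). g \<circ> y = g}))" .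
  have "fact n = of_nat n * (fact (n - 1) :: complex)" using n by (simp add: fact_reduce)
  then have "1 / fact n * (of_nat n * a) = 1 / fact (n - 1) * a" for a :: complex
    using n by simp
  then show ?thesis unfolding frobenius_ch_eq main by (simp add: sum_distrib_left)
qed

section \<open>Fundamental quasisymmetric functions and rotations\<close>

definition lex_le :: "(nat \<Rightarrow> nat) \<Rightarrow> nat \<Rightarrow> nat \<Rightarrow> bool" where
  "lex_le f a b \<longleftrightarrow> f a < f b \<or> f a = f b \<and> a \<le> b"

text \<open>The standardization of a word, with ties broken from left to right. Outside
  \<open>{1..n}\<close> it is the identity, so that it belongs to \<open>Sym n\<close>.\<close>

definition lex_rank :: "nat \<Rightarrow> (nat \<Rightarrow> nat) \<Rightarrow> nat \<Rightarrow> nat" where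
  "lex_rank n f a = (if a \<in> {1..n} then card {a' \<in> {1..n}. lex_le f a' a} else a)"

lemma lex_rank_mono:
  assumes "a \<in> {1..n}" "b \<in> {1..n}" "lex_le f a b" "a \<noteq> b"
  shows "lex_rank n f a < lex_rank n f b"
proof -
  have "{a' \<in> {1..n}. lex_le f a' a} \<subseteq> {a' \<in> {1..n}. lex_le f a' b}"
    using assms(3) by (auto simp: lex_le_def)
  moreover have "b \<in> {a' \<in> {1..n}. lex_le f a' b}" "b \<notin> {a' \<in> {1..n}. lex_le f a' a}"
    using assms by (auto simp: lex_le_def)
  ultimately have "{a' \<in> {1..n}. lex_le f a' a} \<subset> {a' \<in> {1..n}. lex_le f a' b}" by blast
  then have "card {a' \<in> {1..n}. lex_le f a' a} < card {a' \<in> {1..n}. lex_le f a' b}"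
    by (intro psubset_card_mono) auto
  then show ?thesis using assms by (simp add: lex_rank_def)
qed

lemma lex_rank_less_iff:
  assumes "a \<in> {1..n}" "b \<in> {1..n}"
  shows "lex_rank n f a < lex_rank n f b \<longleftrightarrow> f a < f b \<or> f a = f b \<and> a < b"
proof -
  have less: "lex_rank n f x < lex_rank n f y"
    if "f x < f y \<or> f x = f y \<and> x < y" "x \<in> {1..n}" "y \<in> {1..n}" for x y
    by (rule lex_rank_mono) (use that in \<open>auto simp: lex_le_def\<close>)
  consider "f a < f b \<or> f a = f b \<and> a < b" | "a = b" | "f b < f a \<or> f b = f a \<and> b < a"
    by linarith
  then show ?thesis
  proof cases
    case 1 then show ?thesis using less assms by blast
  next
    case 2 then show ?thesis by simp
  next
    case 3
    then have "lex_rank n f b < lex_rank n f a" using less assms by blast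
    then show ?thesis using 3 by auto
  qed
qed

lemma lex_rank_Sym: "lex_rank n f \<in> Sym n"
proof -
  have inj: "inj_on (lex_rank n f) {1..n}"
  proof (rule inj_onI)
    fix a b assume ab: "a \<in> {1..n}" "b \<in> {1..n}" and eq: "lex_rank n f a = lex_rank n f b"
    have "\<not> (f a < f b \<or> f a = f b \<and> a < b)" "\<not> (f b < f a \<or> f b = f a \<and> b < a)"
      using lex_rank_less_iff[OF ab, of f] lex_rank_less_iff[OF ab(2,1), of f] eq by simp_all
    then show "a = b" by linarith
  qed
  have "lex_rank n f a \<in> {1..n}" if a: "a \<in> {1..n}" for a
  proof -
    let ?S = "{a' \<in> {1..n}. lex_le f a' a}"
    have "card ?S \<le> card {1..n}" by (rule card_mono) auto
    moreover have "a \<in> ?S" using a by (simp add: lex_le_def)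
    then have "0 < card ?S" by (intro card_gt_0_iff[THEN iffD2] conjI) auto
    ultimately show ?thesis using a by (simp add: lex_rank_def)
  qed
  then have "lex_rank n f ` {1..n} = {1..n}" by (intro endo_inj_surj inj) auto
  then have "bij_betw (lex_rank n f) {1..n} {1..n}" using inj by (simp add: bij_betw_def)
  then show ?thesis unfolding Sym_def
    by (auto intro!: bij_imp_permutes simp: lex_rank_def)
qed

text \<open>\<open>b\<close> lists the positions in the order of \<open>lex_le\<close> exactly when
  \<open>f\<close> weakly increases along \<open>b\<close> and equal letters are listed from left to
  right. At a descent of \<open>b\<close> the increase must then be strict, as in
  \<open>fundamental_qsym\<close>.\<close>

lemma inv_lex_rank_iff:
  assumes b: "b \<in> Sym n"
  shows "inv (lex_rank n f) = b \<longleftrightarrow>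
    (\<forall>j. 1 \<le> j \<and> j < n \<longrightarrow> f (b j) \<le> f (b (Suc j)) \<and> (b (Suc j) < b j \<longrightarrow> f (b j) < f (b (Suc j))))"
    (is "_ \<longleftrightarrow> ?R")
proof
  assume e: "inv (lex_rank n f) = b"
  have rb: "lex_rank n f (b j) = j" for j
    using Sym_inv_apply(2)[OF lex_rank_Sym, of n f j] e by simp
  show ?R
  proof (intro allI impI)
    fix j assume j: "1 \<le> j \<and> j < n"
    then have bj: "b j \<in> {1..n}" "b (Suc j) \<in> {1..n}" using Sym_in_iff[OF b] by auto
    show "f (b j) \<le> f (b (Suc j)) \<and> (b (Suc j) < b j \<longrightarrow> f (b j) < f (b (Suc j)))"
      using lex_rank_less_iff[OF bj, of f] by (auto simp: rb)
  qed
next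
  assume R: ?R
  have step: "lex_le f (b j) (b (Suc j))" if "1 \<le> j" "j < n" for j
    using R that unfolding lex_le_def by (metis le_neq_implies_less linorder_not_less)
  have chain: "lex_le f (b i) (b j)" if "1 \<le> i" "i \<le> j" "j \<le> n" for i j
    using that(2,1,3)
  proof (induction j rule: dec_induct)
    case base show ?case by (simp add: lex_le_def)
  next
    case (step j)
    have "lex_le f (b i) (b j)" using step by simp
    moreover have "lex_le f (b j) (b (Suc j))" using step by (intro \<open>\<And>j. 1 \<le> j \<Longrightarrow> j < n \<Longrightarrow> lex_le f (b j) (b (Suc j))\<close>) auto
    ultimately show ?case unfolding lex_le_def by linarith
  qed
  have antisym: "x = y" if "lex_le f x y" "lex_le f y x" for x y
    using that by (auto simp: lex_le_def)
  have "lex_rank n f (b j) = j" for j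
  proof (cases "j \<in> {1..n}")
    case True
    \<comment> \<open>Along \<open>b\<close> the positions ascend in \<open>lex_le\<close>, so those
      up to \<open>b j\<close> are the first \<open>j\<close> listed.\<close>
    have "{a' \<in> {1..n}. lex_le f a' (b j)} = b ` {1..j}"
    proof (intro set_eqI iffI)
      fix a assume a: "a \<in> {a' \<in> {1..n}. lex_le f a' (b j)}"
      define i where "i = inv b a"
      have i: "b i = a" "i \<in> {1..n}"
        using Sym_inv_apply(2)[OF b, of a] Sym_in_iff[OF Sym_inv[OF b], of a] a by (auto simp: i_def)
      have "i \<le> j"
      proof (rule ccontr)
        assume "\<not> i \<le> j"
        then have "lex_le f (b j) (b i)" using chain[of j i] True i by auto
        then have "b i = b j" using antisym a i by auto
        then show False using Sym_eq_iff[OF b] \<open>\<not> i \<le> j\<close> by simp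
      qed
      then show "a \<in> b ` {1..j}" using i by auto
    next
      fix a assume "a \<in> b ` {1..j}"
      then obtain i where i: "i \<in> {1..j}" "a = b i" by blast
      then show "a \<in> {a' \<in> {1..n}. lex_le f a' (b j)}"
        using chain[of i j] True Sym_in_iff[OF b, of i] by auto
    qed
    moreover have "card (b ` {1..j}) = j"
      using Sym_eq_iff[OF b] by (subst card_image) (auto simp: inj_on_def)
    ultimately show ?thesis using True Sym_in_iff[OF b, of j] by (simp add: lex_rank_def)
  next
    case False
    then show ?thesis using Sym_outside[OF b False] by (auto simp: lex_rank_def)
  qed
  then have "lex_rank n f \<circ> b = id" by auto
  then show "inv (lex_rank n f) = b"
    using Sym_inv_cancel(1)[OF lex_rank_Sym, of n f b] by simp
qed

text \<open>
  A monomial of the fundamental quasisymmetric function of \<open>b\<close> is a weakly increasing labelling of the positions of \<open>b\<close>. Transporting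
  the labels to the letters of \<open>b\<close> turns it into a word with standardization \<open>inv b\<close>.
\<close>

lemma fundamental_qsym_eq:
  assumes b: "b \<in> Sym n"
  shows "fundamental_qsym n (Des n b) M = of_nat (card {f \<in> words n M. inv (lex_rank n f) = b})"
proof -
  let ?W = "{w :: nat list. length w = n \<and> sorted w \<and> (\<forall>j\<in>Des n b. w ! (j - 1) < w ! j) \<and> mset w = M}"
  have up: "{1..n} = set [1..<Suc n]" by auto
  have ms: "image_mset g (mset_set {1..n}) = mset (map g [1..<Suc n])" for g :: "nat \<Rightarrow> nat"
    by (simp add: atLeastLessThanSuc_atLeastAtMost[symmetric] mset_upt[symmetric] del: mset_upt upt_Suc)
  have nth: "map g [1..<Suc n] ! i = g (Suc i)" if "i < n" for g :: "nat \<Rightarrow> nat" and i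
    using that by (simp del: upt_Suc)
  have bij: "bij_betw (\<lambda>f. map (f \<circ> b) [1..<Suc n]) {f \<in> words n M. inv (lex_rank n f) = b} ?W"
  proof (rule bij_betw_byWitness[where f' = "\<lambda>w a. if a \<in> {1..n} then w ! (inv b a - 1) else 0"])
    show "\<forall>f\<in>{f \<in> words n M. inv (lex_rank n f) = b}.
        (\<lambda>a. if a \<in> {1..n} then map (f \<circ> b) [1..<Suc n] ! (inv b a - 1) else 0) = f"
    proof (intro ballI ext)
      fix f a assume f: "f \<in> {f \<in> words n M. inv (lex_rank n f) = b}"
      show "(if a \<in> {1..n} then map (f \<circ> b) [1..<Suc n] ! (inv b a - 1) else 0) = f a"
      proof (cases "a \<in> {1..n}")
        case True
        then have "inv b a \<in> {1..n}" using Sym_in_iff[OF Sym_inv[OF b]] by blast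
        then have "map (f \<circ> b) [1..<Suc n] ! (inv b a - 1) = (f \<circ> b) (inv b a)"
          by (subst nth) auto
        then show ?thesis using True Sym_inv_apply(2)[OF b] by simp
      next
        case False then show ?thesis using f by (auto simp: words_def)
      qed
    qed
    have inner: "map ((\<lambda>a. if a \<in> {1..n} then w ! (inv b a - 1) else 0) \<circ> b) [1..<Suc n] = w"
      if w: "length w = n" for w :: "nat list"
    proof (rule nth_equalityI)
      show "length (map ((\<lambda>a. if a \<in> {1..n} then w ! (inv b a - 1) else 0) \<circ> b) [1..<Suc n]) = length w"
        using w by simp
      fix i assume "i < length (map ((\<lambda>a. if a \<in> {1..n} then w ! (inv b a - 1) else 0) \<circ> b) [1..<Suc n])"
      then have i: "i < n" by (simp del: upt_Suc)
      then have "b (Suc i) \<in> {1..n}" using Sym_in_iff[OF b, of "Suc i"] by auto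
      then show "map ((\<lambda>a. if a \<in> {1..n} then w ! (inv b a - 1) else 0) \<circ> b) [1..<Suc n] ! i = w ! i"
        unfolding nth[OF i] using Sym_inv_apply(1)[OF b, of "Suc i"] by simp
    qed
    then show "\<forall>w\<in>?W. map ((\<lambda>a. if a \<in> {1..n} then w ! (inv b a - 1) else 0) \<circ> b) [1..<Suc n] = w"
      by blast
    show "(\<lambda>f. map (f \<circ> b) [1..<Suc n]) ` {f \<in> words n M. inv (lex_rank n f) = b} \<subseteq> ?W"
    proof
      fix w assume "w \<in> (\<lambda>f. map (f \<circ> b) [1..<Suc n]) ` {f \<in> words n M. inv (lex_rank n f) = b}"
      then obtain f where f: "f \<in> words n M" "inv (lex_rank n f) = b" and w: "w = map (f \<circ> b) [1..<Suc n]"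
        by blast
      have len: "length w = n" using w by simp
      have wn: "w ! i = f (b (Suc i))" if "i < n" for i unfolding w nth[OF that] by simp
      note R = iffD1[OF inv_lex_rank_iff[OF b] f(2)]
      have "w ! i \<le> w ! Suc i" if "Suc i < length w" for i
        using R[rule_format, of "Suc i"] that len wn[of i] wn[of "Suc i"] by simp
      then have "sorted w" by (simp add: sorted_iff_nth_Suc)
      moreover have "w ! (j - 1) < w ! j" if "j \<in> Des n b" for j
        using R[rule_format, of j] that wn[of "j - 1"] wn[of j] by (simp add: Des_def less_imp_diff_less)
      moreover have "mset w = M"
        using words_comp[OF f(1) b] unfolding w ms[symmetric] words_def by blast
      ultimately show "w \<in> ?W" using len by blast
    qed
    show "(\<lambda>w a. if a \<in> {1..n} then w ! (inv b a - 1) else 0) ` ?W \<subseteq> {f \<in> words n M. inv (lex_rank n f) = b}"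
    proof
      fix f assume "f \<in> (\<lambda>w a. if a \<in> {1..n} then w ! (inv b a - 1) else 0) ` ?W"
      then obtain w where w: "w \<in> ?W" and f: "f = (\<lambda>a. if a \<in> {1..n} then w ! (inv b a - 1) else 0)"
        by blast
      have len: "length w = n" using w by simp
      have fb: "map (f \<circ> b) [1..<Suc n] = w" unfolding f by (rule inner[OF len])
      have fbn: "f (b (Suc i)) = w ! i" if "i < n" for i
        using nth[OF that, of "f \<circ> b"] fb by simp
      have "image_mset (f \<circ> b) (mset_set {1..n}) = M" unfolding ms fb using w by simp
      then have "f \<in> words n M" unfolding image_mset_Sym[OF b] by (simp add: words_def f)
      moreover have "inv (lex_rank n f) = b"
        unfolding inv_lex_rank_iff[OF b]
      proof (intro allI impI)
        fix j assume j: "1 \<le> j \<and> j < n"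
        have e: "f (b j) = w ! (j - 1)" "f (b (Suc j)) = w ! j"
          using fbn[of "j - 1"] fbn[of j] j by (simp_all add: less_imp_diff_less)
        have "w ! (j - 1) \<le> w ! j" using w j by (intro sorted_nth_mono) auto
        moreover have "w ! (j - 1) < w ! j" if "b (Suc j) < b j"
          using w j that by (auto simp: Des_def)
        ultimately show "f (b j) \<le> f (b (Suc j)) \<and> (b (Suc j) < b j \<longrightarrow> f (b j) < f (b (Suc j)))"
          unfolding e by blast
      qed
      ultimately show "f \<in> {f \<in> words n M. inv (lex_rank n f) = b}" by blast
    qed
  qed
  show ?thesis unfolding fundamental_qsym_def using bij_betw_same_card[OF bij] by simp
qed

lemma qsym_of_eq:
  assumes B: "B \<subseteq> Sym n"
  shows "qsym_of n (mset_set B) M = of_nat (card {f \<in> words n M. inv (lex_rank n f) \<in> B})"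
proof -
  have fin: "finite B" using B by (rule finite_subset) simp
  have "qsym_of n (mset_set B) M = (\<Sum>b\<in>B. fundamental_qsym n (Des n b) M)"
    by (simp add: qsym_of_def sum_unfold_sum_mset)
  also have "\<dots> = of_nat (\<Sum>b\<in>B. card {f \<in> words n M. inv (lex_rank n f) = b})"
    using B by (simp add: fundamental_qsym_eq subset_iff)
  also have "(\<Sum>b\<in>B. card {f \<in> words n M. inv (lex_rank n f) = b}) =
      card (\<Union>b\<in>B. {f \<in> words n M. inv (lex_rank n f) = b})"
    by (rule card_UN_disjoint[symmetric]) (use fin in auto)
  also have "(\<Union>b\<in>B. {f \<in> words n M. inv (lex_rank n f) = b}) = {f \<in> words n M. inv (lex_rank n f) \<in> B}"
    by auto
  finally show ?thesis .
qed

section \<open>Rotations of inverse descent classes\<close>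

lemma long_cycle_power:
  assumes "x \<in> {1..n}"
  shows "(long_cycle n ^^ k) x = Suc ((k + (x - 1)) mod n)"
proof -
  have "map (long_cycle n ^^ k) [1..<Suc n] = rotate k [1..<Suc n]"
    unfolding long_cycle_def by (rule cyclic_rotation) simp
  moreover have "[1..<Suc n] ! (x - 1) = x" using assms by (auto simp del: upt_Suc)
  moreover have "map (long_cycle n ^^ k) [1..<Suc n] ! (x - 1) = (long_cycle n ^^ k) ([1..<Suc n] ! (x - 1))"
    using assms by (intro nth_map) auto
  moreover have "rotate k [1..<Suc n] ! (x - 1) = [1..<Suc n] ! ((k + (x - 1)) mod n)"
    using assms nth_rotate[of "x - 1" "[1..<Suc n]" k] by auto
  moreover have "[1..<Suc n] ! ((k + (x - 1)) mod n) = Suc ((k + (x - 1)) mod n)"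
    using assms by (subst nth_upt) auto
  ultimately show ?thesis by metis
qed

lemma long_cycle_Sym: "long_cycle n ^^ k \<in> Sym n"
proof -
  have "long_cycle n permutes {1..n}"
    using cycle_permutes[of "[1..<Suc n]"] by (simp add: long_cycle_def atLeastLessThanSuc_atLeastAtMost del: upt_Suc)
  then show ?thesis unfolding Sym_def by (simp add: permutes_funpow)
qed

text \<open>
  The letters of a word, ordered cyclically with \<open>t\<close> as the last one; the summand exceeds every letter of \<open>M\<close>.
\<close>

definition cyclic_key :: "nat multiset \<Rightarrow> nat \<Rightarrow> nat \<Rightarrow> nat" where
  "cyclic_key M t x = (if x \<le> t then x + Suc (\<Sum>y\<in>#M. y) else x)"

lemma member_le_sum_mset: "(x :: nat) \<in># M \<Longrightarrow> x \<le> (\<Sum>y\<in>#M. y)"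
  by (auto dest!: multi_member_split)

lemma inj_cyclic_key: "inj_on (cyclic_key M t) (set_mset M)"
proof (rule inj_onI)
  fix x y assume "x \<in># M" "y \<in># M" "cyclic_key M t x = cyclic_key M t y"
  then show "x = y"
    using member_le_sum_mset[of x M] member_le_sum_mset[of y M] by (auto simp: cyclic_key_def split: if_splits)
qed

text \<open>Membership means that some power of the cycle carries the standardization into the
  descent class. To land in \<open>Sym (n - 1)\<close> it must move the rank \<open>R\<close> of the
  last letter to \<open>n\<close>, which determines it; ranks up to \<open>R\<close> thereby move
  above all others, as in the order of \<open>cyclic_key\<close>.\<close>

lemma mem_rotations_iff:
  assumes n: "n \<ge> 1" and f: "f \<in> words n M"
  shows "inv (lex_rank n f) \<in> set_product (inverse_descent_class (n - 1) J) (cyclic_subgroup n)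
    \<longleftrightarrow> Des (n - 1) (cyclic_key M (f n) \<circ> f) = J"
proof -
  let ?r = "lex_rank n f" and ?c = "\<lambda>k. long_cycle n ^^ k"
  note r = lex_rank_Sym[of n f]
  note c = long_cycle_Sym[where n = n]
  define R where "R = ?r n"
  have R: "R \<in> {1..n}" unfolding R_def using Sym_in_iff[OF r, of n] n by auto
  define p where "p = ?c (n - R) \<circ> ?r"
  have pS: "p \<in> Sym n" unfolding p_def by (rule Sym_comp[OF c r])
  have p_eq: "p i = (if ?r i \<le> R then ?r i + (n - R) else ?r i - R)" if "i \<in> {1..n}" for i
  proof -
    have ri: "?r i \<in> {1..n}" using Sym_in_iff[OF r] that by blast
    have "p i = Suc ((n - R + (?r i - 1)) mod n)"
      unfolding p_def comp_apply by (rule long_cycle_power[OF ri])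
    also have "\<dots> = (if ?r i \<le> R then ?r i + (n - R) else ?r i - R)"
    proof (cases "?r i \<le> R")
      case True
      then show ?thesis using ri R by (auto simp: mod_less)
    next
      case False
      then have "n - R + (?r i - 1) = n + (?r i - R - 1)" using ri R by auto
      moreover have "?r i - R - 1 < n" using ri R by auto
      ultimately have "(n - R + (?r i - 1)) mod n = ?r i - R - 1" by (simp only: mod_add_self1 mod_less)
      then show ?thesis using False by simp
    qed
    finally show ?thesis .
  qed
  have "p n = n" using p_eq[of n] n R by (auto simp: R_def)
  then have pH: "p \<in> Sym (n - 1)" unfolding Sym_pred_iff[OF n] using pS by simp
  have k_unique: "k = n - R \<or> R = n \<and> k = 0" if "k < n" "?c k \<circ> ?r \<in> Sym (n - 1)" for k
  proof -
    have "?c k R = n" using that(2) unfolding Sym_pred_iff[OF n] R_def by simp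
    then have m: "Suc ((k + (R - 1)) mod n) = n" using long_cycle_power[OF R, of k] by simp
    have "k + (R - 1) = n - 1"
    proof (cases "k + (R - 1) < n")
      case True then show ?thesis using m by simp
    next
      case False
      then have "(k + (R - 1)) mod n = k + (R - 1) - n"
        using that(1) R by (auto simp: mod_if)
      then show ?thesis using m that(1) R by auto
    qed
    then show ?thesis using R by auto
  qed
  have "inv ?r \<in> set_product (inverse_descent_class (n - 1) J) (cyclic_subgroup n) \<longleftrightarrow>
      (\<exists>q k. q \<in> descent_class (n - 1) J \<and> k < n \<and> inv ?r = inv q \<circ> ?c k)"
    unfolding set_product_def inverse_descent_class_def cyclic_subgroup_def by auto
  also have "\<dots> \<longleftrightarrow> (\<exists>q k. q \<in> descent_class (n - 1) J \<and> k < n \<and> ?c k \<circ> ?r = q)"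
  proof -
    have "inv ?r = inv q \<circ> ?c k \<longleftrightarrow> ?c k \<circ> ?r = q" if "q \<in> descent_class (n - 1) J" for q k
    proof -
      have q: "q \<in> Sym n" using that Sym_pred_iff[OF n, of q] by (auto simp: descent_class_def)
      show ?thesis
      proof
        assume "inv ?r = inv q \<circ> ?c k"
        then have "q \<circ> (inv ?r \<circ> ?r) = q \<circ> (inv q \<circ> (?c k \<circ> ?r))" by (simp add: comp_assoc)
        then show "?c k \<circ> ?r = q" by (simp only: Sym_inv_o[OF r] Sym_inv_cancel[OF q] comp_id)
      next
        assume "?c k \<circ> ?r = q"
        then have "inv q \<circ> (?c k \<circ> ?r) \<circ> inv ?r = inv q \<circ> q \<circ> inv ?r" by simp
        then have "inv q \<circ> (?c k \<circ> (?r \<circ> inv ?r)) = inv q \<circ> (q \<circ> inv ?r)" by (simp only: comp_assoc)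
        then show "inv ?r = inv q \<circ> ?c k" by (simp only: Sym_inv_o[OF r] Sym_inv_cancel[OF q] comp_id)
      qed
    qed
    then show ?thesis by blast
  qed
  also have "\<dots> \<longleftrightarrow> (\<exists>k<n. ?c k \<circ> ?r \<in> descent_class (n - 1) J)" by blast
  also have "\<dots> \<longleftrightarrow> p \<in> descent_class (n - 1) J"
  proof
    assume "\<exists>k<n. ?c k \<circ> ?r \<in> descent_class (n - 1) J"
    then obtain k where k: "k < n" "?c k \<circ> ?r \<in> descent_class (n - 1) J" by blast
    then have "k = n - R" using k_unique[of k] by (auto simp: descent_class_def)
    then show "p \<in> descent_class (n - 1) J" using k by (simp add: p_def)
  next
    assume "p \<in> descent_class (n - 1) J"
    moreover have "n - R < n" using R by auto
    ultimately show "\<exists>k<n. ?c k \<circ> ?r \<in> descent_class (n - 1) J" unfolding p_def by blast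
  qed
  also have "\<dots> \<longleftrightarrow> Des (n - 1) p = J" using pH by (simp add: descent_class_def)
  also have "Des (n - 1) p = Des (n - 1) (cyclic_key M (f n) \<circ> f)"
  proof -
    have "p (i + 1) < p i \<longleftrightarrow> cyclic_key M (f n) (f (i + 1)) < cyclic_key M (f n) (f i)"
      if i: "1 \<le> i" "i < n - 1" for i
    proof -
      have i1: "i \<in> {1..n}" and i2: "i + 1 \<in> {1..n}" and nn: "n \<in> {1..n}" using i by auto
      \<comment> \<open>Letters equal to \<open>f n\<close> at earlier positions have rank below
        \<open>R\<close>. Therefore \<open>cyclic_key\<close> also lifts the letters equal to
        \<open>t\<close>, not only the smaller ones.\<close>
      have le: "?r a \<le> R \<longleftrightarrow> f a \<le> f n" if "a \<in> {1..n}" "a < n" for a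
        using lex_rank_less_iff[OF nn that(1), of f] that(2) unfolding R_def
        by (auto simp: linorder_not_less[symmetric])
      have les: "?r i \<le> R \<longleftrightarrow> f i \<le> f n" "?r (i + 1) \<le> R \<longleftrightarrow> f (i + 1) \<le> f n"
        using le[OF i1] le[OF i2] i by auto
      have lt: "?r (i + 1) < ?r i \<longleftrightarrow> f (i + 1) < f i"
        using lex_rank_less_iff[OF i2 i1, of f] by auto
      have b: "f i \<le> (\<Sum>y\<in>#M. y)" "f (i + 1) \<le> (\<Sum>y\<in>#M. y)"
        using member_le_sum_mset set_words[OF f] i1 i2 by auto
      have rb: "?r i \<in> {1..n}" "?r (i + 1) \<in> {1..n}" using Sym_in_iff[OF r] i1 i2 by blast+
      show ?thesis
        unfolding p_eq[OF i1] p_eq[OF i2] les cyclic_key_def using lt b rb R les by auto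
    qed
    then show ?thesis by (auto simp: Des_def)
  qed
  finally show ?thesis .
qed

theorem theorem7p1:
  fixes n :: nat and J :: "nat set"
  assumes "n \<ge> 2" and "J \<subseteq> {1..n - 2}"
  shows "fine_for n
           (mset_set (set_product (inverse_descent_class (n - 1) J) (cyclic_subgroup n)))
           (induced (Sym (n - 1)) (Sym n) (skew_specht (n - 1) (ribbon (n - 1) J)))"
  unfolding fine_for_def
proof
  fix M
  let ?B = "set_product (inverse_descent_class (n - 1) J) (cyclic_subgroup n)"
  let ?V = "skew_specht (n - 1) (ribbon (n - 1) J)"
  have n: "n \<ge> 1" using assms by simp
  have "{1..n - 2} = {1..<n - 1}" using assms(1) by auto
  then interpret ribbon_shape "n - 1" J by unfold_locales (use assms(2) in simp)
  have "?B \<subseteq> Sym n"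
  proof
    fix b assume "b \<in> ?B"
    then obtain q k where q: "q \<in> Sym (n - 1)" and b: "b = inv q \<circ> long_cycle n ^^ k"
      by (auto simp: set_product_def inverse_descent_class_def cyclic_subgroup_def descent_class_def)
    have "inv q \<in> Sym n" using Sym_inv[OF q] unfolding Sym_pred_iff[OF n] by blast
    then show "b \<in> Sym n" unfolding b using long_cycle_Sym by (rule Sym_comp)
  qed
  then have "qsym_of n (mset_set ?B) M = of_nat (card {f \<in> words n M. inv (lex_rank n f) \<in> ?B})"
    by (rule qsym_of_eq)
  \<comment> \<open>\<open>card_words_split\<close> wants a condition on \<open>f(n := 0)\<close>
    and \<open>f n\<close>; the descents concern only the first \<open>n - 1\<close>
    positions.\<close>
  also have "{f \<in> words n M. inv (lex_rank n f) \<in> ?B} =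
      {f \<in> words n M. Des (n - 1) (cyclic_key M (f n) \<circ> f(n := 0)) = J}"
  proof -
    have "Des (n - 1) (cyclic_key M (f n) \<circ> f(n := 0)) = Des (n - 1) (cyclic_key M (f n) \<circ> f)" for f
      by (auto simp: Des_def)
    then show ?thesis using mem_rotations_iff[OF n] by auto
  qed
  also have "card \<dots> = (\<Sum>t\<in>set_mset M. card {g \<in> words (n - 1) (M - {#t#}). Des (n - 1) (cyclic_key M t \<circ> g) = J})"
    by (rule card_words_split[OF n, of M "\<lambda>g t. Des (n - 1) (cyclic_key M t \<circ> g) = J"])
  \<comment> \<open>Each \<open>t\<close> has its own cyclic order, but the count uses only that its
    key is injective on the remaining letters.\<close>
  also have "\<dots> = (\<Sum>t\<in>set_mset M. card {g \<in> words (n - 1) (M - {#t#}). Des (n - 1) g = J})"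
    by (intro sum.cong refl card_words_Des_relabel inj_on_subset[OF inj_cyclic_key]) (auto dest: in_diffD)
  also have "of_nat \<dots> = (\<Sum>t\<in>set_mset M. frobenius_ch (n - 1) (character ?V) (M - {#t#}))"
    by (simp add: frobenius_ch_eq sum_character_fixed_words del: One_nat_def)
  also have "\<dots> = frobenius_ch n (character (induced (Sym (n - 1)) (Sym n) ?V)) M"
    by (rule frobenius_ch_induced[OF specht_rep n, symmetric])
  finally show "qsym_of n (mset_set ?B) M = frobenius_ch n (character (induced (Sym (n - 1)) (Sym n) ?V)) M" .
qed

end
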